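(* Let $(B,g_B)$ and $(F,g_F)$ be pseudo-Riemannian manifolds of dimensions $m$ and $k$ with scalar curvatures $S_B$ and $S_F$, let $c,w:B\to(0,\infty)$ be smooth, and equip $B\times F$ with the metric $g=c^2g_B+w^2g_F$. Then the scalar curvature $S$ of $(B\times F,g)$ is given by $$\begin{aligned}c^2S={}&S_B+S_F\frac{c^2}{w^2}-2(m-1)\frac{\Delta_Bc}{c}-2k\frac{\Delta_Bw}{w}-(m-4)(m-1)\frac{g_B(\nabla^Bc,\nabla^Bc)}{c^2}\\&-2k(m-2)\frac{g_B(\nabla^Bw,\nabla^Bc)}{wc}-k(k-1)\frac{g_B(\nabla^Bw,\nabla^Bw)}{w^2}.\end{aligned}$$
   Context: $g=(c\circ\pi)^2\pi^*g_B+(w\circ\pi)^2\sigma^*g_F$ where $\pi:B\times F\to B$ and $\sigma:B\times F\to F$ are the projections (a "base conformal warped product"). Functions on $B$, $F$ are identified with their pullbacks. $\nabla^B$ is the gradient and $\Delta_B$ the Laplace–Beltrami operator (trace of the Hessian) of $(B,g_B)$. Sign convention: $R(X,Y)Z=\nabla_X\nabla_YZ-\nabla_Y\nabla_XZ-\nabla_{[X,Y]}Z$, $\mathrm{Ric}(X,Y)=\sum_i h(E_i,E_i)\,h(R(E_i,Y)X,E_i)$ for an orthonormal frame, scalar curvature is the metric trace of $\mathrm{Ric}$. *)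

theory Defs
  imports "HOL-Analysis.Analysis"
begin

section \<open>Smooth maps between open sets\<close>

primrec Ck_on :: "nat \<Rightarrow> 'a::euclidean_space set \<Rightarrow> ('a \<Rightarrow> 'b::real_normed_vector) \<Rightarrow> bool" where
  "Ck_on 0 S f \<longleftrightarrow> continuous_on S f"
| "Ck_on (Suc n) S f \<longleftrightarrow>
     (\<forall>x\<in>S. f differentiable (at x)) \<and>
     (\<forall>v. Ck_on n S (\<lambda>x. frechet_derivative f (at x) v))"

definition smooth_on :: "'a::euclidean_space set \<Rightarrow> ('a \<Rightarrow> 'b::real_normed_vector) \<Rightarrow> bool" where
  "smooth_on S f \<longleftrightarrow> (\<forall>n. Ck_on n S f)"


section \<open>Smooth manifolds\<close>

text \<open>The dimension of the manifold is the dimension \<open>DIM('e)\<close> of the Euclidean space \<open>'e\<close> in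
  which the charts take their values. A chart is a pair of its domain and its coordinate map;
  coordinate maps are total functions whose values off the domain are irrelevant.\<close>

record ('p, 'e) smooth_structure =
  mtop :: "'p topology"
  charts :: "('p set \<times> ('p \<Rightarrow> 'e)) set"

abbreviation points :: "('p, 'e) smooth_structure \<Rightarrow> 'p set" where
  "points M \<equiv> topspace (mtop M)"

definition smooth_manifold :: "('p, 'e::euclidean_space) smooth_structure \<Rightarrow> bool" where
  "smooth_manifold M \<longleftrightarrow>
     Hausdorff_space (mtop M) \<and> second_countable (mtop M) \<and>
     (\<Union>(U, \<phi>)\<in>charts M. U) = points M \<and>
     (\<forall>(U, \<phi>)\<in>charts M. openin (mtop M) U \<and> open (\<phi> ` U) \<and>
        homeomorphic_map (subtopology (mtop M) U) (top_of_set (\<phi> ` U)) \<phi>) \<and>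
     (\<forall>(U, \<phi>)\<in>charts M. \<forall>(V, \<psi>)\<in>charts M.
        smooth_on (\<phi> ` (U \<inter> V)) (\<psi> \<circ> inv_into U \<phi>))"

definition product_manifold ::
  "('p, 'a) smooth_structure \<Rightarrow> ('q, 'b) smooth_structure \<Rightarrow> ('p \<times> 'q, 'a \<times> 'b) smooth_structure"
  where
  "product_manifold M N =
     \<lparr> mtop = prod_topology (mtop M) (mtop N),
       charts = {(U \<times> V, map_prod \<phi> \<psi>) | U \<phi> V \<psi>. (U, \<phi>) \<in> charts M \<and> (V, \<psi>) \<in> charts N} \<rparr>"

text \<open>Used for open \<open>U\<close> only; the values of \<open>f\<close> off \<open>U\<close> are irrelevant.\<close>

definition smooth_fun_on ::
  "('p, 'e::euclidean_space) smooth_structure \<Rightarrow> 'p set \<Rightarrow> ('p \<Rightarrow> real) \<Rightarrow> bool" where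
  "smooth_fun_on M U f \<longleftrightarrow>
     (\<forall>(V, \<phi>)\<in>charts M. smooth_on (\<phi> ` (U \<inter> V)) (f \<circ> inv_into V \<phi>))"

definition smooth_near ::
  "('p, 'e::euclidean_space) smooth_structure \<Rightarrow> 'p \<Rightarrow> ('p \<Rightarrow> real) \<Rightarrow> bool" where
  "smooth_near M p f \<longleftrightarrow> (\<exists>U. openin (mtop M) U \<and> p \<in> U \<and> smooth_fun_on M U f)"


section \<open>Tangent vectors and vector fields\<close>

text \<open>Tangent vectors at \<open>p\<close> act as directional derivatives on the functions that are smooth
  near \<open>p\<close>. As HOL functions are total, their value on all other functions is fixed to be \<open>0\<close>,
  so that equality of tangent vectors is equality of functionals.\<close>

type_synonym 'p tvec = "('p \<Rightarrow> real) \<Rightarrow> real"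

definition coord_vector ::
  "('p, 'e::euclidean_space) smooth_structure \<Rightarrow> 'p set \<times> ('p \<Rightarrow> 'e) \<Rightarrow> 'p \<Rightarrow> 'e \<Rightarrow> 'p tvec" where
  "coord_vector M = (\<lambda>(U, \<phi>) p v f.
     if smooth_near M p f then frechet_derivative (f \<circ> inv_into U \<phi>) (at (\<phi> p)) v else 0)"

definition tangent_space ::
  "('p, 'e::euclidean_space) smooth_structure \<Rightarrow> 'p \<Rightarrow> 'p tvec set" where
  "tangent_space M p = {coord_vector M (U, \<phi>) p v | U \<phi> v. (U, \<phi>) \<in> charts M \<and> p \<in> U}"

definition tadd :: "'p tvec \<Rightarrow> 'p tvec \<Rightarrow> 'p tvec" where
  "tadd u v = (\<lambda>f. u f + v f)"

definition tscale :: "real \<Rightarrow> 'p tvec \<Rightarrow> 'p tvec" where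
  "tscale a u = (\<lambda>f. a * u f)"

definition pushforward ::
  "('q, 'b::euclidean_space) smooth_structure \<Rightarrow> ('p \<Rightarrow> 'q) \<Rightarrow> 'p \<Rightarrow> 'p tvec \<Rightarrow> 'q tvec" where
  "pushforward N \<Phi> p u = (\<lambda>f. if smooth_near N (\<Phi> p) f then u (f \<circ> \<Phi>) else 0)"

definition vector_field_on ::
  "('p, 'e::euclidean_space) smooth_structure \<Rightarrow> 'p set \<Rightarrow> ('p \<Rightarrow> 'p tvec) \<Rightarrow> bool" where
  "vector_field_on M U X \<longleftrightarrow>
     (\<forall>p\<in>U. X p \<in> tangent_space M p) \<and>
     (\<forall>W f. openin (mtop M) W \<and> W \<subseteq> U \<and> smooth_fun_on M W f \<longrightarrow>
        smooth_fun_on M W (\<lambda>p. X p f))"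

definition lie_bracket ::
  "('p, 'e::euclidean_space) smooth_structure \<Rightarrow>
    ('p \<Rightarrow> 'p tvec) \<Rightarrow> ('p \<Rightarrow> 'p tvec) \<Rightarrow> 'p \<Rightarrow> 'p tvec" where
  "lie_bracket M X Y p = (\<lambda>f.
     if smooth_near M p f then X p (\<lambda>q. Y q f) - Y p (\<lambda>q. X q f) else 0)"


section \<open>Pseudo-Riemannian metrics\<close>

type_synonym 'p metric_field = "'p \<Rightarrow> 'p tvec \<Rightarrow> 'p tvec \<Rightarrow> real"

definition pseudo_riemannian ::
  "('p, 'e::euclidean_space) smooth_structure \<Rightarrow> 'p metric_field \<Rightarrow> bool" where
  "pseudo_riemannian M h \<longleftrightarrow>
     smooth_manifold M \<and>
     (\<forall>p\<in>points M.
        (\<forall>u\<in>tangent_space M p. \<forall>v\<in>tangent_space M p. h p u v = h p v u) \<and>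
        (\<forall>u\<in>tangent_space M p. \<forall>u'\<in>tangent_space M p. \<forall>v\<in>tangent_space M p. \<forall>a.
           h p (tadd (tscale a u) u') v = a * h p u v + h p u' v) \<and>
        (\<forall>u\<in>tangent_space M p. (\<forall>v\<in>tangent_space M p. h p u v = 0) \<longrightarrow> u = (\<lambda>f. 0))) \<and>
     (\<forall>U X Y. openin (mtop M) U \<and> vector_field_on M U X \<and> vector_field_on M U Y \<longrightarrow>
        smooth_fun_on M U (\<lambda>p. h p (X p) (Y p)))"

definition pullback_metric ::
  "('q, 'b::euclidean_space) smooth_structure \<Rightarrow> ('p \<Rightarrow> 'q) \<Rightarrow> 'q metric_field \<Rightarrow> 'p metric_field"
  where
  "pullback_metric N \<Phi> h p u v = h (\<Phi> p) (pushforward N \<Phi> p u) (pushforward N \<Phi> p v)"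

definition warped_metric ::
  "('p, 'a::euclidean_space) smooth_structure \<Rightarrow> 'p metric_field \<Rightarrow>
   ('q, 'b::euclidean_space) smooth_structure \<Rightarrow> 'q metric_field \<Rightarrow>
   ('p \<Rightarrow> real) \<Rightarrow> ('p \<Rightarrow> real) \<Rightarrow> ('p \<times> 'q) metric_field" where
  "warped_metric B gB F gF c w x u v =
     ((c \<circ> fst) x)\<^sup>2 * pullback_metric B fst gB x u v +
     ((w \<circ> fst) x)\<^sup>2 * pullback_metric F snd gF x u v"


section \<open>The Levi-Civita connection\<close>

text \<open>A connection acts on the smooth vector fields over each open set \<open>U\<close>. As vector fields are
  represented by total functions, the first condition on \<open>D\<close> says that only their values on \<open>U\<close>
  matter, i.e. that \<open>D\<close> is compatible with restriction to smaller open sets.\<close>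

definition is_levi_civita ::
  "('p, 'e::euclidean_space) smooth_structure \<Rightarrow> 'p metric_field \<Rightarrow>
    (('p \<Rightarrow> 'p tvec) \<Rightarrow> ('p \<Rightarrow> 'p tvec) \<Rightarrow> 'p \<Rightarrow> 'p tvec) \<Rightarrow> bool" where
  "is_levi_civita M h D \<longleftrightarrow>
     (\<forall>U X Y X' Y'. openin (mtop M) U \<and>
        vector_field_on M U X \<and> vector_field_on M U Y \<and>
        vector_field_on M U X' \<and> vector_field_on M U Y' \<and>
        (\<forall>p\<in>U. X p = X' p \<and> Y p = Y' p) \<longrightarrow> (\<forall>p\<in>U. D X Y p = D X' Y' p)) \<and>
     (\<forall>U X Y Z f. openin (mtop M) U \<and>
        vector_field_on M U X \<and> vector_field_on M U Y \<and> vector_field_on M U Z \<and>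
        smooth_fun_on M U f \<longrightarrow>
        vector_field_on M U (D X Y) \<and>
        (\<forall>p\<in>U.
           D (\<lambda>q. tadd (X q) (Y q)) Z p = tadd (D X Z p) (D Y Z p) \<and>
           D (\<lambda>q. tscale (f q) (X q)) Y p = tscale (f p) (D X Y p) \<and>
           D X (\<lambda>q. tadd (Y q) (Z q)) p = tadd (D X Y p) (D X Z p) \<and>
           D X (\<lambda>q. tscale (f q) (Y q)) p =
             tadd (tscale (X p f) (Y p)) (tscale (f p) (D X Y p)) \<and>
           D X Y p = tadd (D Y X p) (lie_bracket M X Y p) \<and>
           X p (\<lambda>q. h q (Y q) (Z q)) = h p (D X Y p) (Z p) + h p (Y p) (D X Z p)))"

definition levi_civita ::
  "('p, 'e::euclidean_space) smooth_structure \<Rightarrow> 'p metric_field \<Rightarrow>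
    ('p \<Rightarrow> 'p tvec) \<Rightarrow> ('p \<Rightarrow> 'p tvec) \<Rightarrow> 'p \<Rightarrow> 'p tvec" where
  "levi_civita M h = (SOME D. is_levi_civita M h D)"


section \<open>Curvature\<close>

text \<open>The constructions below are tensorial, so they may be evaluated on single tangent vectors by
  means of arbitrary local extensions of these to smooth vector fields.\<close>

definition local_extension ::
  "('p, 'e::euclidean_space) smooth_structure \<Rightarrow> 'p \<Rightarrow> 'p tvec \<Rightarrow> 'p \<Rightarrow> 'p tvec" where
  "local_extension M p u =
     (SOME X. (\<exists>U. openin (mtop M) U \<and> p \<in> U \<and> vector_field_on M U X) \<and> X p = u)"

definition curvature ::
  "('p, 'e::euclidean_space) smooth_structure \<Rightarrow> 'p metric_field \<Rightarrow>
    ('p \<Rightarrow> 'p tvec) \<Rightarrow> ('p \<Rightarrow> 'p tvec) \<Rightarrow> ('p \<Rightarrow> 'p tvec) \<Rightarrow> 'p \<Rightarrow> 'p tvec" where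
  "curvature M h X Y Z p =
     (let D = levi_civita M h in
      (\<lambda>f. D X (D Y Z) p f - D Y (D X Z) p f - D (lie_bracket M X Y) Z p f))"

definition curvature_at ::
  "('p, 'e::euclidean_space) smooth_structure \<Rightarrow> 'p metric_field \<Rightarrow> 'p \<Rightarrow>
    'p tvec \<Rightarrow> 'p tvec \<Rightarrow> 'p tvec \<Rightarrow> 'p tvec" where
  "curvature_at M h p u v z =
     curvature M h (local_extension M p u) (local_extension M p v) (local_extension M p z) p"

text \<open>\<open>DIM('e)\<close> pairwise orthogonal vectors of square \<open>\<plusminus>1\<close>, hence a basis of the tangent space.\<close>

definition orthonormal_frame ::
  "('p, 'e::euclidean_space) smooth_structure \<Rightarrow> 'p metric_field \<Rightarrow> 'p \<Rightarrow> (nat \<Rightarrow> 'p tvec) \<Rightarrow> bool"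
  where
  "orthonormal_frame M h p E \<longleftrightarrow>
     (\<forall>i<DIM('e). E i \<in> tangent_space M p \<and> \<bar>h p (E i) (E i)\<bar> = 1 \<and>
        (\<forall>j<DIM('e). i \<noteq> j \<longrightarrow> h p (E i) (E j) = 0))"

definition metric_trace ::
  "('p, 'e::euclidean_space) smooth_structure \<Rightarrow> 'p metric_field \<Rightarrow> 'p \<Rightarrow>
    ('p tvec \<Rightarrow> 'p tvec \<Rightarrow> real) \<Rightarrow> real" where
  "metric_trace M h p T =
     (let E = (SOME E. orthonormal_frame M h p E)
      in \<Sum>i<DIM('e). h p (E i) (E i) * T (E i) (E i))"

definition ricci ::
  "('p, 'e::euclidean_space) smooth_structure \<Rightarrow> 'p metric_field \<Rightarrow> 'p \<Rightarrow>
    'p tvec \<Rightarrow> 'p tvec \<Rightarrow> real" where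
  "ricci M h p x y = metric_trace M h p (\<lambda>e e'. h p (curvature_at M h p e y x) e')"

definition scalar_curvature ::
  "('p, 'e::euclidean_space) smooth_structure \<Rightarrow> 'p metric_field \<Rightarrow> 'p \<Rightarrow> real" where
  "scalar_curvature M h p = metric_trace M h p (ricci M h p)"


section \<open>Gradient, Hessian and Laplace--Beltrami operator\<close>

definition gradient ::
  "('p, 'e::euclidean_space) smooth_structure \<Rightarrow> 'p metric_field \<Rightarrow> ('p \<Rightarrow> real) \<Rightarrow> 'p \<Rightarrow> 'p tvec"
  where
  "gradient M h f p =
     (THE t. t \<in> tangent_space M p \<and> (\<forall>u\<in>tangent_space M p. h p t u = u f))"

definition hessian ::
  "('p, 'e::euclidean_space) smooth_structure \<Rightarrow> 'p metric_field \<Rightarrow> ('p \<Rightarrow> real) \<Rightarrow> 'p \<Rightarrow>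
    'p tvec \<Rightarrow> 'p tvec \<Rightarrow> real" where
  "hessian M h f p u v = h p (levi_civita M h (local_extension M p u) (gradient M h f) p) v"

definition laplacian ::
  "('p, 'e::euclidean_space) smooth_structure \<Rightarrow> 'p metric_field \<Rightarrow> ('p \<Rightarrow> real) \<Rightarrow> 'p \<Rightarrow> real" where
  "laplacian M h f p = metric_trace M h p (hessian M h f p)"

end

theory Submission
  imports Defs
begin

text \<open>Every object in the statement is computed in a chart. A metric becomes a smooth family of
  nondegenerate bilinear forms on an open subset of Euclidean space, vector fields become vector-valued
  functions, and Koszul's formula forces any Levi-Civita connection to be given by the Christoffel
  map; that the Christoffel map is smooth is smoothness of the solution of a linear system.
  Conversely the chart formulas agree on overlaps by the same uniqueness argument, so that a
  Levi-Civita connection exists.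

  In a product chart the Christoffel map of the warped metric differs from that of the product
  connection by a tensor built from the logarithmic differentials \<open>dc/c\<close> and \<open>dw/w\<close>. The scalar
  curvature is the double sum of the sectional terms \<open>g (R(u,v)v) u\<close> over a product frame, so only
  four cases (\<open>u\<close> and \<open>v\<close> each tangent to \<open>B\<close> or to \<open>F\<close>) need to be computed.\<close>

section \<open>Calculus of smooth maps\<close>

text \<open>The connection, the frame of a trace and the extension of a tangent vector are picked by
  choice operators. Nothing is known about them before existence is shown, and nothing can be
  computed before independence of the choice is shown. This forces proofs of the existence of a
  Levi-Civita connection, of frames for indefinite forms, and of the tensoriality of curvature.

  The metrics may be indefinite. The sign of the square of a frame vector is kept throughout; it is
  its own inverse, and this replaces positivity.

  Origin of the constants: the conformal change of the base gives -(m-1)(m-2) from the terms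
  quadratic in grad log c, and Hess log c = Hess c / c - (d log c)^2 gives a further 2(m-1),
  together -(m-4)(m-1). The two mixed blocks of the double sum agree, hence the factor 2k. In the
  fibre block the ratio c^2/w^2 cancels the ratio w^2/c^2 in the correction to the fibre curvature,
  so the coefficient k(k-1) carries no power of c.\<close>

abbreviation dd :: "('a::real_normed_vector \<Rightarrow> 'b::real_normed_vector) \<Rightarrow> 'a \<Rightarrow> 'a \<Rightarrow> 'b" where
  "dd f x v \<equiv> frechet_derivative f (at x) v"

lemma has_derivative_cong_open:
  assumes "open S" "x \<in> S" "\<And>y. y \<in> S \<Longrightarrow> f y = g y"
  shows "(f has_derivative f') (at x) \<longleftrightarrow> (g has_derivative f') (at x)"
  using assms has_derivative_transform_within_open[of f f' x UNIV S g]
    has_derivative_transform_within_open[of g f' x UNIV S f] by auto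

lemma has_derivative_transfer_open:
  assumes "(f has_derivative f') (at x)" "open S" "x \<in> S" "\<And>y. y \<in> S \<Longrightarrow> g y = f y"
  shows "(g has_derivative f') (at x)"
  using has_derivative_cong_open[of S x g f f'] assms by simp

lemma dd_cong:
  assumes "open S" "x \<in> S" "\<And>y. y \<in> S \<Longrightarrow> f y = g y"
  shows "dd f x = dd g x"
  unfolding frechet_derivative_def using has_derivative_cong_open[OF assms] by simp

lemma differentiable_cong_open:
  assumes "open S" "x \<in> S" "\<And>y. y \<in> S \<Longrightarrow> f y = g y"
  shows "f differentiable (at x) \<longleftrightarrow> g differentiable (at x)"
  unfolding differentiable_def using has_derivative_cong_open[OF assms] by simp

lemma dd_eqI: "(f has_derivative f') (at x) \<Longrightarrow> dd f x v = f' v"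
  by (metis frechet_derivative_at)

section \<open>Differentiability of finite order and its closure properties\<close>

lemma Ck_on_cong:
  assumes "open S" "\<And>y. y \<in> S \<Longrightarrow> f y = g y"
  shows "Ck_on n S f \<longleftrightarrow> Ck_on n S g"
  using assms
proof (induction n arbitrary: f g)
  case 0
  then show ?case by (simp cong: continuous_on_cong)
next
  case (Suc n)
  have "Ck_on n S (\<lambda>x. dd f x v) \<longleftrightarrow> Ck_on n S (\<lambda>x. dd g x v)" for v
    by (rule Suc.IH) (use Suc.prems dd_cong[of S _ f g] in auto)
  moreover have "(\<forall>x\<in>S. f differentiable (at x)) \<longleftrightarrow> (\<forall>x\<in>S. g differentiable (at x))"
    using differentiable_cong_open[of S _ f g] Suc.prems by blast
  ultimately show ?case by simp
qed

lemma smooth_on_cong: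
  "open S \<Longrightarrow> (\<And>y. y \<in> S \<Longrightarrow> f y = g y) \<Longrightarrow> smooth_on S f \<longleftrightarrow> smooth_on S g"
  unfolding smooth_on_def using Ck_on_cong[of S f g] by blast

lemma smooth_on_transfer:
  assumes "open S" "smooth_on S g" "\<And>y. y \<in> S \<Longrightarrow> f y = g y"
  shows "smooth_on S f"
  by (rule smooth_on_cong[THEN iffD2, OF assms(1) _ assms(2)]) (rule assms(3))

lemma Ck_on_subset: "Ck_on n S f \<Longrightarrow> T \<subseteq> S \<Longrightarrow> Ck_on n T f"
  by (induction n arbitrary: f) (auto intro: continuous_on_subset)

lemma smooth_on_subset: "smooth_on S f \<Longrightarrow> T \<subseteq> S \<Longrightarrow> smooth_on T f"
  unfolding smooth_on_def using Ck_on_subset by blast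

lemma Ck_on_SucD: "Ck_on (Suc n) S f \<Longrightarrow> Ck_on n S f"
proof (induction n arbitrary: f)
  case 0
  then show ?case
    by (auto intro!: continuous_at_imp_continuous_on differentiable_imp_continuous_within)
next
  case (Suc n)
  then show ?case by (metis Ck_on.simps(2))
qed

text \<open>The recursion in \<open>Ck_on\<close> refers to \<open>frechet_derivative\<close>; on an
  open set any pointwise formula for the derivative may replace it. The rules for sums, products and
  composition go through this form.\<close>

lemma Ck_on_SucI:
  assumes "open S" "\<And>x. x \<in> S \<Longrightarrow> (f has_derivative f' x) (at x)"
    "\<And>v. Ck_on n S (\<lambda>x. f' x v)"
  shows "Ck_on (Suc n) S f"
proof -
  have "Ck_on n S (\<lambda>x. dd f x v)" for v
    using Ck_on_cong[OF assms(1), of "\<lambda>x. dd f x v" "\<lambda>x. f' x v"] assms dd_eqI[OF assms(2)] by auto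
  then show ?thesis using assms by (auto simp: differentiable_def)
qed

lemma Ck_on_local:
  assumes "\<And>x. x \<in> S \<Longrightarrow> \<exists>T. open T \<and> x \<in> T \<and> Ck_on n T f"
  shows "Ck_on n S f"
  using assms
proof (induction n arbitrary: f)
  case 0
  have "continuous_on S f"
  proof (rule continuous_at_imp_continuous_on, rule ballI)
    fix x assume "x \<in> S"
    then obtain T where "open T" "x \<in> T" "continuous_on T f" using 0 by auto
    then show "isCont f x" by (simp add: continuous_on_eq_continuous_at)
  qed
  then show ?case by simp
next
  case (Suc n)
  have "Ck_on n S (\<lambda>x. dd f x v)" for v
  proof (rule Suc.IH)
    fix x assume "x \<in> S"
    then show "\<exists>T. open T \<and> x \<in> T \<and> Ck_on n T (\<lambda>x. dd f x v)"
      using Suc.prems by (metis Ck_on.simps(2))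
  qed
  moreover have "\<forall>x\<in>S. f differentiable (at x)"
    using Suc.prems by fastforce
  ultimately show ?case by simp
qed

lemma smooth_on_local:
  assumes "\<And>x. x \<in> S \<Longrightarrow> \<exists>T. open T \<and> x \<in> T \<and> smooth_on T f"
  shows "smooth_on S f"
  unfolding smooth_on_def using Ck_on_local[of S _ f] assms unfolding smooth_on_def by blast

lemma Ck_on_const: "Ck_on n S (\<lambda>x. c)"
  by (induction n arbitrary: c) auto

lemma Ck_on_linear:
  fixes f :: "'a::euclidean_space \<Rightarrow> 'b::real_normed_vector"
  assumes "bounded_linear f"
  shows "Ck_on n S f"
proof (cases n)
  case 0
  then show ?thesis using assms by (simp add: linear_continuous_on)
next
  case (Suc k)
  have "dd f x = f" for x using assms
    by (metis bounded_linear_imp_has_derivative frechet_derivative_at)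
  then show ?thesis unfolding Suc using assms
    by (auto simp: Ck_on_const bounded_linear_imp_differentiable)
qed

lemma Ck_on_bounded_linear:
  assumes "open S" "bounded_linear h" "Ck_on n S f"
  shows "Ck_on n S (\<lambda>x. h (f x))"
  using assms(3)
proof (induction n arbitrary: f)
  case 0
  then show ?case using assms by (auto intro: bounded_linear.continuous_on)
next
  case (Suc n)
  show ?case
  proof (rule Ck_on_SucI[OF assms(1), where f' = "\<lambda>x v. h (dd f x v)"])
    fix x assume "x \<in> S"
    then show "((\<lambda>x. h (f x)) has_derivative (\<lambda>v. h (dd f x v))) (at x)"
      using Suc.prems bounded_linear.has_derivative[OF assms(2)] frechet_derivative_works by fastforce
  qed (use Suc in auto)
qed

lemma Ck_on_add:
  assumes "open S" "Ck_on n S f" "Ck_on n S g"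
  shows "Ck_on n S (\<lambda>x. f x + g x)"
  using assms(2,3)
proof (induction n arbitrary: f g)
  case 0
  then show ?case by (auto intro: continuous_intros)
next
  case (Suc n)
  show ?case
  proof (rule Ck_on_SucI[OF assms(1), where f' = "\<lambda>x v. dd f x v + dd g x v"])
    fix x assume "x \<in> S"
    then show "((\<lambda>x. f x + g x) has_derivative (\<lambda>v. dd f x v + dd g x v)) (at x)"
      using Suc.prems by (auto intro!: has_derivative_add simp: frechet_derivative_works)
  qed (use Suc in auto)
qed

lemma Ck_on_sum:
  assumes "open S" "\<And>i. i \<in> I \<Longrightarrow> Ck_on n S (f i)"
  shows "Ck_on n S (\<lambda>x. \<Sum>i\<in>I. f i x)"
  using assms(2)
proof (induction I rule: infinite_finite_induct)
  case (insert i I)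
  then show ?case using assms(1) by (simp add: Ck_on_add)
qed (auto simp: Ck_on_const)

text \<open>By the Leibniz rule the derivative contains \<open>f\<close> and \<open>g\<close>
  themselves, so the induction also needs both of them one order lower, which
  \<open>Ck_on_SucD\<close> provides.\<close>

lemma Ck_on_bilinear:
  assumes "open S" "bounded_bilinear h" "Ck_on n S f" "Ck_on n S g"
  shows "Ck_on n S (\<lambda>x. h (f x) (g x))"
  using assms(3,4)
proof (induction n arbitrary: f g)
  case 0
  then show ?case using bounded_bilinear.continuous_on[OF assms(2)] by auto
next
  case (Suc n)
  show ?case
  proof (rule Ck_on_SucI[OF assms(1), where f' = "\<lambda>x v. h (f x) (dd g x v) + h (dd f x v) (g x)"])
    fix x assume "x \<in> S"
    then show "((\<lambda>x. h (f x) (g x)) has_derivative (\<lambda>v. h (f x) (dd g x v) + h (dd f x v) (g x))) (at x)"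
      using Suc.prems by (auto intro!: bounded_bilinear.FDERIV[OF assms(2)] simp: frechet_derivative_works)
  next
    show "Ck_on n S (\<lambda>x. h (f x) (dd g x v) + h (dd f x v) (g x))" for v
      by (intro Ck_on_add assms Suc.IH) (use Suc.prems Ck_on_SucD[OF Suc.prems(1)] Ck_on_SucD[OF Suc.prems(2)] in auto)
  qed
qed

lemma linear_basis_sum:
  fixes L :: "'a::euclidean_space \<Rightarrow> 'b::real_vector"
  assumes "linear L"
  shows "L u = (\<Sum>b\<in>Basis. (u \<bullet> b) *\<^sub>R L b)"
  by (subst euclidean_representation[symmetric, of u]) (simp add: assms linear_sum linear_cmul)

text \<open>\<open>Ck_on\<close> controls derivatives in a fixed direction, whereas the chain rule
  evaluates \<open>dd g\<close> at the moving direction \<open>dd f x v\<close>. Expanding that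
  direction in the standard basis turns the derivative into a finite sum of products of functions of
  order \<open>n\<close>.\<close>

lemma Ck_on_compose:
  fixes f :: "'a::euclidean_space \<Rightarrow> 'b::euclidean_space" and g :: "'b \<Rightarrow> 'c::real_normed_vector"
  assumes "open S" "open T" "f ` S \<subseteq> T" "Ck_on n S f" "Ck_on n T g"
  shows "Ck_on n S (\<lambda>x. g (f x))"
  using assms(4,5)
proof (induction n arbitrary: g)
  case 0
  then show ?case using assms(3) continuous_on_compose2[of T g S f] by simp
next
  case (Suc n)
  show ?case
  proof (rule Ck_on_SucI[OF assms(1), where f' = "\<lambda>x v. \<Sum>b\<in>Basis. (dd f x v \<bullet> b) *\<^sub>R dd g (f x) b"])
    fix x assume x: "x \<in> S"
    have f: "(f has_derivative dd f x) (at x)" using x Suc.prems by (auto simp: frechet_derivative_works)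
    have g: "(g has_derivative dd g (f x)) (at (f x))"
      using x assms(3) Suc.prems by (auto simp: frechet_derivative_works)
    have "linear (dd g (f x))" using g has_derivative_linear by blast
    then have *: "dd g (f x) u = (\<Sum>b\<in>Basis. (u \<bullet> b) *\<^sub>R dd g (f x) b)" for u
      by (rule linear_basis_sum)
    show "((\<lambda>x. g (f x)) has_derivative (\<lambda>v. \<Sum>b\<in>Basis. (dd f x v \<bullet> b) *\<^sub>R dd g (f x) b)) (at x)"
      using has_derivative_compose[OF f g] by (simp only: *[symmetric])
  next
    have "Ck_on n S (\<lambda>x. dd g (f x) b)" for b
      using Suc.IH[of "\<lambda>y. dd g y b"] Ck_on_SucD[OF Suc.prems(1)] Suc.prems(2) by simp
    moreover have "Ck_on n S (\<lambda>x. dd f x v \<bullet> b)" for v b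
      by (rule Ck_on_bounded_linear[OF assms(1) bounded_linear_inner_left]) (use Suc.prems(1) in simp)
    ultimately show "Ck_on n S (\<lambda>x. \<Sum>b\<in>Basis. (dd f x v \<bullet> b) *\<^sub>R dd g (f x) b)" for v
      by (intro Ck_on_sum[OF assms(1)] Ck_on_bilinear[OF assms(1) bounded_bilinear_scaleR])
  qed
qed

section \<open>Smooth maps and linear maps depending on a parameter\<close>

lemma smooth_on_const: "smooth_on S (\<lambda>x. c)"
  by (simp add: smooth_on_def Ck_on_const)

lemma smooth_on_bounded_linear: "bounded_linear f \<Longrightarrow> smooth_on S f"
  by (simp add: smooth_on_def Ck_on_linear)

lemma smooth_on_bounded_linear_compose:
  "open S \<Longrightarrow> bounded_linear h \<Longrightarrow> smooth_on S f \<Longrightarrow> smooth_on S (\<lambda>x. h (f x))"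
  by (simp add: smooth_on_def Ck_on_bounded_linear)

lemma smooth_on_add:
  "open S \<Longrightarrow> smooth_on S f \<Longrightarrow> smooth_on S g \<Longrightarrow> smooth_on S (\<lambda>x. f x + g x)"
  by (simp add: smooth_on_def Ck_on_add)

lemma smooth_on_minus:
  "open S \<Longrightarrow> smooth_on S f \<Longrightarrow> smooth_on S (\<lambda>x. - f x)"
  by (rule smooth_on_bounded_linear_compose) (auto intro: bounded_linear_minus bounded_linear_ident)

lemma smooth_on_diff:
  "open S \<Longrightarrow> smooth_on S f \<Longrightarrow> smooth_on S g \<Longrightarrow> smooth_on S (\<lambda>x. f x - g x)"
  using smooth_on_add[of S f "\<lambda>x. - g x"] smooth_on_minus[of S g] by simp

lemma smooth_on_sum:
  "open S \<Longrightarrow> (\<And>i. i \<in> I \<Longrightarrow> smooth_on S (f i)) \<Longrightarrow> smooth_on S (\<lambda>x. \<Sum>i\<in>I. f i x)"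
  by (simp add: smooth_on_def Ck_on_sum)

lemma smooth_on_bilinear:
  "open S \<Longrightarrow> bounded_bilinear h \<Longrightarrow> smooth_on S f \<Longrightarrow> smooth_on S g \<Longrightarrow> smooth_on S (\<lambda>x. h (f x) (g x))"
  by (simp add: smooth_on_def Ck_on_bilinear)

lemmas smooth_on_scaleR = smooth_on_bilinear[OF _ bounded_bilinear_scaleR]
lemmas smooth_on_mult = smooth_on_bilinear[OF _ bounded_bilinear_mult]
lemmas smooth_on_inner_left = smooth_on_bounded_linear_compose[OF _ bounded_linear_inner_left]

lemma smooth_on_power:
  fixes f :: "'a::euclidean_space \<Rightarrow> real"
  shows "open S \<Longrightarrow> smooth_on S f \<Longrightarrow> smooth_on S (\<lambda>x. f x ^ n)"
  by (induction n) (simp_all add: smooth_on_const smooth_on_mult)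

lemma smooth_on_compose:
  fixes f :: "'a::euclidean_space \<Rightarrow> 'b::euclidean_space"
  shows "open S \<Longrightarrow> open T \<Longrightarrow> f ` S \<subseteq> T \<Longrightarrow> smooth_on S f \<Longrightarrow> smooth_on T g \<Longrightarrow> smooth_on S (\<lambda>x. g (f x))"
  by (simp add: smooth_on_def Ck_on_compose)

lemma smooth_on_dd: "smooth_on S f \<Longrightarrow> smooth_on S (\<lambda>x. dd f x v)"
  unfolding smooth_on_def by (metis Ck_on.simps(2))

lemma smooth_on_differentiable: "smooth_on S f \<Longrightarrow> x \<in> S \<Longrightarrow> f differentiable (at x)"
  unfolding smooth_on_def by (metis Ck_on.simps(2))

lemma smooth_on_has_derivative: "smooth_on S f \<Longrightarrow> x \<in> S \<Longrightarrow> (f has_derivative dd f x) (at x)"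
  using smooth_on_differentiable frechet_derivative_works by blast

lemma smooth_on_linear_dd: "smooth_on S f \<Longrightarrow> x \<in> S \<Longrightarrow> linear (dd f x)"
  using smooth_on_has_derivative has_derivative_linear by blast

lemma smooth_on_continuous_on: "smooth_on S f \<Longrightarrow> continuous_on S f"
  unfolding smooth_on_def by (metis Ck_on.simps(1))

text \<open>Passes from fixed to moving arguments: regularity of a field of linear maps is recorded
  for each constant vector, and the expansion of \<open>\<eta> y\<close> in the basis recovers the
  general case.\<close>

lemma Ck_on_apply:
  fixes L :: "'a::euclidean_space \<Rightarrow> 'b::euclidean_space \<Rightarrow> 'c::real_normed_vector"
  assumes "open S" "\<And>y. y \<in> S \<Longrightarrow> linear (L y)" "\<And>i. Ck_on n S (\<lambda>y. L y i)" "Ck_on n S \<eta>"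
  shows "Ck_on n S (\<lambda>y. L y (\<eta> y))"
proof -
  have "Ck_on n S (\<lambda>y. \<eta> y \<bullet> b)" for b
    by (rule Ck_on_bounded_linear[OF assms(1) bounded_linear_inner_left assms(4)])
  then have "Ck_on n S (\<lambda>y. \<Sum>b\<in>Basis. (\<eta> y \<bullet> b) *\<^sub>R L y b)"
    using assms(3) by (intro Ck_on_sum[OF assms(1)] Ck_on_bilinear[OF assms(1) bounded_bilinear_scaleR])
  moreover have "L y (\<eta> y) = (\<Sum>b\<in>Basis. (\<eta> y \<bullet> b) *\<^sub>R L y b)" if "y \<in> S" for y
    using linear_basis_sum[OF assms(2)[OF that]] .
  ultimately show ?thesis using Ck_on_cong[OF assms(1), of "\<lambda>y. L y (\<eta> y)"] by simp
qed

lemma smooth_on_apply: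
  fixes L :: "'a::euclidean_space \<Rightarrow> 'b::euclidean_space \<Rightarrow> 'c::real_normed_vector"
  assumes "open S" "\<And>y. y \<in> S \<Longrightarrow> linear (L y)" "\<And>i. smooth_on S (\<lambda>y. L y i)" "smooth_on S \<eta>"
  shows "smooth_on S (\<lambda>y. L y (\<eta> y))"
  unfolding smooth_on_def
proof
  show "Ck_on n S (\<lambda>y. L y (\<eta> y))" for n
    by (rule Ck_on_apply[OF assms(1,2)]) (use assms(3,4) smooth_on_def in \<open>auto simp: smooth_on_def\<close>)
qed

text \<open>Product rule for evaluation: one summand differentiates the map with its argument frozen
  at \<open>\<eta> x\<close>, the other moves the argument only. Derivatives of metric and
  connection terms are all taken in this shape.\<close>

lemma has_derivative_apply:
  fixes L :: "'a::euclidean_space \<Rightarrow> 'b::euclidean_space \<Rightarrow> 'c::real_normed_vector"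
  assumes S: "open S" "x \<in> S" and lin: "\<And>y. y \<in> S \<Longrightarrow> linear (L y)"
    and dif: "\<And>i. (\<lambda>y. L y i) differentiable (at x)" and \<eta>: "(\<eta> has_derivative \<eta>') (at x)"
  shows "((\<lambda>y. L y (\<eta> y)) has_derivative (\<lambda>v. dd (\<lambda>y. L y (\<eta> x)) x v + L x (\<eta>' v))) (at x)"
proof -
  have d: "((\<lambda>y. L y i) has_derivative dd (\<lambda>y. L y i) x) (at x)" for i
    using dif frechet_derivative_works by blast
  have 1: "((\<lambda>y. \<Sum>b\<in>Basis. (\<eta> y \<bullet> b) *\<^sub>R L y b) has_derivative
      (\<lambda>v. \<Sum>b\<in>Basis. (\<eta> x \<bullet> b) *\<^sub>R dd (\<lambda>y. L y b) x v + (\<eta>' v \<bullet> b) *\<^sub>R L x b)) (at x)"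
    by (intro has_derivative_sum has_derivative_scaleR d
        has_derivative_inner_left \<eta>)
  have "((\<lambda>y. \<Sum>b\<in>Basis. (\<eta> x \<bullet> b) *\<^sub>R L y b) has_derivative
      (\<lambda>v. \<Sum>b\<in>Basis. (\<eta> x \<bullet> b) *\<^sub>R dd (\<lambda>y. L y b) x v)) (at x)"
    by (intro has_derivative_sum has_derivative_scaleR_right d)
  then have "((\<lambda>y. L y (\<eta> x)) has_derivative
      (\<lambda>v. \<Sum>b\<in>Basis. (\<eta> x \<bullet> b) *\<^sub>R dd (\<lambda>y. L y b) x v)) (at x)"
    by (rule has_derivative_transfer_open[OF _ S]) (rule linear_basis_sum[OF lin])
  then have 2: "dd (\<lambda>y. L y (\<eta> x)) x v = (\<Sum>b\<in>Basis. (\<eta> x \<bullet> b) *\<^sub>R dd (\<lambda>y. L y b) x v)" for v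
    by (rule dd_eqI)
  have 3: "L x (\<eta>' v) = (\<Sum>b\<in>Basis. (\<eta>' v \<bullet> b) *\<^sub>R L x b)" for v
    by (rule linear_basis_sum[OF lin[OF S(2)]])
  have "((\<lambda>y. L y (\<eta> y)) has_derivative
      (\<lambda>v. \<Sum>b\<in>Basis. (\<eta> x \<bullet> b) *\<^sub>R dd (\<lambda>y. L y b) x v + (\<eta>' v \<bullet> b) *\<^sub>R L x b)) (at x)"
    by (rule has_derivative_transfer_open[OF 1 S]) (rule linear_basis_sum[OF lin])
  then show ?thesis unfolding 2 3 sum.distrib .
qed

text \<open>Schwarz's theorem: by the mean value theorem the second difference quotient along \<open>u\<close> and \<open>v\<close>
  equals either mixed derivative at some point close to \<open>x\<close>.\<close>

lemma dd_second_real: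
  fixes f :: "'a::euclidean_space \<Rightarrow> real"
  assumes S: "open S" and x: "x \<in> S" and f: "smooth_on S f"
  shows "dd (\<lambda>y. dd f y u) x v = dd (\<lambda>y. dd f y v) x u"
proof -
  obtain r where r: "r > 0" "ball x r \<subseteq> S" using S x openE by blast
  \<comment> \<open>Every point of the parallelogram with sides \<open>s *\<^sub>R u\<close> and
    \<open>s *\<^sub>R v\<close> lies within \<open>s * K\<close> of \<open>x\<close>; the summand 1
    keeps \<open>K\<close> positive when \<open>u = v = 0\<close>.\<close>
  define K where "K = norm u + norm v + 1"
  have K: "K > 0" unfolding K_def by (simp add: add_nonneg_pos)
  have mv: "\<exists>z. z \<in> S \<and> dist x z < \<delta> \<and>
       f (x + s *\<^sub>R u + s *\<^sub>R v) - f (x + s *\<^sub>R u) - f (x + s *\<^sub>R v) + f x = s * s * dd (\<lambda>y. dd f y u) z v"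
    if \<delta>: "\<delta> > 0" "\<delta> \<le> r" and s: "0 < s" "s * K < \<delta>" and uv: "norm u + norm v + 1 = K" for u v \<delta> s
  proof -
    have inB: "dist x (x + a *\<^sub>R u + b *\<^sub>R v) < \<delta>" if "0 \<le> a" "a \<le> s" "0 \<le> b" "b \<le> s" for a b
    proof -
      have "norm (a *\<^sub>R u + b *\<^sub>R v) \<le> a * norm u + b * norm v"
        using norm_triangle_ineq[of "a *\<^sub>R u" "b *\<^sub>R v"] that by simp
      also have "\<dots> \<le> s * norm u + s * norm v" using that by (intro add_mono mult_right_mono) auto
      also have "\<dots> \<le> s * K" using s uv by (simp add: algebra_simps flip: uv)
      finally have "norm (a *\<^sub>R u + b *\<^sub>R v) < \<delta>" using s by simp
      moreover have "dist x (x + a *\<^sub>R u + b *\<^sub>R v) = norm (a *\<^sub>R u + b *\<^sub>R v)"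
        by (metis add.assoc add_diff_cancel_left' dist_commute dist_norm)
      ultimately show ?thesis by simp
    qed
    then have inS: "x + a *\<^sub>R u + b *\<^sub>R v \<in> S" if "0 \<le> a" "a \<le> s" "0 \<le> b" "b \<le> s" for a b
      using that r \<delta> by (meson in_mono less_le_trans mem_ball)
    \<comment> \<open>The second difference is \<open>g s - g 0\<close>. Writing out
      \<open>0 *\<^sub>R v\<close> lets one derivative formula serve both terms.\<close>
    define g where "g = (\<lambda>a. f (x + a *\<^sub>R u + s *\<^sub>R v) - f (x + a *\<^sub>R u + 0 *\<^sub>R v))"
    have dg: "(g has_real_derivative dd f (x + a *\<^sub>R u + s *\<^sub>R v) u - dd f (x + a *\<^sub>R u + 0 *\<^sub>R v) u) (at a)"
      if "0 \<le> a" "a \<le> s" for a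
    proof -
      have *: "((\<lambda>a. f (x + a *\<^sub>R u + b *\<^sub>R v)) has_derivative (\<lambda>h. h * dd f (x + a *\<^sub>R u + b *\<^sub>R v) u)) (at a)"
        if "0 \<le> b" "b \<le> s" for b
      proof -
        have pS: "x + a *\<^sub>R u + b *\<^sub>R v \<in> S" using inS \<open>0 \<le> a\<close> \<open>a \<le> s\<close> that by simp
        have l: "linear (dd f (x + a *\<^sub>R u + b *\<^sub>R v))"
          by (rule smooth_on_linear_dd[OF f pS])
        have "((\<lambda>a. x + a *\<^sub>R u + b *\<^sub>R v) has_derivative (\<lambda>h. h *\<^sub>R u)) (at a)"
          by (auto intro!: derivative_eq_intros)
        then have "((\<lambda>a. f (x + a *\<^sub>R u + b *\<^sub>R v)) has_derivative (\<lambda>h. dd f (x + a *\<^sub>R u + b *\<^sub>R v) (h *\<^sub>R u))) (at a)"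
          by (rule has_derivative_compose) (rule smooth_on_has_derivative[OF f pS])
        then show ?thesis using l by (simp add: linear_cmul)
      qed
      show ?thesis unfolding g_def
        by (rule has_derivative_imp_has_field_derivative[OF has_derivative_diff[OF *[of s] *[of 0]]])
          (use s in \<open>simp_all add: algebra_simps\<close>)
    qed
    obtain a where a: "0 < a" "a < s" "g s - g 0 = s * (dd f (x + a *\<^sub>R u + s *\<^sub>R v) u - dd f (x + a *\<^sub>R u + 0 *\<^sub>R v) u)"
      using MVT2[of 0 s g "\<lambda>a. dd f (x + a *\<^sub>R u + s *\<^sub>R v) u - dd f (x + a *\<^sub>R u + 0 *\<^sub>R v) u"] s dg by auto
    \<comment> \<open>A second use of the mean value theorem, along \<open>v\<close> at the
      intermediate parameter \<open>a\<close>, turns the difference of first derivatives into a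
      mixed derivative.\<close>
    define k where "k = (\<lambda>b. dd f (x + a *\<^sub>R u + b *\<^sub>R v) u)"
    have dk: "(k has_real_derivative dd (\<lambda>y. dd f y u) (x + a *\<^sub>R u + b *\<^sub>R v) v) (at b)"
      if "0 \<le> b" "b \<le> s" for b
    proof -
      have sm: "smooth_on S (\<lambda>y. dd f y u)" using f by (rule smooth_on_dd)
      have pS: "x + a *\<^sub>R u + b *\<^sub>R v \<in> S" using inS a that by simp
      have "((\<lambda>b. x + a *\<^sub>R u + b *\<^sub>R v) has_derivative (\<lambda>h. h *\<^sub>R v)) (at b)"
        by (auto intro!: derivative_eq_intros)
      then have "(k has_derivative (\<lambda>h. dd (\<lambda>y. dd f y u) (x + a *\<^sub>R u + b *\<^sub>R v) (h *\<^sub>R v))) (at b)"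
        unfolding k_def by (rule has_derivative_compose) (rule smooth_on_has_derivative[OF sm pS])
      then show ?thesis
        by (rule has_derivative_imp_has_field_derivative)
          (simp add: linear_cmul[OF smooth_on_linear_dd[OF sm pS]])
    qed
    obtain b where b: "0 < b" "b < s" "k s - k 0 = s * dd (\<lambda>y. dd f y u) (x + a *\<^sub>R u + b *\<^sub>R v) v"
      using MVT2[of 0 s k "\<lambda>b. dd (\<lambda>y. dd f y u) (x + a *\<^sub>R u + b *\<^sub>R v) v"] s dk by auto
    have "f (x + s *\<^sub>R u + s *\<^sub>R v) - f (x + s *\<^sub>R u) - f (x + s *\<^sub>R v) + f x = g s - g 0"
      by (simp add: g_def)
    also have "\<dots> = s * (k s - k 0)" using a(3) by (simp add: k_def)
    finally show ?thesis using b a inB[of a b] inS[of a b]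
      by (intro exI[of _ "x + a *\<^sub>R u + b *\<^sub>R v"]) simp
  qed
  define p where "p = (\<lambda>y. dd (\<lambda>y. dd f y u) y v)"
  define q where "q = (\<lambda>y. dd (\<lambda>y. dd f y v) y u)"
  have cont: "isCont p x" "isCont q x"
    using smooth_on_continuous_on[OF smooth_on_dd[OF smooth_on_dd[OF f]]] S x
    unfolding p_def q_def by (auto simp: continuous_on_eq_continuous_at)
  have "\<bar>p x - q x\<bar> \<le> e" if e: "e > 0" for e
  proof -
    obtain d1 where d1: "d1 > 0" "\<And>y. dist x y < d1 \<Longrightarrow> dist (p y) (p x) < e / 2"
      using cont(1) e unfolding continuous_at_eps_delta by (metis dist_commute half_gt_zero)
    obtain d2 where d2: "d2 > 0" "\<And>y. dist x y < d2 \<Longrightarrow> dist (q y) (q x) < e / 2"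
      using cont(2) e unfolding continuous_at_eps_delta by (metis dist_commute half_gt_zero)
    define \<delta> where "\<delta> = min r (min d1 d2)"
    have \<delta>: "\<delta> > 0" "\<delta> \<le> r" using r d1 d2 by (auto simp: \<delta>_def)
    define s where "s = \<delta> / (2 * K)"
    have s: "s > 0" "s * K < \<delta>" using \<delta> K by (auto simp: s_def)
    obtain z where z: "dist x z < \<delta>"
      "f (x + s *\<^sub>R u + s *\<^sub>R v) - f (x + s *\<^sub>R u) - f (x + s *\<^sub>R v) + f x = s * s * p z"
      using mv[OF \<delta> s, of u v] unfolding K_def p_def by auto
    obtain z' where z': "dist x z' < \<delta>"
      "f (x + s *\<^sub>R v + s *\<^sub>R u) - f (x + s *\<^sub>R v) - f (x + s *\<^sub>R u) + f x = s * s * q z'"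
      using mv[OF \<delta> s, of v u] unfolding K_def q_def by auto
    \<comment> \<open>Exchanging \<open>u\<close> and \<open>v\<close> does not change the second
      difference, so the two mixed derivatives agree at points close to \<open>x\<close>; continuity
      moves both to \<open>x\<close>.\<close>
    have "x + s *\<^sub>R v + s *\<^sub>R u = x + s *\<^sub>R u + s *\<^sub>R v" by (simp add: algebra_simps)
    then have "s * s * p z = s * s * q z'" using z z' by (simp add: algebra_simps)
    then have "p z = q z'" using s by simp
    moreover have "\<bar>p z - p x\<bar> < e / 2" "\<bar>q z' - q x\<bar> < e / 2"
      using d1 d2 z z' by (auto simp: \<delta>_def dist_real_def)
    ultimately show ?thesis by linarith
  qed
  then have "\<bar>p x - q x\<bar> \<le> 0" by (rule field_le_epsilon[of _ 0, simplified])
  then show ?thesis by (simp add: p_def q_def)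
qed

lemma dd_bounded_linear:
  assumes "bounded_linear h" "f differentiable (at x)"
  shows "dd (\<lambda>y. h (f y)) x v = h (dd f x v)"
  by (rule dd_eqI, rule bounded_linear.has_derivative[OF assms(1)])
    (use assms(2) frechet_derivative_works in blast)

lemma dd_second:
  fixes f :: "'a::euclidean_space \<Rightarrow> 'b::euclidean_space"
  assumes S: "open S" and x: "x \<in> S" and f: "smooth_on S f"
  shows "dd (\<lambda>y. dd f y u) x v = dd (\<lambda>y. dd f y v) x u"
proof (rule euclidean_eqI)
  fix b :: 'b assume "b \<in> Basis"
  have *: "dd (\<lambda>y. dd f y u) x v \<bullet> b = dd (\<lambda>y. dd (\<lambda>z. f z \<bullet> b) y u) x v" for u v
  proof -
    have "dd (\<lambda>y. dd f y u) x v \<bullet> b = dd (\<lambda>y. dd f y u \<bullet> b) x v"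
      using dd_bounded_linear[OF bounded_linear_inner_left smooth_on_differentiable[OF smooth_on_dd[OF f] x]]
      by metis
    also have "\<dots> = dd (\<lambda>y. dd (\<lambda>z. f z \<bullet> b) y u) x v"
      using dd_cong[OF S x, of "\<lambda>y. dd f y u \<bullet> b" "\<lambda>y. dd (\<lambda>z. f z \<bullet> b) y u"]
        dd_bounded_linear[OF bounded_linear_inner_left smooth_on_differentiable[OF f]] by metis
    finally show ?thesis .
  qed
  show "dd (\<lambda>y. dd f y u) x v \<bullet> b = dd (\<lambda>y. dd f y v) x u \<bullet> b"
    unfolding * by (rule dd_second_real[OF S x smooth_on_inner_left[OF S f]])
qed

lemma linear_dd_param:
  fixes L :: "'a::euclidean_space \<Rightarrow> 'b::real_vector \<Rightarrow> 'c::real_normed_vector"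
  assumes S: "open S" "x \<in> S" and lin: "\<And>y. y \<in> S \<Longrightarrow> linear (L y)"
    and dif: "\<And>i. (\<lambda>y. L y i) differentiable (at x)"
  shows "linear (\<lambda>u. dd (\<lambda>y. L y u) x v)"
proof (rule linearI)
  have d: "((\<lambda>y. L y i) has_derivative dd (\<lambda>y. L y i) x) (at x)" for i
    using dif frechet_derivative_works by blast
  show "dd (\<lambda>y. L y (u + w)) x v = dd (\<lambda>y. L y u) x v + dd (\<lambda>y. L y w) x v" for u w
    by (rule dd_eqI, rule has_derivative_transfer_open[OF has_derivative_add[OF d[of u] d[of w]] S])
      (simp add: linear_add[OF lin])
  show "dd (\<lambda>y. L y (r *\<^sub>R u)) x v = r *\<^sub>R dd (\<lambda>y. L y u) x v" for r u
    by (rule dd_eqI, rule has_derivative_transfer_open[OF has_derivative_scaleR_right[OF d[of u]] S])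
      (simp add: linear_cmul[OF lin])
qed

section \<open>Nondegenerate symmetric bilinear forms\<close>

definition nondeg_form :: "('e::euclidean_space \<Rightarrow> 'e \<Rightarrow> real) \<Rightarrow> bool" where
  "nondeg_form g \<longleftrightarrow> bilinear g \<and> (\<forall>u v. g u v = g v u) \<and> (\<forall>u. (\<forall>v. g u v = 0) \<longrightarrow> u = 0)"

lemma nondeg_form_bilinear: "nondeg_form g \<Longrightarrow> bilinear g"
  by (simp add: nondeg_form_def)

lemma nondeg_form_sym: "nondeg_form g \<Longrightarrow> g u v = g v u"
  by (simp add: nondeg_form_def)

lemma nondeg_form_zero: "nondeg_form g \<Longrightarrow> (\<And>v. g u v = 0) \<Longrightarrow> u = 0"
  by (simp add: nondeg_form_def)

lemma nondeg_form_eqI: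
  assumes "nondeg_form g" "\<And>z. g u z = g v z"
  shows "u = v"
  using nondeg_form_zero[OF assms(1), of "u - v"] assms(2)
  by (simp add: bilinear_lsub[OF nondeg_form_bilinear[OF assms(1)]])

lemma bilinear_simps:
  assumes "bilinear B"
  shows "B (u + v) z = B u z + B v z" "B (u - v) z = B u z - B v z"
    "B (r *\<^sub>R u) z = r *\<^sub>R B u z" "B z (u + v) = B z u + B z v"
    "B z (u - v) = B z u - B z v" "B z (r *\<^sub>R u) = r *\<^sub>R B z u"
    "B (- u) z = - B u z" "B z (- u) = - B z u" "B 0 z = 0" "B z 0 = 0"
  by (rule bilinear_ladd bilinear_lsub bilinear_lmul bilinear_radd bilinear_rsub bilinear_rmul
      bilinear_lneg bilinear_rneg bilinear_lzero bilinear_rzero, rule assms)+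

lemma linear_functional_to_vector:
  fixes A :: "'a::real_vector \<Rightarrow> 'b::euclidean_space \<Rightarrow> real"
  assumes "\<And>v. linear (\<lambda>u. A u v)"
  shows "linear (\<lambda>u. \<Sum>b\<in>Basis. A u b *\<^sub>R b)"
  using assms by (auto simp: linear_iff scaleR_add_left sum.distrib scaleR_sum_right)

lemma functional_to_vector_inner:
  fixes f :: "'b::euclidean_space \<Rightarrow> real"
  assumes "linear f"
  shows "(\<Sum>b\<in>Basis. f b *\<^sub>R b) \<bullet> v = f v"
  using linear_basis_sum[OF assms, of v]
  by (simp add: inner_sum_left inner_commute[of v] mult.commute)

text \<open>The index-raising (sharp) map of \<open>g\<close>; the description is meaningful for
  nondegenerate \<open>g\<close> and linear \<open>\<alpha>\<close>.\<close>

definition raise :: "('e::euclidean_space \<Rightarrow> 'e \<Rightarrow> real) \<Rightarrow> ('e \<Rightarrow> real) \<Rightarrow> 'e" where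
  "raise g \<alpha> = (THE t. \<forall>z. g t z = \<alpha> z)"

text \<open>The sum is the vector that represents the functional \<open>g u\<close> through the
  Euclidean inner product, so the map is the Gram matrix of \<open>g\<close>. Nondegeneracy is its
  injectivity, and an injective endomorphism is onto, which gives the existence of
  \<open>raise\<close>.\<close>

lemma nondeg_form_inj:
  assumes g: "nondeg_form g"
  shows "linear (\<lambda>u. \<Sum>b\<in>Basis. g u b *\<^sub>R b)" "inj (\<lambda>u. \<Sum>b\<in>Basis. g u b *\<^sub>R b)"
    "(\<Sum>b\<in>Basis. g u b *\<^sub>R b) \<bullet> v = g u v"
proof -
  have b: "\<And>v. linear (\<lambda>u. g u v)" "\<And>v. linear (g v)"
    using nondeg_form_bilinear[OF g] by (auto simp: bilinear_def)
  show l: "linear (\<lambda>u. \<Sum>b\<in>Basis. g u b *\<^sub>R b)"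
    by (rule linear_functional_to_vector[OF b(1)])
  show *: "(\<Sum>b\<in>Basis. g u b *\<^sub>R b) \<bullet> v = g u v" for u v
    by (rule functional_to_vector_inner[OF b(2)])
  show "inj (\<lambda>u. \<Sum>b\<in>Basis. g u b *\<^sub>R b)"
    by (rule injI, rule nondeg_form_eqI[OF g]) (metis *)
qed

lemma raise:
  assumes g: "nondeg_form g" and \<alpha>: "linear \<alpha>"
  shows "g (raise g \<alpha>) z = \<alpha> z"
proof -
  have "surj (\<lambda>u. \<Sum>b\<in>Basis. g u b *\<^sub>R b)"
    by (rule linear_injective_imp_surjective[OF nondeg_form_inj(1,2)[OF g]]) simp
  then obtain t where t: "(\<Sum>b\<in>Basis. g t b *\<^sub>R b) = (\<Sum>b\<in>Basis. \<alpha> b *\<^sub>R b)"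
    using surjD[of "\<lambda>u. \<Sum>b\<in>Basis. g u b *\<^sub>R b"] by metis
  have "g t z = \<alpha> z" for z
    using nondeg_form_inj(3)[OF g, of t z] functional_to_vector_inner[OF \<alpha>, of z] t by simp
  then have "\<exists>!t. \<forall>z. g t z = \<alpha> z"
    using nondeg_form_eqI[OF g] by (intro ex1I[of _ t]) simp_all
  from theI'[OF this] show ?thesis unfolding raise_def by blast
qed

section \<open>Pseudo-orthonormal frames and traces\<close>

definition frame :: "('e::euclidean_space \<Rightarrow> 'e \<Rightarrow> real) \<Rightarrow> (nat \<Rightarrow> 'e) \<Rightarrow> bool" where
  "frame g e \<longleftrightarrow> (\<forall>i<DIM('e). \<bar>g (e i) (e i)\<bar> = 1 \<and> (\<forall>j<DIM('e). i \<noteq> j \<longrightarrow> g (e i) (e j) = 0))"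

text \<open>Gram-Schmidt breaks down on null vectors, so the induction splits off a vector of
  nonzero square and continues in its orthogonal complement. Nondegeneracy is required relative to
  \<open>V\<close>, a condition that the complement inherits.\<close>

lemma subspace_frame_exists:
  fixes g :: "'e::euclidean_space \<Rightarrow> 'e \<Rightarrow> real"
  assumes bil: "bilinear g" and sym: "\<And>u v. g u v = g v u"
    and "subspace V" "dim V = n" "\<And>u. u \<in> V \<Longrightarrow> (\<And>v. v \<in> V \<Longrightarrow> g u v = 0) \<Longrightarrow> u = 0"
  shows "\<exists>e. \<forall>i<n. e i \<in> V \<and> \<bar>g (e i) (e i)\<bar> = 1 \<and> (\<forall>j<n. i \<noteq> j \<longrightarrow> g (e i) (e j) = 0)"
  using assms(3-5)
proof (induction n arbitrary: V)
  case 0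
  then show ?case by simp
next
  case (Suc n)
  note bl = bilinear_ladd[OF bil] bilinear_radd[OF bil] bilinear_lmul[OF bil] bilinear_rmul[OF bil]
    bilinear_lsub[OF bil] bilinear_rsub[OF bil]
  \<comment> \<open>By polarization a symmetric form with vanishing squares on \<open>V\<close>
    vanishes on \<open>V\<close>, against nondegeneracy and positive dimension.\<close>
  have "\<exists>v\<in>V. g v v \<noteq> 0"
  proof (rule ccontr)
    assume "\<not> ?thesis"
    then have z: "g v v = 0" if "v \<in> V" for v using that by blast
    have "g u v = 0" if "u \<in> V" "v \<in> V" for u v
      using z[of "u + v"] z[of u] z[of v] that subspace_add[OF Suc.prems(1)] sym[of v u] by (simp add: bl)
    then have "V \<subseteq> {0}" using Suc.prems(3) by blast
    then have "dim V = 0" using dim_eq_0 by blast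
    then show False using Suc.prems by simp
  qed
  then obtain v where v: "v \<in> V" "g v v \<noteq> 0" by blast
  define e0 where "e0 = (1 / sqrt \<bar>g v v\<bar>) *\<^sub>R v"
  have e0: "e0 \<in> V" unfolding e0_def by (rule subspace_scale[OF Suc.prems(1) v(1)])
  have "sqrt \<bar>g v v\<bar> * sqrt \<bar>g v v\<bar> = \<bar>g v v\<bar>" by simp
  then have g0: "\<bar>g e0 e0\<bar> = 1" using v(2)
    by (simp add: e0_def bl abs_mult)
  define W where "W = {w \<in> V. g w e0 = 0}"
  have W: "subspace W" unfolding W_def using Suc.prems(1)
    by (auto simp: subspace_def bl bilinear_lzero[OF bil])
  \<comment> \<open>Projection along \<open>e0\<close>: the sign \<open>g e0 e0\<close>, being its
    own inverse, stands where a division by the square of \<open>e0\<close> would be.\<close>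
  have split: "u - (g u e0 * g e0 e0) *\<^sub>R e0 \<in> W" if "u \<in> V" for u
  proof -
    have "g e0 e0 * g e0 e0 = 1" using g0 by (metis abs_mult_self_eq mult_1)
    then show ?thesis unfolding W_def using that e0 Suc.prems(1)
      by (auto simp: bl subspace_diff subspace_scale mult.assoc)
  qed
  have "e0 \<notin> span W"
    using W g0 unfolding W_def by (auto simp: span_eq_iff[THEN iffD2])
  then have "dim (insert e0 W) = Suc (dim W)" by (simp add: dim_insert)
  moreover have "span (insert e0 W) = V"
  proof
    show "span (insert e0 W) \<subseteq> V"
      by (rule span_minimal[OF _ Suc.prems(1)]) (use e0 W_def in auto)
    show "V \<subseteq> span (insert e0 W)"
    proof
      fix u assume "u \<in> V"
      then have "u - (g u e0 * g e0 e0) *\<^sub>R e0 \<in> span (insert e0 W)" using split by (simp add: span_base)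
      then have "(u - (g u e0 * g e0 e0) *\<^sub>R e0) + (g u e0 * g e0 e0) *\<^sub>R e0 \<in> span (insert e0 W)"
        by (intro span_add span_scale) (simp_all add: span_base)
      then show "u \<in> span (insert e0 W)" by simp
    qed
  qed
  ultimately have dimW: "dim W = n" using Suc.prems(2) by (metis dim_span nat.inject)
  have ndW: "u = 0" if u: "u \<in> W" "\<And>w. w \<in> W \<Longrightarrow> g u w = 0" for u
  proof (rule Suc.prems(3))
    show "u \<in> V" using u W_def by simp
    fix x assume "x \<in> V"
    then have "g u (x - (g x e0 * g e0 e0) *\<^sub>R e0) = 0" using u split by blast
    then show "g u x = 0" using u(1) by (simp add: bl W_def)
  qed
  obtain e where e: "\<forall>i<n. e i \<in> W \<and> \<bar>g (e i) (e i)\<bar> = 1 \<and> (\<forall>j<n. i \<noteq> j \<longrightarrow> g (e i) (e j) = 0)"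
    using Suc.IH[OF W dimW ndW] by blast
  show ?case
  proof (intro exI allI impI conjI)
    fix i assume i: "i < Suc n"
    show "case_nat e0 e i \<in> V" using i e0 e by (auto simp: W_def split: nat.split)
    show "\<bar>g (case_nat e0 e i) (case_nat e0 e i)\<bar> = 1" using i g0 e by (auto split: nat.split)
    fix j assume "j < Suc n" "i \<noteq> j"
    then show "g (case_nat e0 e i) (case_nat e0 e j) = 0"
      using i e sym by (auto simp: W_def split: nat.split)
  qed
qed

lemma frame_exists:
  fixes g :: "'e::euclidean_space \<Rightarrow> 'e \<Rightarrow> real"
  assumes "nondeg_form g"
  shows "\<exists>e. frame g e"
  using subspace_frame_exists[of g UNIV "DIM('e)"] assms unfolding nondeg_form_def frame_def by auto

lemma frame_sq: "frame g e \<Longrightarrow> i < DIM('e) \<Longrightarrow> g (e i) (e i) * g (e i) (e i) = 1"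
  for g :: "'e::euclidean_space \<Rightarrow> 'e \<Rightarrow> real"
  unfolding frame_def by (metis abs_mult_self_eq mult_1)

lemma frame_sum:
  fixes g :: "'e::euclidean_space \<Rightarrow> 'e \<Rightarrow> real"
  assumes "frame g e" "i < DIM('e)"
  shows "(\<Sum>j<DIM('e). g (e j) (e j) * (g (e i) (e j) * f j)) = f i"
proof -
  have "(\<Sum>j<DIM('e). g (e j) (e j) * (g (e i) (e j) * f j)) = (\<Sum>j<DIM('e). if j = i then f i else 0)"
    by (rule sum.cong) (use assms frame_sq[OF assms] in \<open>auto simp: frame_def simp flip: mult.assoc\<close>)
  then show ?thesis using assms by simp
qed

text \<open>Orthogonal vectors of nonzero square are independent, since pairing a relation with
  \<open>e i\<close> isolates one coefficient; their number is the dimension.\<close>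

lemma frame_span:
  fixes g :: "'e::euclidean_space \<Rightarrow> 'e \<Rightarrow> real"
  assumes g: "nondeg_form g" and e: "frame g e"
  shows "span (e ` {..<DIM('e)}) = UNIV"
proof -
  note bil = nondeg_form_bilinear[OF g]
  have inj: "inj_on e {..<DIM('e)}"
    using e unfolding frame_def inj_on_def by (metis abs_zero lessThan_iff zero_neq_one)
  have "independent (e ` {..<DIM('e)})"
  proof
    assume "dependent (e ` {..<DIM('e)})"
    then obtain u i where u: "i < DIM('e)" "u (e i) \<noteq> 0" "(\<Sum>v\<in>e ` {..<DIM('e)}. u v *\<^sub>R v) = 0"
      by (auto simp: dependent_finite)
    have "g 0 (e i) = (\<Sum>j<DIM('e). u (e j) * g (e j) (e i))"
      using bil unfolding u(3)[symmetric] sum.reindex[OF inj]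
      by (simp add: bilinear_def linear_sum[of "\<lambda>x. g x (e i)"] linear_cmul[of "\<lambda>x. g x (e i)"])
    also have "\<dots> = (\<Sum>j<DIM('e). if j = i then u (e i) * g (e i) (e i) else 0)"
      by (rule sum.cong) (use e u(1) in \<open>auto simp: frame_def\<close>)
    also have "\<dots> = u (e i) * g (e i) (e i)" using u(1) by simp
    finally show False using u frame_sq[OF e u(1)] by (auto simp: bilinear_lzero[OF bil])
  qed
  moreover have "card (e ` {..<DIM('e)}) = DIM('e)" using inj by (simp add: card_image)
  ultimately show ?thesis
    using card_eq_dim[of "e ` {..<DIM('e)}" UNIV] by auto
qed

lemma frame_expansion:
  fixes g :: "'e::euclidean_space \<Rightarrow> 'e \<Rightarrow> real"
  assumes g: "nondeg_form g" and e: "frame g e"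
  shows "(\<Sum>i<DIM('e). (g (e i) (e i) * g v (e i)) *\<^sub>R e i) = v"
proof (rule nondeg_form_eqI[OF g])
  note bil = nondeg_form_bilinear[OF g]
  have lin: "linear (\<lambda>u. g u z)" "linear (g z)" for z using bil by (auto simp: bilinear_def)
  let ?w = "\<Sum>i<DIM('e). (g (e i) (e i) * g v (e i)) *\<^sub>R e i"
  fix z
  show "g ?w z = g v z"
  proof (rule linear_eq_on_span[of "g ?w" "g v" "e ` {..<DIM('e)}"])
    show "linear (g ?w)" "linear (g v)" by (rule lin)+
    show "z \<in> span (e ` {..<DIM('e)})" using frame_span[OF g e] by simp
    fix y assume "y \<in> e ` {..<DIM('e)}"
    then obtain j where j: "j < DIM('e)" "y = e j" by auto
    have "g ?w (e j) = (\<Sum>i<DIM('e). g (e i) (e i) * (g (e j) (e i) * g v (e i)))"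
      by (simp add: linear_sum[OF lin(1)] linear_cmul[OF lin(1)] nondeg_form_sym[OF g, of "e j"] ac_simps)
    also have "\<dots> = g v (e j)" by (rule frame_sum[OF e j(1)])
    finally show "g ?w y = g v y" using j by simp
  qed
qed

text \<open>This makes the chosen frame in a trace harmless. The first arguments are expanded in
  \<open>f\<close>; after exchanging the sums, the inner sum is the expansion of \<open>f j\<close>
  in \<open>e\<close> in the second argument.\<close>

lemma frame_trace_eq:
  fixes g :: "'e::euclidean_space \<Rightarrow> 'e \<Rightarrow> real"
  assumes g: "nondeg_form g" and e: "frame g e" and f: "frame g f" and T: "bilinear T"
  shows "(\<Sum>i<DIM('e). g (e i) (e i) * T (e i) (e i)) = (\<Sum>i<DIM('e). g (f i) (f i) * T (f i) (f i) :: real)"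
proof -
  have lin: "linear (\<lambda>u. T u z)" "linear (T z)" for z using T by (auto simp: bilinear_def)
  have 1: "T (e i) z = (\<Sum>j<DIM('e). g (f j) (f j) * g (e i) (f j) * T (f j) z)" for i z
    by (subst frame_expansion[OF g f, of "e i", symmetric])
      (simp add: linear_sum[OF lin(1)] linear_cmul[OF lin(1)])
  have 2: "T z (f j) = (\<Sum>i<DIM('e). g (e i) (e i) * g (f j) (e i) * T z (e i))" for j z
    by (subst frame_expansion[OF g e, of "f j", symmetric])
      (simp add: linear_sum[OF lin(2)] linear_cmul[OF lin(2)])
  have "(\<Sum>i<DIM('e). g (e i) (e i) * T (e i) (e i)) =
      (\<Sum>i<DIM('e). \<Sum>j<DIM('e). g (e i) (e i) * (g (f j) (f j) * g (e i) (f j) * T (f j) (e i)))"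
    by (intro sum.cong refl, subst 1) (simp only: sum_distrib_left)
  also have "\<dots> = (\<Sum>j<DIM('e). \<Sum>i<DIM('e). g (e i) (e i) * (g (f j) (f j) * g (e i) (f j) * T (f j) (e i)))"
    by (rule sum.swap)
  also have "\<dots> = (\<Sum>j<DIM('e). g (f j) (f j) * (\<Sum>i<DIM('e). g (e i) (e i) * g (f j) (e i) * T (f j) (e i)))"
    unfolding sum_distrib_left
    by (intro sum.cong refl) (simp add: nondeg_form_sym[OF g, of "f _" "e _"] ac_simps)
  also have "\<dots> = (\<Sum>j<DIM('e). g (f j) (f j) * T (f j) (f j))"
    by (intro sum.cong refl) (simp only: flip: 2)
  finally show ?thesis .
qed

definition ftrace :: "('e::euclidean_space \<Rightarrow> 'e \<Rightarrow> real) \<Rightarrow> ('e \<Rightarrow> 'e \<Rightarrow> real) \<Rightarrow> real" where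
  "ftrace g T = (let e = (SOME e. frame g e) in \<Sum>i<DIM('e). g (e i) (e i) * T (e i) (e i))"

lemma ftrace_frame:
  fixes g :: "'e::euclidean_space \<Rightarrow> 'e \<Rightarrow> real"
  assumes "nondeg_form g" "frame g e" "bilinear T"
  shows "ftrace g T = (\<Sum>i<DIM('e). g (e i) (e i) * T (e i) (e i))"
  unfolding ftrace_def Let_def
  by (rule frame_trace_eq) (use assms someI_ex[OF frame_exists] in auto)

text \<open>The frame chosen in \<open>ftrace\<close> depends on \<open>g\<close> alone, so the same
  frame serves for all \<open>u\<close> and \<open>v\<close>.\<close>

lemma bilinear_ftrace:
  assumes "\<And>e e'. bilinear (\<lambda>u v. T u v e e')"
  shows "bilinear (\<lambda>u v. ftrace g (T u v))"
proof -
  have "linear (\<lambda>u. T u v e e')" "linear (\<lambda>v. T u v e e')" for u v e e'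
    using assms by (auto simp: bilinear_def)
  then show ?thesis unfolding ftrace_def bilinear_def Let_def
    by (auto simp: linear_iff sum.distrib algebra_simps sum_distrib_left)
qed

section \<open>Smooth dependence of solutions of linear systems\<close>

text \<open>Where \<open>f\<close> vanishes, the term of the product rule with a derivative of
  \<open>g\<close> drops out, and continuity of \<open>g\<close> is enough.\<close>

lemma has_derivative_mult_zero:
  fixes f g :: "'a::real_normed_vector \<Rightarrow> real"
  assumes f: "(f has_derivative f') (at x)" "f x = 0" and g: "isCont g x"
  shows "((\<lambda>y. g y * f y) has_derivative (\<lambda>h. g x * f' h)) (at x)"
proof -
  have bl: "bounded_linear f'" using f(1) by (rule has_derivative_bounded_linear)
  obtain K where K: "\<And>h. norm (f' h) \<le> norm h * K" using bounded_linear.bounded[OF bl] by blast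
  define E where "E = (\<lambda>y. (1 / norm (y - x)) *\<^sub>R (f y - (f x + f' (y - x))))"
  have E: "(E \<longlongrightarrow> 0) (at x)" using f(1) by (simp add: has_derivative_within E_def)
  have gx: "((\<lambda>y. g y - g x) \<longlongrightarrow> 0) (at x)" using g by (simp add: isCont_def LIM_zero)
  \<comment> \<open>The remainder of the product is \<open>g\<close> times the remainder of
    \<open>f\<close>, plus a part bounded by \<open>\<bar>g y - g x\<bar> * K\<close> because
    \<open>f'\<close> is bounded.\<close>
  have "((\<lambda>y. g y * E y + (g y - g x) * (f' (y - x) / norm (y - x))) \<longlongrightarrow> 0) (at x)"
  proof -
    have "((\<lambda>y. (g y - g x) * (f' (y - x) / norm (y - x))) \<longlongrightarrow> 0) (at x)"
    proof (rule Lim_null_comparison)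
      show "((\<lambda>y. \<bar>g y - g x\<bar> * K) \<longlongrightarrow> 0) (at x)"
        using tendsto_mult_left_zero[OF tendsto_rabs_zero[OF gx]] .
      show "\<forall>\<^sub>F y in at x. norm ((g y - g x) * (f' (y - x) / norm (y - x))) \<le> \<bar>g y - g x\<bar> * K"
      proof (rule eventually_mono[OF eventually_at_filter[THEN iffD2, OF always_eventually]])
        show "\<forall>y. y \<noteq> x \<longrightarrow> y \<in> UNIV \<longrightarrow> y \<noteq> x" by simp
        fix y assume "y \<noteq> x"
        then have "\<bar>f' (y - x)\<bar> / norm (y - x) \<le> K"
          using K[of "y - x"] by (simp add: divide_le_eq mult.commute)
        then show "norm ((g y - g x) * (f' (y - x) / norm (y - x))) \<le> \<bar>g y - g x\<bar> * K"
          using mult_left_mono[of "\<bar>f' (y - x)\<bar> / norm (y - x)" K "\<bar>g y - g x\<bar>"] by (simp add: abs_mult)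
      qed
    qed
    moreover have "((\<lambda>y. g y * E y) \<longlongrightarrow> g x * 0) (at x)"
      using g E by (intro tendsto_mult) (simp_all add: isCont_def)
    ultimately show ?thesis using tendsto_add by fastforce
  qed
  moreover have "(1 / norm (y - x)) *\<^sub>R (g y * f y - (g x * f x + g x * f' (y - x)))
      = g y * E y + (g y - g x) * (f' (y - x) / norm (y - x))" for y
    using f(2) by (simp add: E_def diff_divide_distrib add_divide_distrib algebra_simps)
  ultimately show ?thesis
    using bl by (simp add: has_derivative_within bounded_linear_const_mult)
qed

text \<open>The unknown \<open>t\<close> is determined by \<open>A x (t x) v = b x v\<close> for all
  \<open>v\<close>. Its smoothness is drawn from the equation itself, by an estimate and by
  differentiation, without forming an inverse matrix. Christoffel maps and gradients are both
  solutions, with the metric as \<open>A\<close>.\<close>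

locale linear_system =
  fixes S :: "'a::euclidean_space set" and A :: "'a \<Rightarrow> 'b::euclidean_space \<Rightarrow> 'b \<Rightarrow> real"
  assumes open_S: "open S" and nondeg: "x \<in> S \<Longrightarrow> nondeg_form (A x)"
    and smooth: "smooth_on S (\<lambda>x. A x u v)"
begin

lemma lin: "x \<in> S \<Longrightarrow> linear (A x u)" "x \<in> S \<Longrightarrow> linear (\<lambda>u. A x u v)"
  using nondeg[of x] by (auto simp: nondeg_form_def bilinear_def)

lemma solution_continuous:
  assumes b: "\<And>v. continuous_on S (\<lambda>x. b x v)" and t: "\<And>x v. x \<in> S \<Longrightarrow> A x (t x) v = b x v"
  shows "continuous_on S t"
proof (rule continuous_at_imp_continuous_on, rule ballI)
  fix x assume x: "x \<in> S"
  define L where "L y u = (\<Sum>b\<in>Basis. A y u b *\<^sub>R b)" for y u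
  define \<beta> where "\<beta> y = (\<Sum>v\<in>Basis. b y v *\<^sub>R v)" for y
  define \<epsilon> where "\<epsilon> y = (\<Sum>v\<in>Basis. \<Sum>i\<in>Basis. \<bar>A y i v - A x i v\<bar>)" for y
  have Lt: "L y (t y) = \<beta> y" if "y \<in> S" for y by (simp add: L_def \<beta>_def t[OF that])
  have Llin: "linear (L y)" if "y \<in> S" for y
    using nondeg_form_inj(1)[OF nondeg[OF that]] by (simp add: L_def[abs_def])
  obtain \<kappa> where \<kappa>: "\<kappa> > 0" "\<And>u. \<kappa> * norm u \<le> norm (L x u)"
    using linear_inj_bounded_below_pos[OF Llin[OF x]] nondeg_form_inj(2)[OF nondeg[OF x]]
    by (auto simp: L_def[abs_def])
  have Ldiff: "norm (L y u - L x u) \<le> \<epsilon> y * norm u" if y: "y \<in> S" for y u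
  proof -
    have "L y u - L x u = (\<Sum>v\<in>Basis. (A y u v - A x u v) *\<^sub>R v)"
      by (simp add: L_def sum_subtractf algebra_simps)
    also have "norm \<dots> \<le> (\<Sum>v\<in>Basis. \<bar>A y u v - A x u v\<bar>)"
      by (rule order_trans[OF norm_sum]) simp
    also have "\<dots> \<le> (\<Sum>v\<in>Basis. (\<Sum>i\<in>Basis. \<bar>A y i v - A x i v\<bar>) * norm u)"
    proof (rule sum_mono)
      fix v :: 'b
      have "A y u v - A x u v = (\<Sum>i\<in>Basis. (u \<bullet> i) * (A y i v - A x i v))"
        using linear_basis_sum[OF lin(2)[OF x], of u v] linear_basis_sum[OF lin(2)[OF y], of u v]
        by (simp add: sum_subtractf algebra_simps)
      also have "\<bar>\<dots>\<bar> \<le> (\<Sum>i\<in>Basis. \<bar>u \<bullet> i\<bar> * \<bar>A y i v - A x i v\<bar>)"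
        by (rule order_trans[OF sum_abs]) (simp add: abs_mult)
      also have "\<dots> \<le> (\<Sum>i\<in>Basis. norm u * \<bar>A y i v - A x i v\<bar>)"
        by (intro sum_mono mult_right_mono Basis_le_norm) auto
      finally show "\<bar>A y u v - A x u v\<bar> \<le> (\<Sum>i\<in>Basis. \<bar>A y i v - A x i v\<bar>) * norm u"
        by (simp add: sum_distrib_left mult.commute)
    qed
    finally show ?thesis by (simp add: \<epsilon>_def sum_distrib_right)
  qed
  have contA: "isCont (\<lambda>y. A y u v) x" for u v
    using smooth_on_continuous_on[OF smooth] x open_S by (simp add: continuous_on_eq_continuous_at)
  have "isCont (\<lambda>y. b y v) x" for v
    using b x open_S by (simp add: continuous_on_eq_continuous_at)
  then have "isCont \<beta> x" unfolding \<beta>_def by (intro continuous_intros)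
  then have \<beta>0: "((\<lambda>y. norm (\<beta> y - \<beta> x)) \<longlongrightarrow> 0) (at x)"
    by (simp add: isCont_def LIM_zero tendsto_norm_zero)
  have "isCont \<epsilon> x" unfolding \<epsilon>_def by (intro continuous_intros contA)
  then have \<epsilon>0: "(\<epsilon> \<longlongrightarrow> 0) (at x)" by (simp add: isCont_def \<epsilon>_def)
  have bound: "norm (t y - t x) \<le> (2 / \<kappa>) * (norm (\<beta> y - \<beta> x) + \<epsilon> y * norm (t x))"
    if y: "y \<in> S" and e: "\<epsilon> y < \<kappa> / 2" for y
  proof -
    have "\<epsilon> y \<ge> 0" unfolding \<epsilon>_def by (intro sum_nonneg) simp
    have "\<kappa> * norm (t y - t x) \<le> norm (L x (t y - t x))" by (rule \<kappa>(2))
    also have "L x (t y - t x) = (\<beta> y - \<beta> x) - (L y (t y) - L x (t y))"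
      using Lt[OF y] Lt[OF x] by (simp add: linear_diff[OF Llin[OF x]])
    also have "norm \<dots> \<le> norm (\<beta> y - \<beta> x) + norm (L y (t y) - L x (t y))"
      by (rule norm_triangle_ineq4)
    also have "\<dots> \<le> norm (\<beta> y - \<beta> x) + \<epsilon> y * norm (t y)" using Ldiff[OF y] by simp
    also have "\<epsilon> y * norm (t y) \<le> \<epsilon> y * (norm (t x) + norm (t y - t x))"
      using norm_triangle_sub[of "t y" "t x"] \<open>\<epsilon> y \<ge> 0\<close> by (intro mult_left_mono) auto
    also have "\<dots> \<le> \<epsilon> y * norm (t x) + \<kappa> / 2 * norm (t y - t x)"
      using mult_right_mono[of "\<epsilon> y" "\<kappa> / 2" "norm (t y - t x)"] e by (simp add: distrib_left)
    finally have "\<kappa> / 2 * norm (t y - t x) \<le> norm (\<beta> y - \<beta> x) + \<epsilon> y * norm (t x)" by simp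
    then show ?thesis using \<kappa>(1) by (simp add: field_simps)
  qed
  have "((\<lambda>y. t y - t x) \<longlongrightarrow> 0) (at x)"
  proof (rule Lim_null_comparison)
    have "\<forall>\<^sub>F y in at x. y \<in> S" using open_S x by (rule eventually_at_in_open')
    moreover have "\<forall>\<^sub>F y in at x. \<epsilon> y < \<kappa> / 2" using order_tendstoD(2)[OF \<epsilon>0, of "\<kappa> / 2"] \<kappa>(1) by simp
    ultimately show "\<forall>\<^sub>F y in at x. norm (t y - t x) \<le> (2 / \<kappa>) * (norm (\<beta> y - \<beta> x) + \<epsilon> y * norm (t x))"
      by eventually_elim (rule bound)
    show "((\<lambda>y. (2 / \<kappa>) * (norm (\<beta> y - \<beta> x) + \<epsilon> y * norm (t x))) \<longlongrightarrow> 0) (at x)"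
      using tendsto_mult_right_zero[OF tendsto_add_zero[OF \<beta>0 tendsto_mult_left_zero[OF \<epsilon>0, of "norm (t x)"]], of "2 / \<kappa>"] .
  qed
  then show "isCont t x" by (simp add: isCont_def LIM_zero_iff)
qed

text \<open>In \<open>A x (t y) = b y - (A y - A x) (t y)\<close> the last term is a factor vanishing at \<open>x\<close> times one that
  is merely continuous, so the right-hand side is differentiable at \<open>y = x\<close>.\<close>

lemma solution_differentiable:
  assumes x: "x \<in> S" and b: "\<And>v. (\<lambda>x. b x v) differentiable (at x)"
    and t: "\<And>x v. x \<in> S \<Longrightarrow> A x (t x) v = b x v" and cont: "isCont t x"
  shows "t differentiable (at x)"
proof -
  define L where "L u = (\<Sum>b\<in>Basis. A x u b *\<^sub>R b)" for u
  have L: "linear L" "inj L" using nondeg_form_inj[OF nondeg[OF x]] by (auto simp: L_def[abs_def])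
  obtain R where R: "linear R" "R \<circ> L = id" using linear_injective_left_inverse[OF L] by blast
  have "(\<lambda>y. A x (t y) v) differentiable (at x)" for v
  proof -
    have Ad: "((\<lambda>y. A y i v) has_derivative dd (\<lambda>y. A y i v) x) (at x)" for i
      by (rule smooth_on_has_derivative[OF smooth x])
    have "((\<lambda>y. A y i v - A x i v) has_derivative (\<lambda>h. dd (\<lambda>y. A y i v) x h - 0)) (at x)" for i
      by (rule has_derivative_diff[OF Ad has_derivative_const])
    then have "((\<lambda>y. (t y \<bullet> i) * (A y i v - A x i v)) has_derivative (\<lambda>h. (t x \<bullet> i) * (dd (\<lambda>y. A y i v) x h - 0))) (at x)" for i
      by (rule has_derivative_mult_zero) (use cont in \<open>auto intro: continuous_intros\<close>)
    then have "(\<lambda>y. b y v - (\<Sum>i\<in>Basis. (t y \<bullet> i) * (A y i v - A x i v))) differentiable (at x)"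
      using b by (intro differentiable_diff differentiable_sum) (auto simp: differentiable_def)
    moreover have "A x (t y) v = b y v - (\<Sum>i\<in>Basis. (t y \<bullet> i) * (A y i v - A x i v))" if y: "y \<in> S" for y
      using t[OF y, of v] linear_basis_sum[OF lin(2)[OF x], of "t y" v] linear_basis_sum[OF lin(2)[OF y], of "t y" v]
      by (simp add: sum_subtractf right_diff_distrib)
    ultimately show ?thesis
      using differentiable_cong_open[OF open_S x, of "\<lambda>y. A x (t y) v"] by simp
  qed
  then have "(\<lambda>y. L (t y)) differentiable (at x)"
    unfolding L_def by (intro differentiable_sum differentiable_scaleR) auto
  then have "(\<lambda>y. R (L (t y))) differentiable (at x)"
    using R(1) bounded_linear.has_derivative[OF linear_conv_bounded_linear[THEN iffD1, OF R(1)]]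
    unfolding differentiable_def by blast
  then show ?thesis using R(2) by (simp add: fun_eq_iff)
qed

text \<open>The differentiated equation is a system for \<open>dd t x h\<close> with the same
  \<open>A\<close>. Its right-hand side contains \<open>t\<close> but no derivative of
  \<open>t\<close>, so the induction hypothesis is used twice: for \<open>t\<close> itself, and then
  for the derivative.\<close>

lemma solution_Ck:
  assumes "\<And>v. Ck_on n S (\<lambda>x. b x v)" and "\<And>x v. x \<in> S \<Longrightarrow> A x (t x) v = b x v"
  shows "Ck_on n S t"
  using assms
proof (induction n arbitrary: b t)
  case 0
  then show ?case using solution_continuous[of b t] by simp
next
  case (Suc n)
  have C: "Ck_on n S t" using Suc.IH[of b t] Suc.prems Ck_on_SucD by blast
  have c: "continuous_on S t"
  proof (rule solution_continuous[of b t])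
    show "continuous_on S (\<lambda>x. b x v)" for v
      using Suc.prems(1)[of v] by (auto intro!: continuous_at_imp_continuous_on differentiable_imp_continuous_within)
  qed (rule Suc.prems(2))
  have dif: "t differentiable (at x)" if "x \<in> S" for x
    by (rule solution_differentiable[of x b]) (use that Suc.prems c open_S in \<open>auto simp: continuous_on_eq_continuous_at\<close>)
  have "Ck_on n S (\<lambda>x. dd t x h)" for h
  proof (rule Suc.IH[where b = "\<lambda>x v. dd (\<lambda>y. b y v) x h - dd (\<lambda>y. A y (t x) v) x h"])
    fix x v assume x: "x \<in> S"
    have "((\<lambda>y. A y (t y) v) has_derivative (\<lambda>h. dd (\<lambda>y. A y (t x) v) x h + A x (dd t x h) v)) (at x)"
      by (rule has_derivative_apply[OF open_S x, where L = "\<lambda>y u. A y u v"])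
        (use dif[OF x] lin smooth_on_differentiable[OF smooth x] in \<open>auto simp flip: frechet_derivative_works\<close>)
    then have "dd (\<lambda>y. A y (t y) v) x h = dd (\<lambda>y. A y (t x) v) x h + A x (dd t x h) v"
      by (rule dd_eqI)
    moreover have "dd (\<lambda>y. A y (t y) v) x = dd (\<lambda>y. b y v) x"
      by (rule dd_cong[OF open_S x]) (rule Suc.prems(2))
    ultimately show "A x (dd t x h) v = dd (\<lambda>y. b y v) x h - dd (\<lambda>y. A y (t x) v) x h" by simp
  next
    fix v
    have "Ck_on n S (\<lambda>x. dd (\<lambda>y. A y (t x) v) x h)"
    proof (rule Ck_on_apply[OF open_S, where L = "\<lambda>x u. dd (\<lambda>y. A y u v) x h"])
      show "linear (\<lambda>u. dd (\<lambda>y. A y u v) x h)" if x: "x \<in> S" for x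
        by (rule linear_dd_param[OF open_S x]) (auto intro: lin smooth_on_differentiable[OF smooth x])
      show "Ck_on n S (\<lambda>x. dd (\<lambda>y. A y i v) x h)" for i
        using smooth_on_dd[OF smooth] by (simp add: smooth_on_def)
    qed (rule C)
    then have "Ck_on n S (\<lambda>x. - dd (\<lambda>y. A y (t x) v) x h)"
      by (rule Ck_on_bounded_linear[OF open_S bounded_linear_minus[OF bounded_linear_ident]])
    moreover have "Ck_on n S (\<lambda>x. dd (\<lambda>y. b y v) x h)" using Suc.prems(1) by simp
    ultimately show "Ck_on n S (\<lambda>x. dd (\<lambda>y. b y v) x h - dd (\<lambda>y. A y (t x) v) x h)"
      using Ck_on_add[OF open_S] by fastforce
  qed
  then show ?case using dif by simp
qed

lemma solution_smooth:
  assumes "\<And>v. smooth_on S (\<lambda>x. b x v)" "\<And>x v. x \<in> S \<Longrightarrow> A x (t x) v = b x v"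
  shows "smooth_on S t"
  using assms solution_Ck[of _ b t] by (simp add: smooth_on_def)

end

lemma has_derivative_apply2:
  fixes B :: "'a::euclidean_space \<Rightarrow> 'b::euclidean_space \<Rightarrow> 'c::euclidean_space \<Rightarrow> 'd::real_normed_vector"
  assumes S: "open S" "x \<in> S" and bil: "\<And>y. y \<in> S \<Longrightarrow> bilinear (B y)"
    and dif: "\<And>i j. (\<lambda>y. B y i j) differentiable (at x)"
    and \<eta>: "(\<eta> has_derivative \<eta>') (at x)" and \<zeta>: "(\<zeta> has_derivative \<zeta>') (at x)"
  shows "((\<lambda>y. B y (\<eta> y) (\<zeta> y)) has_derivative
    (\<lambda>v. dd (\<lambda>y. B y (\<eta> x) (\<zeta> x)) x v + B x (\<eta>' v) (\<zeta> x) + B x (\<eta> x) (\<zeta>' v))) (at x)"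
proof -
  have lin: "linear (B y u)" "linear (\<lambda>u. B y u v)" if "y \<in> S" for y u v
    using bil[OF that] by (auto simp: bilinear_def)
  have *: "((\<lambda>y. B y (\<eta> y) j) has_derivative (\<lambda>v. dd (\<lambda>y. B y (\<eta> x) j) x v + B x (\<eta>' v) j)) (at x)" for j
    by (rule has_derivative_apply[OF S, where L = "\<lambda>y u. B y u j"]) (use lin dif \<eta> in auto)
  then have "(\<lambda>y. B y (\<eta> y) j) differentiable (at x)" for j
    unfolding differentiable_def by blast
  then have "((\<lambda>y. B y (\<eta> y) (\<zeta> y)) has_derivative
      (\<lambda>v. dd (\<lambda>y. B y (\<eta> y) (\<zeta> x)) x v + B x (\<eta> x) (\<zeta>' v))) (at x)"
    by (intro has_derivative_apply[OF S, where L = "\<lambda>y. B y (\<eta> y)"] \<zeta> lin)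
  then show ?thesis using dd_eqI[OF *[of "\<zeta> x"]] by simp
qed

lemma smooth_on_apply2:
  fixes B :: "'a::euclidean_space \<Rightarrow> 'b::euclidean_space \<Rightarrow> 'c::euclidean_space \<Rightarrow> 'd::real_normed_vector"
  assumes S: "open S" and bil: "\<And>y. y \<in> S \<Longrightarrow> bilinear (B y)"
    and sm: "\<And>i j. smooth_on S (\<lambda>y. B y i j)" and "smooth_on S \<eta>" "smooth_on S \<zeta>"
  shows "smooth_on S (\<lambda>y. B y (\<eta> y) (\<zeta> y))"
proof (rule smooth_on_apply[OF S, where L = "\<lambda>y. B y (\<eta> y)"])
  show "smooth_on S (\<lambda>y. B y (\<eta> y) j)" for j
    by (rule smooth_on_apply[OF S, where L = "\<lambda>y u. B y u j"]) (use assms in \<open>auto simp: bilinear_def\<close>)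
qed (use assms in \<open>auto simp: bilinear_def\<close>)

section \<open>Metrics on open sets of Euclidean space\<close>

text \<open>Koszul's formula on constant fields, whose brackets vanish: the functional is the
  Christoffel symbol of the first kind, and raising its index gives the second kind.\<close>

definition christoffel ::
  "('e::euclidean_space \<Rightarrow> 'e \<Rightarrow> 'e \<Rightarrow> real) \<Rightarrow> 'e \<Rightarrow> 'e \<Rightarrow> 'e \<Rightarrow> 'e" where
  "christoffel G x u v = raise (G x)
     (\<lambda>z. (dd (\<lambda>y. G y v z) x u + dd (\<lambda>y. G y u z) x v - dd (\<lambda>y. G y u v) x z) / 2)"

text \<open>The curvature of constant fields, so no bracket term appears.\<close>

definition riem ::
  "('e::euclidean_space \<Rightarrow> 'e \<Rightarrow> 'e \<Rightarrow> real) \<Rightarrow> 'e \<Rightarrow> 'e \<Rightarrow> 'e \<Rightarrow> 'e \<Rightarrow> 'e" where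
  "riem G x u v z =
     dd (\<lambda>y. christoffel G y v z) x u - dd (\<lambda>y. christoffel G y u z) x v
     + christoffel G x u (christoffel G x v z) - christoffel G x v (christoffel G x u z)"

definition scal :: "('e::euclidean_space \<Rightarrow> 'e \<Rightarrow> 'e \<Rightarrow> real) \<Rightarrow> 'e \<Rightarrow> real" where
  "scal G x = ftrace (G x) (\<lambda>u v. ftrace (G x) (\<lambda>e e'. G x (riem G x e v u) e'))"

definition covd ::
  "('e::euclidean_space \<Rightarrow> 'e \<Rightarrow> 'e \<Rightarrow> real) \<Rightarrow> ('e \<Rightarrow> 'e) \<Rightarrow> ('e \<Rightarrow> 'e) \<Rightarrow> 'e \<Rightarrow> 'e" where
  "covd G \<xi> \<eta> x = dd \<eta> x (\<xi> x) + christoffel G x (\<xi> x) (\<eta> x)"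

definition bracket :: "('e::real_normed_vector \<Rightarrow> 'e) \<Rightarrow> ('e \<Rightarrow> 'e) \<Rightarrow> 'e \<Rightarrow> 'e" where
  "bracket \<xi> \<eta> x = dd \<eta> x (\<xi> x) - dd \<xi> x (\<eta> x)"

definition cgrad ::
  "('e::euclidean_space \<Rightarrow> 'e \<Rightarrow> 'e \<Rightarrow> real) \<Rightarrow> ('e \<Rightarrow> real) \<Rightarrow> 'e \<Rightarrow> 'e" where
  "cgrad G f x = raise (G x) (dd f x)"

definition hess ::
  "('e::euclidean_space \<Rightarrow> 'e \<Rightarrow> 'e \<Rightarrow> real) \<Rightarrow> ('e \<Rightarrow> real) \<Rightarrow> 'e \<Rightarrow> 'e \<Rightarrow> 'e \<Rightarrow> real" where
  "hess G f x u v = dd (\<lambda>y. dd f y v) x u - dd f x (christoffel G x u v)"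

locale local_metric = linear_system S G
  for S :: "'e::euclidean_space set" and G :: "'e \<Rightarrow> 'e \<Rightarrow> 'e \<Rightarrow> real"
begin

abbreviation \<Gamma> where "\<Gamma> \<equiv> christoffel G"

lemma bil: "x \<in> S \<Longrightarrow> bilinear (G x)" by (rule nondeg_form_bilinear[OF nondeg])
lemma sym: "x \<in> S \<Longrightarrow> G x u v = G x v u" by (rule nondeg_form_sym[OF nondeg])
lemma eqI: "x \<in> S \<Longrightarrow> (\<And>z. G x u z = G x v z) \<Longrightarrow> u = v" by (rule nondeg_form_eqI[OF nondeg])

lemmas G_simps = bilinear_simps[OF bil, unfolded real_scaleR_def]

lemma dG_linear:
  assumes x: "x \<in> S"
  shows "linear (\<lambda>v. dd (\<lambda>y. G y v z) x u)" "linear (\<lambda>z. dd (\<lambda>y. G y v z) x u)"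
    "linear (\<lambda>u. dd (\<lambda>y. G y v z) x u)"
  by (rule linear_dd_param[OF open_S x], rule lin, assumption, rule smooth_on_differentiable[OF smooth x])+
    (rule smooth_on_linear_dd[OF smooth x])

lemma christoffel:
  assumes x: "x \<in> S"
  shows "G x (\<Gamma> x u v) z = (dd (\<lambda>y. G y v z) x u + dd (\<lambda>y. G y u z) x v - dd (\<lambda>y. G y u v) x z) / 2"
  unfolding christoffel_def
  by (rule raise[OF nondeg[OF x]])
    (use dG_linear[OF x] in \<open>auto simp: linear_iff algebra_simps add_divide_distrib diff_divide_distrib\<close>)

lemma christoffel_sym: "x \<in> S \<Longrightarrow> \<Gamma> x u v = \<Gamma> x v u"
proof (rule eqI)
  fix z assume x: "x \<in> S"
  have "dd (\<lambda>y. G y u v) x = dd (\<lambda>y. G y v u) x"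
    by (rule dd_cong[OF open_S x]) (rule sym)
  then show "G x (\<Gamma> x u v) z = G x (\<Gamma> x v u) z" by (simp add: christoffel[OF x])
qed

lemma christoffel_bilinear:
  assumes x: "x \<in> S" shows "bilinear (\<Gamma> x)"
proof -
  have *: "linear (\<Gamma> x u)" for u
  proof (rule linearI; rule eqI[OF x])
    show "G x (\<Gamma> x u (v + w)) z = G x (\<Gamma> x u v + \<Gamma> x u w) z" for v w z
      using dG_linear[OF x] by (simp add: G_simps[OF x] christoffel[OF x] linear_add[of "\<lambda>v. dd (\<lambda>y. G y v z) x u"]
          linear_add[of "\<lambda>z. dd (\<lambda>y. G y v z) x u" for v u] linear_add[of "dd (\<lambda>y. G y u z) x"] field_simps)
    show "G x (\<Gamma> x u (r *\<^sub>R v)) z = G x (r *\<^sub>R \<Gamma> x u v) z" for r v z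
      using dG_linear[OF x] by (simp add: G_simps[OF x] christoffel[OF x] linear_cmul[of "\<lambda>v. dd (\<lambda>y. G y v z) x u"]
          linear_cmul[of "\<lambda>z. dd (\<lambda>y. G y v z) x u" for v u] linear_cmul[of "dd (\<lambda>y. G y u z) x"] field_simps)
  qed
  then show ?thesis unfolding bilinear_def using christoffel_sym[OF x] by (metis (no_types, lifting) ext)
qed

lemmas christoffel_simps = bilinear_simps[OF christoffel_bilinear]

lemma christoffel_smooth: "smooth_on S (\<lambda>x. \<Gamma> x u v)"
proof (rule solution_smooth)
  show "G x (\<Gamma> x u v) z = (dd (\<lambda>y. G y v z) x u + dd (\<lambda>y. G y u z) x v - dd (\<lambda>y. G y u v) x z) * (1 / 2)"
    if "x \<in> S" for x z using christoffel[OF that] by simp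
  show "smooth_on S (\<lambda>x. (dd (\<lambda>y. G y v z) x u + dd (\<lambda>y. G y u z) x v - dd (\<lambda>y. G y u v) x z) * (1 / 2))" for z
    by (intro smooth_on_mult smooth_on_diff smooth_on_add smooth_on_const smooth_on_dd[OF smooth] open_S)
qed

text \<open>Adding two instances of Koszul's formula with \<open>v\<close> and \<open>z\<close>
  exchanged cancels the other derivatives in pairs.\<close>

lemma metric_compatible:
  assumes x: "x \<in> S"
  shows "dd (\<lambda>y. G y v z) x u = G x (\<Gamma> x u v) z + G x v (\<Gamma> x u z)"
proof -
  have "dd (\<lambda>y. G y a b) x = dd (\<lambda>y. G y b a) x" for a b
    by (rule dd_cong[OF open_S x]) (rule sym)
  then show ?thesis using christoffel[OF x, of u v z] christoffel[OF x, of u z v] sym[OF x, of v]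
    by simp
qed

lemma metric_has_derivative:
  assumes x: "x \<in> S" and "(\<eta> has_derivative \<eta>') (at x)" "(\<zeta> has_derivative \<zeta>') (at x)"
  shows "((\<lambda>y. G y (\<eta> y) (\<zeta> y)) has_derivative
    (\<lambda>u. G x (\<eta>' u + \<Gamma> x u (\<eta> x)) (\<zeta> x) + G x (\<eta> x) (\<zeta>' u + \<Gamma> x u (\<zeta> x)))) (at x)"
  using has_derivative_apply2[OF open_S x bil smooth_on_differentiable[OF smooth x] assms(2,3)]
  by (simp add: metric_compatible[OF x] G_simps[OF x] algebra_simps)

lemma christoffel_has_derivative:
  assumes x: "x \<in> S" and "(\<eta> has_derivative \<eta>') (at x)" "(\<zeta> has_derivative \<zeta>') (at x)"
  shows "((\<lambda>y. \<Gamma> y (\<eta> y) (\<zeta> y)) has_derivative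
    (\<lambda>u. dd (\<lambda>y. \<Gamma> y (\<eta> x) (\<zeta> x)) x u + \<Gamma> x (\<eta>' u) (\<zeta> x) + \<Gamma> x (\<eta> x) (\<zeta>' u))) (at x)"
  by (rule has_derivative_apply2[OF open_S x christoffel_bilinear
        smooth_on_differentiable[OF christoffel_smooth x] assms(2,3)])

lemma dchristoffel_linear:
  assumes x: "x \<in> S"
  shows "linear (\<lambda>v. dd (\<lambda>y. \<Gamma> y v z) x u)" "linear (\<lambda>z. dd (\<lambda>y. \<Gamma> y v z) x u)"
    "linear (\<lambda>u. dd (\<lambda>y. \<Gamma> y v z) x u)"
proof -
  show "linear (\<lambda>v. dd (\<lambda>y. \<Gamma> y v z) x u)" "linear (\<lambda>z. dd (\<lambda>y. \<Gamma> y v z) x u)"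
    by (rule linear_dd_param[OF open_S x]; use christoffel_bilinear in \<open>auto simp: bilinear_def\<close>
        | rule smooth_on_differentiable[OF christoffel_smooth x])+
  show "linear (\<lambda>u. dd (\<lambda>y. \<Gamma> y v z) x u)"
    by (rule smooth_on_linear_dd[OF christoffel_smooth x])
qed

lemma riem_linear:
  assumes x: "x \<in> S"
  shows "linear (\<lambda>u. riem G x u v z)" "linear (\<lambda>v. riem G x u v z)" "linear (\<lambda>z. riem G x u v z)"
  using dchristoffel_linear[OF x]
  by (auto simp: riem_def linear_iff christoffel_simps[OF x] algebra_simps)

lemma riem_bilinear:
  assumes x: "x \<in> S"
  shows "bilinear (\<lambda>e e'. G x (riem G x e v u) e')"
  using riem_linear[OF x, unfolded linear_iff] by (auto simp: bilinear_def linear_iff G_simps[OF x])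

lemma ricci_bilinear:
  assumes x: "x \<in> S"
  shows "bilinear (\<lambda>u v. ftrace (G x) (\<lambda>e e'. G x (riem G x e v u) e'))"
  by (rule bilinear_ftrace)
    (use riem_linear[OF x, unfolded linear_iff] in \<open>auto simp: bilinear_def linear_iff G_simps[OF x]\<close>)

lemma scal_frame:
  assumes x: "x \<in> S" and e: "frame (G x) e"
  shows "scal G x = (\<Sum>i<DIM('e). \<Sum>j<DIM('e).
    G x (e i) (e i) * G x (e j) (e j) * G x (riem G x (e j) (e i) (e i)) (e j))"
  unfolding scal_def ftrace_frame[OF nondeg[OF x] e ricci_bilinear[OF x]]
  unfolding ftrace_frame[OF nondeg[OF x] e riem_bilinear[OF x]]
  by (simp add: sum_distrib_left mult.assoc)

section \<open>Covariant derivatives of vector fields in coordinates\<close>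

lemma covd_cong:
  assumes "open T" "x \<in> T" "\<xi> x = \<xi>' x" "\<And>y. y \<in> T \<Longrightarrow> \<eta> y = \<eta>' y"
  shows "covd G \<xi> \<eta> x = covd G \<xi>' \<eta>' x"
  using dd_cong[OF assms(1,2,4)] assms(2-4) by (simp add: covd_def)

lemma covd_smooth:
  assumes "open T" "T \<subseteq> S" "smooth_on T \<xi>" "smooth_on T \<eta>"
  shows "smooth_on T (covd G \<xi> \<eta>)"
  unfolding covd_def[abs_def]
proof (rule smooth_on_add[OF assms(1)])
  show "smooth_on T (\<lambda>x. dd \<eta> x (\<xi> x))"
    by (rule smooth_on_apply[OF assms(1) smooth_on_linear_dd[OF assms(4)] smooth_on_dd[OF assms(4)] assms(3)])
  show "smooth_on T (\<lambda>x. \<Gamma> x (\<xi> x) (\<eta> x))"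
    by (rule smooth_on_apply2[OF assms(1) christoffel_bilinear smooth_on_subset[OF christoffel_smooth assms(2)]
          assms(3,4)]) (use assms(2) in auto)
qed

lemma covd_torsion: "x \<in> S \<Longrightarrow> covd G \<xi> \<eta> x = covd G \<eta> \<xi> x + bracket \<xi> \<eta> x"
  using christoffel_sym[of x "\<xi> x" "\<eta> x"] by (simp add: covd_def bracket_def)

lemma covd_metric:
  assumes x: "x \<in> S" and "\<eta> differentiable (at x)" "\<zeta> differentiable (at x)"
  shows "dd (\<lambda>y. G y (\<eta> y) (\<zeta> y)) x (\<xi> x) = G x (covd G \<xi> \<eta> x) (\<zeta> x) + G x (\<eta> x) (covd G \<xi> \<zeta> x)"
  using dd_eqI[OF metric_has_derivative[OF x assms(2,3)[unfolded frechet_derivative_works]], of "\<xi> x"]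
  by (simp add: covd_def)

text \<open>Koszul's formula, with the third field constant: \<open>nXY\<close> etc. are the values at \<open>x\<close> of a
  torsion-free metric covariant derivative.\<close>

lemma koszul_unique:
  assumes x: "x \<in> S" and d: "\<xi> differentiable (at x)" "\<eta> differentiable (at x)"
    and n: "nXY - nYX = bracket \<xi> \<eta> x" "nXZ - nZX = bracket \<xi> (\<lambda>_. z) x" "nYZ - nZY = bracket \<eta> (\<lambda>_. z) x"
    and m: "dd (\<lambda>y. G y (\<eta> y) z) x (\<xi> x) = G x nXY z + G x (\<eta> x) nXZ"
      "dd (\<lambda>y. G y z (\<xi> y)) x (\<eta> x) = G x nYZ (\<xi> x) + G x z nYX"
      "dd (\<lambda>y. G y (\<xi> y) (\<eta> y)) x z = G x nZX (\<eta> x) + G x (\<xi> x) nZY"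
  shows "G x nXY z = G x (covd G \<xi> \<eta> x) z"
proof -
  note M = covd_metric[OF x d(2), of "\<lambda>_. z" \<xi>] covd_metric[OF x _ d(1), of "\<lambda>_. z" \<eta>]
    covd_metric[OF x d, of "\<lambda>_. z"]
  have nYX: "nYX = nXY - bracket \<xi> \<eta> x" and nXZ: "nXZ = nZX + bracket \<xi> (\<lambda>_. z) x"
    and nYZ: "nYZ = nZY + bracket \<eta> (\<lambda>_. z) x" using n by (auto simp: algebra_simps)
  have c: "covd G \<eta> \<xi> x = covd G \<xi> \<eta> x - bracket \<xi> \<eta> x"
    "covd G \<xi> (\<lambda>_. z) x = covd G (\<lambda>_. z) \<xi> x + bracket \<xi> (\<lambda>_. z) x"
    "covd G \<eta> (\<lambda>_. z) x = covd G (\<lambda>_. z) \<eta> x + bracket \<eta> (\<lambda>_. z) x"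
    using covd_torsion[OF x, of \<xi> \<eta>] covd_torsion[OF x, of \<xi> "\<lambda>_. z"] covd_torsion[OF x, of \<eta> "\<lambda>_. z"]
    by simp_all
  \<comment> \<open>After elimination of \<open>nYX\<close>, \<open>nXZ\<close> and
    \<open>nYZ\<close>, the equations \<open>m\<close> and \<open>M\<close> contain the same
    brackets. The sum of the first two minus the third isolates twice the wanted pairing on either
    side.\<close>
  show ?thesis
    using m M unfolding nYX nXZ nYZ c
    by (simp add: G_simps[OF x] sym[OF x, of _ "\<xi> x"] sym[OF x, of _ "\<eta> x"] sym[OF x, of _ z])
qed

text \<open>Tensoriality: the second derivatives of \<open>\<zeta>\<close> cancel by Schwarz's
  theorem, the products of \<Gamma> with \<open>dd \<zeta>\<close> cancel because they are symmetric
  in \<open>\<xi>\<close> and \<open>\<eta>\<close>, and the derivatives of \<open>\<xi>\<close> and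
  \<open>\<eta>\<close> are absorbed by the bracket term. Only the values at \<open>x\<close>
  survive.\<close>

lemma covd_curvature:
  assumes T: "open T" "T \<subseteq> S" and x: "x \<in> T" and sm: "smooth_on T \<xi>" "smooth_on T \<eta>" "smooth_on T \<zeta>"
  shows "covd G \<xi> (covd G \<eta> \<zeta>) x - covd G \<eta> (covd G \<xi> \<zeta>) x - covd G (bracket \<xi> \<eta>) \<zeta> x
    = riem G x (\<xi> x) (\<eta> x) (\<zeta> x)"
proof -
  have xS: "x \<in> S" using x T by auto
  have h: "(\<alpha> has_derivative dd \<alpha> x) (at x)" if "smooth_on T \<alpha>" for \<alpha> :: "'e \<Rightarrow> 'e"
    by (rule smooth_on_has_derivative[OF that x])
  have D: "dd (covd G \<eta> \<zeta>) x u = dd (\<lambda>y. dd \<zeta> y (\<eta> x)) x u + dd \<zeta> x (dd \<eta> x u)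
      + (dd (\<lambda>y. \<Gamma> y (\<eta> x) (\<zeta> x)) x u + \<Gamma> x (dd \<eta> x u) (\<zeta> x) + \<Gamma> x (\<eta> x) (dd \<zeta> x u))"
    if sm: "smooth_on T \<eta>" for u \<eta>
    unfolding covd_def[abs_def]
  proof (rule dd_eqI, rule has_derivative_add)
    show "((\<lambda>y. dd \<zeta> y (\<eta> y)) has_derivative (\<lambda>u. dd (\<lambda>y. dd \<zeta> y (\<eta> x)) x u + dd \<zeta> x (dd \<eta> x u))) (at x)"
      by (rule has_derivative_apply[OF T(1) x smooth_on_linear_dd[OF \<open>smooth_on T \<zeta>\<close>] _ h[OF sm]])
        (assumption | rule smooth_on_differentiable[OF smooth_on_dd[OF \<open>smooth_on T \<zeta>\<close>] x])+
    show "((\<lambda>y. \<Gamma> y (\<eta> y) (\<zeta> y)) has_derivative (\<lambda>u. dd (\<lambda>y. \<Gamma> y (\<eta> x) (\<zeta> x)) x u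
        + \<Gamma> x (dd \<eta> x u) (\<zeta> x) + \<Gamma> x (\<eta> x) (dd \<zeta> x u))) (at x)"
      by (rule christoffel_has_derivative[OF xS h[OF sm] h[OF \<open>smooth_on T \<zeta>\<close>]])
  qed
  have "dd (\<lambda>y. dd \<zeta> y (\<eta> x)) x (\<xi> x) = dd (\<lambda>y. dd \<zeta> y (\<xi> x)) x (\<eta> x)"
    by (rule dd_second[OF T(1) x sm(3)])
  moreover have "linear (dd \<zeta> x)" by (rule smooth_on_linear_dd[OF sm(3) x])
  ultimately show ?thesis
    unfolding covd_def[of _ _ "covd G _ _"] covd_def[of _ "bracket _ _"] D[OF sm(1)] D[OF sm(2)]
    by (simp add: riem_def covd_def bracket_def christoffel_simps[OF xS] linear_diff)
qed

lemma cgrad: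
  assumes x: "x \<in> S" and T: "smooth_on S f"
  shows "G x (cgrad G f x) z = dd f x z"
  unfolding cgrad_def by (rule raise[OF nondeg[OF x] smooth_on_linear_dd[OF T x]])

lemma cgrad_smooth: "smooth_on S f \<Longrightarrow> smooth_on S (cgrad G f)"
  using solution_smooth[of "dd f" "cgrad G f"] smooth_on_dd[of S f] cgrad by blast

text \<open>Reconciles the Hessian as covariant derivative of the gradient with the coordinate
  formula: the gradient paired with a constant field \<open>v\<close> is \<open>dd f y v\<close>,
  and metric compatibility differentiates this pairing.\<close>

lemma cgrad_covd:
  assumes x: "x \<in> S" and f: "smooth_on S f"
  shows "G x (covd G \<xi> (cgrad G f) x) v = hess G f x (\<xi> x) v"
proof -
  have "dd (\<lambda>y. G y (cgrad G f y) v) x = dd (\<lambda>y. dd f y v) x"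
    by (rule dd_cong[OF open_S x]) (rule cgrad[OF _ f])
  then have "dd (\<lambda>y. dd f y v) x (\<xi> x)
      = G x (covd G \<xi> (cgrad G f) x) v + G x (cgrad G f x) (covd G \<xi> (\<lambda>_. v) x)"
    using covd_metric[OF x smooth_on_differentiable[OF cgrad_smooth[OF f] x], of "\<lambda>_. v"] by simp
  then show ?thesis by (simp add: cgrad[OF x f] hess_def) (simp add: covd_def)
qed

lemma hess_bilinear:
  assumes x: "x \<in> S" and f: "smooth_on S f"
  shows "bilinear (hess G f x)"
proof -
  have "linear (\<lambda>v. dd (\<lambda>y. dd f y v) x u)" for u
    by (rule linear_dd_param[OF open_S x smooth_on_linear_dd[OF f]])
      (assumption | rule smooth_on_differentiable[OF smooth_on_dd[OF f] x])+
  moreover have "linear (dd (\<lambda>y. dd f y v) x)" "linear (dd f x)" for v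
    using smooth_on_linear_dd[OF f x] smooth_on_linear_dd[OF smooth_on_dd[OF f] x] by auto
  ultimately show ?thesis
    unfolding bilinear_def hess_def by (auto simp: linear_iff christoffel_simps[OF x] algebra_simps)
qed

lemma hess_sym:
  assumes x: "x \<in> S" and f: "smooth_on S f"
  shows "hess G f x u v = hess G f x v u"
  using dd_second[OF open_S x f] christoffel_sym[OF x, of u v] by (simp add: hess_def)

end

section \<open>Base conformal warped products in coordinates\<close>

lemma has_derivative_comp_fst:
  assumes "f differentiable (at (fst p))"
  shows "((\<lambda>p. f (fst p)) has_derivative (\<lambda>u. dd f (fst p) (fst u))) (at p)"
  by (rule has_derivative_compose[OF has_derivative_fst[OF has_derivative_ident]])
    (use assms frechet_derivative_works in blast)

lemma has_derivative_comp_snd: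
  assumes "f differentiable (at (snd p))"
  shows "((\<lambda>p. f (snd p)) has_derivative (\<lambda>u. dd f (snd p) (snd u))) (at p)"
  by (rule has_derivative_compose[OF has_derivative_snd[OF has_derivative_ident]])
    (use assms frechet_derivative_works in blast)

lemma smooth_on_comp_fst:
  fixes f :: "'a::euclidean_space \<Rightarrow> 'c::real_normed_vector"
  assumes "open S" "open T" "smooth_on S f"
  shows "smooth_on (S \<times> T) (\<lambda>p :: 'a \<times> 'b::euclidean_space. f (fst p))"
  by (rule smooth_on_compose[OF open_Times[OF assms(1,2)] assms(1) _ smooth_on_bounded_linear[OF bounded_linear_fst] assms(3)])
    auto

lemma smooth_on_comp_snd:
  fixes f :: "'b::euclidean_space \<Rightarrow> 'c::real_normed_vector"
  assumes "open S" "open T" "smooth_on T f"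
  shows "smooth_on (S \<times> T) (\<lambda>p :: 'a::euclidean_space \<times> 'b. f (snd p))"
  by (rule smooth_on_compose[OF open_Times[OF assms(1,2)] assms(2) _ smooth_on_bounded_linear[OF bounded_linear_snd] assms(3)])
    auto

lemma sum_lessThan_add:
  fixes f :: "nat \<Rightarrow> 'a::comm_monoid_add"
  shows "(\<Sum>i<m + n. f i) = (\<Sum>i<m. f i) + (\<Sum>i<n. f (m + i))"
  by (induction n) (auto simp: add.assoc)

definition warp ::
  "('a \<Rightarrow> 'a \<Rightarrow> 'a \<Rightarrow> real) \<Rightarrow> ('b \<Rightarrow> 'b \<Rightarrow> 'b \<Rightarrow> real) \<Rightarrow> ('a \<Rightarrow> real) \<Rightarrow> ('a \<Rightarrow> real) \<Rightarrow>
    'a \<times> 'b \<Rightarrow> 'a \<times> 'b \<Rightarrow> 'a \<times> 'b \<Rightarrow> real" where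
  "warp g h c w p u v =
    (c (fst p))\<^sup>2 * g (fst p) (fst u) (fst v) + (w (fst p))\<^sup>2 * h (snd p) (snd u) (snd v)"

locale local_warped = B: local_metric S g + F: local_metric T h
  for S :: "'a::euclidean_space set" and g and T :: "'b::euclidean_space set" and h +
  fixes c w :: "'a \<Rightarrow> real"
  assumes c_smooth: "smooth_on S c" and w_smooth: "smooth_on S w"
    and c_pos: "x \<in> S \<Longrightarrow> 0 < c x" and w_pos: "x \<in> S \<Longrightarrow> 0 < w x"
begin

abbreviation W where "W \<equiv> warp g h c w"

lemma local_metric_warp: "local_metric (S \<times> T) W"
proof (unfold local_metric_def, unfold_locales)
  show "open (S \<times> T)" by (rule open_Times[OF B.open_S F.open_S])
  show "smooth_on (S \<times> T) (\<lambda>p. W p u v)" for u v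
    unfolding warp_def
    by (intro smooth_on_add smooth_on_mult smooth_on_power open_Times B.open_S F.open_S smooth_on_const
        smooth_on_comp_fst[OF B.open_S F.open_S c_smooth] smooth_on_comp_fst[OF B.open_S F.open_S w_smooth]
        smooth_on_comp_fst[OF B.open_S F.open_S B.smooth] smooth_on_comp_snd[OF B.open_S F.open_S F.smooth])
  show "nondeg_form (W p)" if "p \<in> S \<times> T" for p
  proof -
    have xy: "fst p \<in> S" "snd p \<in> T" using that by auto
    note s = B.G_simps[OF xy(1)] F.G_simps[OF xy(2)]
    show ?thesis unfolding nondeg_form_def
    proof (intro conjI allI impI)
      show "bilinear (W p)" by (auto simp: bilinear_def linear_iff warp_def s algebra_simps)
      show "W p u v = W p v u" for u v
        using B.sym[OF xy(1), of "fst u" "fst v"] F.sym[OF xy(2), of "snd u" "snd v"] by (simp add: warp_def)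
      fix u assume u: "\<forall>v. W p u v = 0"
      have "fst u = 0"
      proof (rule B.eqI[OF xy(1)])
        show "g (fst p) (fst u) z = g (fst p) 0 z" for z
          using u[rule_format, of "(z, 0)"] c_pos[OF xy(1)] by (simp add: warp_def s)
      qed
      moreover have "snd u = 0"
      proof (rule F.eqI[OF xy(2)])
        show "h (snd p) (snd u) z = h (snd p) 0 z" for z
          using u[rule_format, of "(0, z)"] w_pos[OF xy(1)] by (simp add: warp_def s)
      qed
      ultimately show "u = 0" by (simp add: prod_eq_iff)
    qed
  qed
qed

sublocale W: local_metric "S \<times> T" W by (rule local_metric_warp)

text \<open>\<open>la f\<close> is the logarithmic differential of \<open>f\<close>, \<open>lA f\<close> the vector dual to it and
  \<open>lP f\<close> its covariant derivative.\<close>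

definition la :: "('a \<Rightarrow> real) \<Rightarrow> 'a \<Rightarrow> 'a \<Rightarrow> real" where "la f x v = dd f x v / f x"
definition lA :: "('a \<Rightarrow> real) \<Rightarrow> 'a \<Rightarrow> 'a" where "lA f x = (1 / f x) *\<^sub>R cgrad g f x"
definition lP :: "('a \<Rightarrow> real) \<Rightarrow> 'a \<Rightarrow> 'a \<Rightarrow> 'a \<Rightarrow> real" where
  "lP f x u v = hess g f x u v / f x - la f x u * la f x v"

text \<open>The fibre part \<open>w^2 h\<close> of the metric is turned into a base vector by the
  inverse of \<open>c^2 g\<close>; this quotient remains.\<close>

definition \<sigma> where "\<sigma> x = (w x)\<^sup>2 / (c x)\<^sup>2"

text \<open>In the first component the terms with \<open>c\<close> are the conformal change from
  \<open>g\<close> to \<open>c^2 g\<close>, and the last term is the second fundamental form of the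
  fibres. The terms with \<open>w\<close> in the second component express the scaling of the fibres
  along the base.\<close>

definition wchr :: "'a \<times> 'b \<Rightarrow> 'a \<times> 'b \<Rightarrow> 'a \<times> 'b \<Rightarrow> 'a \<times> 'b" where
  "wchr p u v =
    (christoffel g (fst p) (fst u) (fst v) + la c (fst p) (fst u) *\<^sub>R fst v + la c (fst p) (fst v) *\<^sub>R fst u
      - g (fst p) (fst u) (fst v) *\<^sub>R lA c (fst p) - h (snd p) (snd u) (snd v) *\<^sub>R (\<sigma> (fst p) *\<^sub>R lA w (fst p)),
     christoffel h (snd p) (snd u) (snd v) + la w (fst p) (fst u) *\<^sub>R snd v + la w (fst p) (fst v) *\<^sub>R snd u)"

lemma lA:
  assumes "x \<in> S" "smooth_on S f"
  shows "g x (lA f x) z = la f x z"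
  using B.cgrad[OF assms] by (simp add: lA_def la_def B.G_simps[OF assms(1)])

lemma la_simps:
  assumes "x \<in> S" "smooth_on S f"
  shows "la f x (u + v) = la f x u + la f x v" "la f x (u - v) = la f x u - la f x v"
    "la f x (r *\<^sub>R v) = r * la f x v" "la f x (- v) = - la f x v" "la f x 0 = 0"
  using smooth_on_linear_dd[OF assms(2,1)]
  by (auto simp: la_def linear_add linear_diff linear_cmul linear_neg linear_0 add_divide_distrib diff_divide_distrib)

text \<open>\<open>lP f\<close> is the Hessian of log \<open>f\<close>; the ordinary derivative of
  the differential exceeds it by the connection term.\<close>

lemma la_has_derivative:
  assumes x: "x \<in> S" and f: "smooth_on S f" and pos: "f x \<noteq> 0"
  shows "((\<lambda>x. la f x v) has_derivative (\<lambda>u. lP f x u v + la f x (christoffel g x u v))) (at x)"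
proof -
  have "((\<lambda>x. dd f x v / f x) has_derivative
      (\<lambda>u. - dd f x v * (inverse (f x) * dd f x u * inverse (f x)) + dd (\<lambda>y. dd f y v) x u / f x)) (at x)"
    by (rule has_derivative_divide[OF smooth_on_has_derivative[OF smooth_on_dd[OF f] x]
          smooth_on_has_derivative[OF f x] pos])
  moreover have "- dd f x v * (inverse (f x) * dd f x u * inverse (f x)) + dd (\<lambda>y. dd f y v) x u / f x
      = lP f x u v + la f x (christoffel g x u v)" for u
    using pos by (simp add: lP_def la_def hess_def field_simps)
  ultimately show ?thesis by (simp add: la_def)
qed

text \<open>The covariant derivative of the gradient of log \<open>f\<close> is dual to
  \<open>lP f\<close>; the connection term is subtracted since the derivative here is the ordinary
  one.\<close>

lemma lA_has_derivative:
  assumes x: "x \<in> S" and f: "smooth_on S f" and pos: "f x \<noteq> 0"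
  shows "(lA f has_derivative dd (lA f) x) (at x)"
    and "g x (dd (lA f) x u) z = lP f x u z - g x (christoffel g x u (lA f x)) z"
proof -
  note G = B.G_simps[OF x] B.christoffel_simps[OF x]
  let ?A = "\<lambda>u. (1 / f x) *\<^sub>R dd (cgrad g f) x u + (- (inverse (f x) * dd f x u * inverse (f x))) *\<^sub>R cgrad g f x"
  have "((\<lambda>x. inverse (f x)) has_derivative (\<lambda>u. - (inverse (f x) * dd f x u * inverse (f x)))) (at x)"
    by (rule Deriv.has_derivative_inverse[OF pos smooth_on_has_derivative[OF f x]])
  then have "((\<lambda>x. 1 / f x) has_derivative (\<lambda>u. - (inverse (f x) * dd f x u * inverse (f x)))) (at x)"
    by (simp add: inverse_eq_divide)
  then have D: "(lA f has_derivative ?A) (at x)"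
    unfolding lA_def[abs_def]
    by (rule has_derivative_scaleR[OF _ smooth_on_has_derivative[OF B.cgrad_smooth[OF f] x]])
  show "(lA f has_derivative dd (lA f) x) (at x)"
    using D frechet_derivative_at[OF D] by simp
  have H: "hess g f x u z = g x (dd (cgrad g f) x u) z + g x (christoffel g x u (cgrad g f x)) z"
    using B.cgrad_covd[OF x f, of "\<lambda>_. u" z] by (simp add: covd_def G)
  have "g x (?A u) z = lP f x u z - g x (christoffel g x u (lA f x)) z"
    using pos B.cgrad[OF x f, of z] by (simp add: G H lP_def la_def lA_def field_simps)
  then show "g x (dd (lA f) x u) z = lP f x u z - g x (christoffel g x u (lA f x)) z"
    unfolding dd_eqI[OF D] .
qed

lemma \<sigma>_has_derivative:
  assumes x: "x \<in> S"
  shows "(\<sigma> has_derivative (\<lambda>u. \<sigma> x * (2 * la w x u - 2 * la c x u))) (at x)"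
proof -
  have cw: "c x \<noteq> 0" "w x \<noteq> 0" using c_pos[OF x] w_pos[OF x] by auto
  note dc = smooth_on_has_derivative[OF c_smooth x] and dw = smooth_on_has_derivative[OF w_smooth x]
  have "((\<lambda>x. (w x * w x) / (c x * c x)) has_derivative
     (\<lambda>u. - (w x * w x) * (inverse (c x * c x) * (c x * dd c x u + dd c x u * c x) * inverse (c x * c x))
       + (w x * dd w x u + dd w x u * w x) / (c x * c x))) (at x)"
    by (rule has_derivative_divide[OF has_derivative_mult[OF dw dw] has_derivative_mult[OF dc dc]]) (use cw in simp)
  moreover have "- (w x * w x) * (inverse (c x * c x) * (c x * dd c x u + dd c x u * c x) * inverse (c x * c x))
       + (w x * dd w x u + dd w x u * w x) / (c x * c x) = \<sigma> x * (2 * la w x u - 2 * la c x u)" for u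
    using cw by (simp add: \<sigma>_def la_def field_simps power2_eq_square)
  ultimately show ?thesis by (simp add: \<sigma>_def[abs_def] power2_eq_square)
qed

text \<open>The derivatives of \<open>g\<close> and \<open>h\<close> are replaced at once by their
  Christoffel maps, so that Koszul's formula for the warped metric becomes an algebraic
  identity.\<close>

lemma warp_dd:
  assumes x: "x \<in> S" and y: "y \<in> T"
  shows "dd (\<lambda>p. W p v z) (x, y) u =
    2 * (c x)\<^sup>2 * la c x (fst u) * g x (fst v) (fst z)
    + (c x)\<^sup>2 * (g x (christoffel g x (fst u) (fst v)) (fst z) + g x (fst v) (christoffel g x (fst u) (fst z)))
    + 2 * (w x)\<^sup>2 * la w x (fst u) * h y (snd v) (snd z)
    + (w x)\<^sup>2 * (h y (christoffel h y (snd u) (snd v)) (snd z) + h y (snd v) (christoffel h y (snd u) (snd z)))"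
proof -
  have dc: "((\<lambda>p. c (fst p)) has_derivative (\<lambda>u. dd c x (fst u))) (at (x, y))"
    using has_derivative_comp_fst[of c "(x, y)"] smooth_on_differentiable[OF c_smooth x] by simp
  have dw: "((\<lambda>p. w (fst p)) has_derivative (\<lambda>u. dd w x (fst u))) (at (x, y))"
    using has_derivative_comp_fst[of w "(x, y)"] smooth_on_differentiable[OF w_smooth x] by simp
  have dg: "((\<lambda>p. g (fst p) (fst v) (fst z)) has_derivative (\<lambda>u. dd (\<lambda>x. g x (fst v) (fst z)) x (fst u))) (at (x, y))"
    using has_derivative_comp_fst[of "\<lambda>x. g x (fst v) (fst z)" "(x, y)"] smooth_on_differentiable[OF B.smooth x] by simp
  have dh: "((\<lambda>p. h (snd p) (snd v) (snd z)) has_derivative (\<lambda>u. dd (\<lambda>x. h x (snd v) (snd z)) y (snd u))) (at (x, y))"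
    using has_derivative_comp_snd[of "\<lambda>x. h x (snd v) (snd z)" "(x, y)"] smooth_on_differentiable[OF F.smooth y] by simp
  have 1: "dd (\<lambda>p. W p v z) (x, y) u =
     ((c x * c x) * dd (\<lambda>x. g x (fst v) (fst z)) x (fst u) + (c x * dd c x (fst u) + dd c x (fst u) * c x) * g x (fst v) (fst z))
    + ((w x * w x) * dd (\<lambda>x. h x (snd v) (snd z)) y (snd u) + (w x * dd w x (fst u) + dd w x (fst u) * w x) * h y (snd v) (snd z))"
    unfolding warp_def power2_eq_square
    using dd_eqI[OF has_derivative_add[OF has_derivative_mult[OF has_derivative_mult[OF dc dc] dg]
          has_derivative_mult[OF has_derivative_mult[OF dw dw] dh]], of u] by simp
  have "c x \<noteq> 0" "w x \<noteq> 0" using c_pos[OF x] w_pos[OF x] by auto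
  then show ?thesis unfolding 1 B.metric_compatible[OF x] F.metric_compatible[OF y]
    by (simp add: la_def power2_eq_square algebra_simps)
qed

text \<open>The closed form is checked against Koszul's formula and nondegeneracy does the rest; no
  index is raised for the warped metric.\<close>

lemma warp_christoffel:
  assumes x: "x \<in> S" and y: "y \<in> T"
  shows "christoffel W (x, y) u v = wchr (x, y) u v"
proof (rule W.eqI)
  show xy: "(x, y) \<in> S \<times> T" using x y by simp
  fix z
  have cw: "c x \<noteq> 0" "w x \<noteq> 0" using c_pos[OF x] w_pos[OF x] by auto
  \<comment> \<open>In this form the second fundamental form term, multiplied by \<open>c^2\<close>,
    and the \<open>w^2\<close> terms of Koszul's formula match syntactically.\<close>
  have s: "(w x)\<^sup>2 = (c x)\<^sup>2 * \<sigma> x" using cw by (simp add: \<sigma>_def)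
  show "W (x, y) (christoffel W (x, y) u v) z = W (x, y) (wchr (x, y) u v) z"
    unfolding W.christoffel[OF xy] warp_dd[OF x y]
    unfolding warp_def wchr_def fst_conv snd_conv s
    by (simp add: B.G_simps[OF x] F.G_simps[OF y] lA[OF x c_smooth] lA[OF x w_smooth] add_divide_distrib diff_divide_distrib algebra_simps
        B.sym[OF x, of "fst z"] B.sym[OF x, of "fst v" "fst u"] F.sym[OF y, of "snd z"] F.sym[OF y, of "snd v" "snd u"]
        B.sym[OF x, of "fst v" "christoffel g x _ _"] B.sym[OF x, of "fst u" "christoffel g x _ _"]
        F.sym[OF y, of "snd v" "christoffel h y _ _"] F.sym[OF y, of "snd u" "christoffel h y _ _"]
        B.christoffel_sym[OF x, of "fst z"] B.christoffel_sym[OF x, of "fst v" "fst u"]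
        F.christoffel_sym[OF y, of "snd z"] F.christoffel_sym[OF y, of "snd v" "snd u"])
qed

lemma lP_sym: "x \<in> S \<Longrightarrow> smooth_on S f \<Longrightarrow> lP f x u v = lP f x v u"
  using B.hess_sym[of x f u v] by (simp add: lP_def)

lemma lP_zero:
  assumes "x \<in> S" "smooth_on S f"
  shows "lP f x 0 v = 0" "lP f x v 0 = 0"
  using bilinear_lzero[OF B.hess_bilinear[OF assms]] bilinear_rzero[OF B.hess_bilinear[OF assms]]
  by (auto simp: lP_def la_simps[OF assms])

lemma wchr_has_derivative:
  assumes x: "x \<in> S" and y: "y \<in> T"
  shows "((\<lambda>p. wchr p v z) has_derivative (\<lambda>u.
    (dd (\<lambda>x. christoffel g x (fst v) (fst z)) x (fst u)
      + (lP c x (fst u) (fst v) + la c x (christoffel g x (fst u) (fst v))) *\<^sub>R fst z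
      + (lP c x (fst u) (fst z) + la c x (christoffel g x (fst u) (fst z))) *\<^sub>R fst v
      - (g x (fst v) (fst z) *\<^sub>R dd (lA c) x (fst u) +
        (g x (christoffel g x (fst u) (fst v)) (fst z) + g x (fst v) (christoffel g x (fst u) (fst z))) *\<^sub>R lA c x)
      - (h y (snd v) (snd z) *\<^sub>R (\<sigma> x *\<^sub>R dd (lA w) x (fst u) + (\<sigma> x * (2 * la w x (fst u) - 2 * la c x (fst u))) *\<^sub>R lA w x) +
        (h y (christoffel h y (snd u) (snd v)) (snd z) + h y (snd v) (christoffel h y (snd u) (snd z))) *\<^sub>R (\<sigma> x *\<^sub>R lA w x)),
     dd (\<lambda>y. christoffel h y (snd v) (snd z)) y (snd u)
      + (lP w x (fst u) (fst v) + la w x (christoffel g x (fst u) (fst v))) *\<^sub>R snd z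
      + (lP w x (fst u) (fst z) + la w x (christoffel g x (fst u) (fst z))) *\<^sub>R snd v))) (at (x, y))"
proof -
  have fst': "((\<lambda>p. f (fst p)) has_derivative (\<lambda>u. f' (fst u))) (at (x, y))"
    if "(f has_derivative f') (at x)" for f :: "'a \<Rightarrow> 'd::real_normed_vector" and f'
    by (rule has_derivative_compose[OF has_derivative_fst[OF has_derivative_ident]]) (simp add: that)
  have snd': "((\<lambda>p. f (snd p)) has_derivative (\<lambda>u. f' (snd u))) (at (x, y))"
    if "(f has_derivative f') (at y)" for f :: "'b \<Rightarrow> 'd::real_normed_vector" and f'
    by (rule has_derivative_compose[OF has_derivative_snd[OF has_derivative_ident]]) (simp add: that)
  have cw: "c x \<noteq> 0" "w x \<noteq> 0" using c_pos[OF x] w_pos[OF x] by auto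
  have dg: "((\<lambda>x. g x (fst v) (fst z)) has_derivative (\<lambda>u. g x (christoffel g x u (fst v)) (fst z) + g x (fst v) (christoffel g x u (fst z)))) (at x)"
    by (rule has_derivative_eq_rhs[OF smooth_on_has_derivative[OF B.smooth x]])
      (simp add: fun_eq_iff B.metric_compatible[OF x])
  have dh: "((\<lambda>x. h x (snd v) (snd z)) has_derivative (\<lambda>u. h y (christoffel h y u (snd v)) (snd z) + h y (snd v) (christoffel h y u (snd z)))) (at y)"
    by (rule has_derivative_eq_rhs[OF smooth_on_has_derivative[OF F.smooth y]])
      (simp add: fun_eq_iff F.metric_compatible[OF y])
  show ?thesis unfolding wchr_def
    using has_derivative_Pair[OF
        has_derivative_diff[OF has_derivative_diff[OF has_derivative_add[OF has_derivative_add[OF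
          fst'[OF smooth_on_has_derivative[OF B.christoffel_smooth[of "fst v" "fst z"] x]]
          has_derivative_scaleR_left[OF fst'[OF la_has_derivative[OF x c_smooth cw(1), of "fst v"]], of "fst z"]]
          has_derivative_scaleR_left[OF fst'[OF la_has_derivative[OF x c_smooth cw(1), of "fst z"]], of "fst v"]]
          has_derivative_scaleR[OF fst'[OF dg] fst'[OF lA_has_derivative(1)[OF x c_smooth cw(1)]]]]
          has_derivative_scaleR[OF snd'[OF dh] has_derivative_scaleR[OF fst'[OF \<sigma>_has_derivative[OF x]] fst'[OF lA_has_derivative(1)[OF x w_smooth cw(2)]]]]]
        has_derivative_add[OF has_derivative_add[OF
          snd'[OF smooth_on_has_derivative[OF F.christoffel_smooth[of "snd v" "snd z"] y]]
          has_derivative_scaleR_left[OF fst'[OF la_has_derivative[OF x w_smooth cw(2), of "fst v"]], of "snd z"]]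
          has_derivative_scaleR_left[OF fst'[OF la_has_derivative[OF x w_smooth cw(2), of "fst z"]], of "snd v"]]]
    by simp
qed

text \<open>The closed form agrees with the Christoffel map on an open set, so it may also be
  differentiated in its place.\<close>

lemma riem_warp:
  assumes x: "x \<in> S" and y: "y \<in> T"
  shows "riem W (x, y) u v z = dd (\<lambda>p. wchr p v z) (x, y) u - dd (\<lambda>p. wchr p u z) (x, y) v
     + wchr (x, y) u (wchr (x, y) v z) - wchr (x, y) v (wchr (x, y) u z)"
proof -
  have "christoffel W p v z = wchr p v z" if "p \<in> S \<times> T" for p v
    using warp_christoffel[of "fst p" "snd p" v z] that by (simp add: mem_Times_iff)
  then have "dd (\<lambda>p. christoffel W p v z) (x, y) = dd (\<lambda>p. wchr p v z) (x, y)" for v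
    by (intro dd_cong[OF open_Times[OF B.open_S F.open_S]]) (use x y in auto)
  then show ?thesis unfolding riem_def warp_christoffel[OF x y] by simp
qed

section \<open>Sectional terms of the warped curvature\<close>

context
  fixes x y assumes x: "x \<in> S" and y: "y \<in> T"
begin

lemmas wsimps = B.G_simps[OF x] F.G_simps[OF y] B.christoffel_simps[OF x] F.christoffel_simps[OF y]
  la_simps[OF x c_smooth] la_simps[OF x w_smooth] lA[OF x c_smooth] lA[OF x w_smooth]
  lP_zero[OF x c_smooth] lP_zero[OF x w_smooth]

text \<open>The arguments below are tangent to one factor, so one component of each is 0; these
  rules delete the corresponding terms.\<close>

lemma linear_dd_christoffel_0:
  "dd (\<lambda>x. christoffel g x u v) x 0 = 0" "dd (\<lambda>y. christoffel h y u' v') y 0 = 0"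
  "dd (\<lambda>x. christoffel g x 0 v) x u = 0" "dd (\<lambda>y. christoffel h y 0 v') y u' = 0"
  "dd (\<lambda>x. christoffel g x v 0) x u = 0" "dd (\<lambda>y. christoffel h y v' 0) y u' = 0"
  using B.dchristoffel_linear[OF x, THEN linear_0] F.dchristoffel_linear[OF y, THEN linear_0] by auto

lemma lA_derivative:
  "g x (dd (lA c) x u) z = lP c x u z - g x (christoffel g x u (lA c x)) z"
  "g x (dd (lA w) x u) z = lP w x u z - g x (christoffel g x u (lA w x)) z"
  "dd (lA c) x 0 = 0" "dd (lA w) x 0 = 0"
proof -
  have cw: "c x \<noteq> 0" "w x \<noteq> 0" using c_pos[OF x] w_pos[OF x] by auto
  note D = lA_has_derivative[OF x c_smooth cw(1)] lA_has_derivative[OF x w_smooth cw(2)]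
  show "g x (dd (lA c) x u) z = lP c x u z - g x (christoffel g x u (lA c x)) z"
    "g x (dd (lA w) x u) z = lP w x u z - g x (christoffel g x u (lA w x)) z"
    "dd (lA c) x 0 = 0" "dd (lA w) x 0 = 0"
    using D linear_0[OF has_derivative_linear] by auto
qed

lemmas dd_wchr = dd_eqI[OF wchr_has_derivative[OF x y]]

text \<open>The classical curvature formula for the conformal metric \<open>c^2 g\<close>, with the
  differential, gradient and Hessian of log \<open>c\<close>. The slices along the base are totally
  geodesic, so neither \<open>w\<close> nor the fibre enters.\<close>

lemma riem_BB:
  "W (x, y) (riem W (x, y) (u, 0) (v, 0) (v, 0)) (u, 0) = (c x)\<^sup>2 *
    (g x (riem g x u v v) u + 2 * (lP c x u v * g x u v) - g x v v * lP c x u u - lP c x v v * g x u u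
     + (la c x v)\<^sup>2 * g x u u + (la c x u)\<^sup>2 * g x v v - g x u u * g x v v * g x (lA c x) (lA c x)
     - 2 * (la c x u * la c x v * g x u v) + (g x u v)\<^sup>2 * g x (lA c x) (lA c x))"
  unfolding riem_warp[OF x y] dd_wchr warp_def
  by (simp add: wchr_def linear_dd_christoffel_0 wsimps lA_derivative riem_def)
    (simp add: B.sym[OF x, of v u] B.sym[OF x, of _ "lA c x"] B.sym[OF x, of u "christoffel g x _ _"]
      B.sym[OF x, of v "christoffel g x _ _"]
      B.christoffel_sym[OF x, of v u] lP_sym[OF x c_smooth, of v u] lA[OF x c_smooth] algebra_simps power2_eq_square)

text \<open>Gauss equation: the fibres are totally umbilic, with second fundamental form
  \<open>- h y u v\<close> times \<open>\<sigma> x *\<^sub>R lA w x\<close>, and products of two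
  such terms correct the intrinsic curvature.\<close>

lemma riem_FF:
  "W (x, y) (riem W (x, y) (0, u) (0, v) (0, v)) (0, u) = (w x)\<^sup>2 *
    (h y (riem h y u v v) u - \<sigma> x * g x (lA w x) (lA w x) * (h y u u * h y v v - (h y u v)\<^sup>2))"
  unfolding riem_warp[OF x y] dd_wchr warp_def
  by (simp add: wchr_def linear_dd_christoffel_0 wsimps lA_derivative riem_def)
    (simp add: F.sym[OF y, of v u] lA[OF x w_smooth] algebra_simps power2_eq_square)

text \<open>The factor after \<open>h y v v\<close> is minus the Hessian of \<open>w\<close> for the
  conformal metric \<open>c^2 g\<close>, divided by \<open>w\<close> and rewritten in terms of
  \<open>g\<close>.\<close>

lemma riem_BF:
  "W (x, y) (riem W (x, y) (u, 0) (0, v) (0, v)) (u, 0) = (w x)\<^sup>2 *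
    (h y v v * (2 * (la c x u * la w x u) - lP w x u u - g x (lA c x) (lA w x) * g x u u - (la w x u)\<^sup>2))"
proof -
  have s: "(w x)\<^sup>2 = (c x)\<^sup>2 * \<sigma> x" using c_pos[OF x] by (simp add: \<sigma>_def)
  show ?thesis unfolding riem_warp[OF x y] dd_wchr warp_def s
    by (simp add: wchr_def linear_dd_christoffel_0 wsimps lA_derivative)
      (simp add: B.sym[OF x, of u "lA w x"] lA[OF x w_smooth] lA[OF x c_smooth] algebra_simps power2_eq_square)
qed

text \<open>The value is that of \<open>riem_BF\<close> with the roles exchanged, as the pair
  symmetry of curvature predicts; it is computed directly, since the double sum meets both
  orders.\<close>

lemma riem_FB:
  "W (x, y) (riem W (x, y) (0, u) (v, 0) (v, 0)) (0, u) = (w x)\<^sup>2 *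
    (h y u u * (2 * (la c x v * la w x v) - lP w x v v - g x (lA c x) (lA w x) * g x v v - (la w x v)\<^sup>2))"
proof -
  have [simp]: "la w x (lA c x) = g x (lA c x) (lA w x)"
    using lA[OF x w_smooth, of "lA c x"] B.sym[OF x, of "lA c x"] by simp
  show ?thesis unfolding riem_warp[OF x y] dd_wchr warp_def
    by (simp add: wchr_def linear_dd_christoffel_0 wsimps lA_derivative)
      (simp add: lA[OF x w_smooth] lA[OF x c_smooth] algebra_simps power2_eq_square)
qed

end

end

section \<open>Summation over a product frame\<close>

lemma frame_pm:
  fixes g :: "'e::euclidean_space \<Rightarrow> 'e \<Rightarrow> real"
  shows "frame g e \<Longrightarrow> i < DIM('e) \<Longrightarrow> g (e i) (e i) = 1 \<or> g (e i) (e i) = - 1"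
  unfolding frame_def by (metis abs_eq_iff abs_1)

text \<open>Parseval's identity for an indefinite form.\<close>

lemma frame_sum_inner:
  fixes g :: "'e::euclidean_space \<Rightarrow> 'e \<Rightarrow> real"
  assumes g: "nondeg_form g" and e: "frame g e"
  shows "(\<Sum>i<DIM('e). g (e i) (e i) * (g u (e i) * g v (e i))) = g u v"
proof -
  have l: "linear (g v)" using nondeg_form_bilinear[OF g] by (simp add: bilinear_def)
  have "g u v = g v (\<Sum>i<DIM('e). (g (e i) (e i) * g u (e i)) *\<^sub>R e i)"
    using frame_expansion[OF g e, of u] nondeg_form_sym[OF g, of u v] by simp
  also have "\<dots> = (\<Sum>i<DIM('e). g (e i) (e i) * (g u (e i) * g v (e i)))"
    by (simp add: linear_sum[OF l] linear_cmul[OF l] mult.assoc)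
  finally show ?thesis by simp
qed

text \<open>Base vectors of \<open>product_frame\<close> carry the factor \<open>1 / c x\<close> and
  fibre vectors \<open>1 / w x\<close>. Each vector occurs twice in a sectional term, so these
  factors come out as squares.\<close>

lemma (in local_metric) riem_scale:
  assumes x: "x \<in> S"
  shows "G x (riem G x (r *\<^sub>R u) (s *\<^sub>R v) (s *\<^sub>R v)) (r *\<^sub>R u) = r\<^sup>2 * s\<^sup>2 * G x (riem G x u v v) u"
  using riem_linear[OF x, THEN linear_cmul] by (simp add: G_simps[OF x] power2_eq_square)

context local_warped
begin

context
  fixes x y e f
  assumes x: "x \<in> S" and y: "y \<in> T" and e: "frame (g x) e" and f: "frame (h y) f"
begin

abbreviation \<epsilon> where "\<epsilon> i \<equiv> g x (e i) (e i)"
abbreviation \<delta> where "\<delta> i \<equiv> h y (f i) (f i)"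

definition product_frame :: "nat \<Rightarrow> 'a \<times> 'b" where
  "product_frame i = (if i < DIM('a) then (1 / c x) *\<^sub>R (e i, 0) else (1 / w x) *\<^sub>R (0, f (i - DIM('a))))"

lemma frame_product_frame: "frame (W (x, y)) product_frame"
proof -
  have cw: "c x \<noteq> 0" "w x \<noteq> 0" using c_pos[OF x] w_pos[OF x] by auto
  note s = B.G_simps[OF x] F.G_simps[OF y]
  show ?thesis
    unfolding frame_def
  proof (intro allI impI conjI)
    fix i assume i: "i < DIM('a \<times> 'b)"
    show "\<bar>W (x, y) (product_frame i) (product_frame i)\<bar> = 1"
      using i e f cw by (auto simp: product_frame_def warp_def frame_def s power2_eq_square)
    fix j assume j: "j < DIM('a \<times> 'b)" and ij: "i \<noteq> j"
    show "W (x, y) (product_frame i) (product_frame j) = 0"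
      using i j ij e f cw by (auto simp: product_frame_def warp_def frame_def s)
  qed
qed

text \<open>The trace of the Hessian of log \<open>u\<close>, not of \<open>u\<close>: the
  subtracted square of the logarithmic differential traces to the square of its dual vector.\<close>

lemma sum_P:
  assumes "smooth_on S u"
  shows "(\<Sum>i<DIM('a). \<epsilon> i * lP u x (e i) (e i)) = ftrace (g x) (hess g u x) / u x - g x (lA u x) (lA u x)"
proof -
  have "ftrace (g x) (hess g u x) = (\<Sum>i<DIM('a). \<epsilon> i * hess g u x (e i) (e i))"
    by (rule ftrace_frame[OF B.nondeg[OF x] e B.hess_bilinear[OF x assms]])
  moreover have "(\<Sum>i<DIM('a). \<epsilon> i * (la u x (e i) * la u x (e i))) = g x (lA u x) (lA u x)"
    using frame_sum_inner[OF B.nondeg[OF x] e, of "lA u x" "lA u x"] by (simp add: lA[OF x assms])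
  ultimately show ?thesis
    by (simp add: lP_def right_diff_distrib sum_subtractf sum_divide_distrib)
qed

lemma sum_la:
  assumes "smooth_on S u" "smooth_on S v"
  shows "(\<Sum>i<DIM('a). \<epsilon> i * (la u x (e i) * la v x (e i))) = g x (lA u x) (lA v x)"
  using frame_sum_inner[OF B.nondeg[OF x] e, of "lA u x" "lA v x"] by (simp add: lA[OF x] assms)

lemma sum_BB:
  "(\<Sum>i<DIM('a). \<Sum>j<DIM('a). \<epsilon> i * \<epsilon> j *
     (g x (riem g x (e j) (e i) (e i)) (e j) + 2 * (lP c x (e j) (e i) * g x (e j) (e i))
      - g x (e i) (e i) * lP c x (e j) (e j) - lP c x (e i) (e i) * g x (e j) (e j)
      + (la c x (e i))\<^sup>2 * g x (e j) (e j) + (la c x (e j))\<^sup>2 * g x (e i) (e i)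
      - g x (e j) (e j) * g x (e i) (e i) * g x (lA c x) (lA c x)
      - 2 * (la c x (e j) * la c x (e i) * g x (e j) (e i)) + (g x (e j) (e i))\<^sup>2 * g x (lA c x) (lA c x)))
   = scal g x - 2 * (real DIM('a) - 1) * (ftrace (g x) (hess g c x) / c x)
     - (real DIM('a) - 4) * (real DIM('a) - 1) * g x (lA c x) (lA c x)" (is "(\<Sum>i<_. \<Sum>j<_. ?t i j) = ?R")
proof -
  let ?L = "\<Sum>i<DIM('a). \<Sum>j<DIM('a). ?t i j"
  let ?N = "g x (lA c x) (lA c x)" let ?n = "real DIM('a)"
  \<comment> \<open>Squares of signs are removed, and a factor
    \<open>\<epsilon> j * g x (e i) (e j)\<close> is exposed wherever the sum over \<open>j\<close>
    is to collapse to its term at \<open>i\<close> by \<open>frame_sum\<close>.\<close>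
  let ?s = "\<lambda>i j. \<epsilon> i * \<epsilon> j * g x (riem g x (e j) (e i) (e i)) (e j)
      + 2 * \<epsilon> i * (\<epsilon> j * (g x (e i) (e j) * lP c x (e j) (e i)))
      - \<epsilon> j * lP c x (e j) (e j) - \<epsilon> i * lP c x (e i) (e i)
      + \<epsilon> i * (la c x (e i) * la c x (e i)) + \<epsilon> j * (la c x (e j) * la c x (e j)) - ?N
      - 2 * (\<epsilon> i * la c x (e i)) * (\<epsilon> j * (g x (e i) (e j) * la c x (e j)))
      + ?N * \<epsilon> i * (\<epsilon> j * (g x (e i) (e j) * g x (e i) (e j)))"
  have "?L = (\<Sum>i<DIM('a). \<Sum>j<DIM('a). ?s i j)"
  proof (intro sum.cong refl)
    fix i j assume "i \<in> {..<DIM('a)}" "j \<in> {..<DIM('a)}"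
    then have "\<epsilon> i = 1 \<or> \<epsilon> i = - 1" "\<epsilon> j = 1 \<or> \<epsilon> j = - 1" using frame_pm[OF e] by auto
    then show "?t i j = ?s i j"
      using B.sym[OF x, of "e i" "e j"] by (elim disjE) (simp_all add: algebra_simps power2_eq_square)
  qed
  also have "\<dots> = (\<Sum>i<DIM('a). (\<Sum>j<DIM('a). \<epsilon> i * \<epsilon> j * g x (riem g x (e j) (e i) (e i)) (e j))
      + 2 * (\<epsilon> i * lP c x (e i) (e i))
      - (\<Sum>j<DIM('a). \<epsilon> j * lP c x (e j) (e j)) - ?n * (\<epsilon> i * lP c x (e i) (e i))
      + ?n * (\<epsilon> i * (la c x (e i) * la c x (e i))) + ?N - ?n * ?N
      - 2 * (\<epsilon> i * (la c x (e i) * la c x (e i)))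
      + ?N)"
    by (intro sum.cong refl)
      (simp add: sum.distrib sum_subtractf frame_sum[OF e] frame_sq[OF e] sum_la c_smooth flip: sum_distrib_left)
  \<comment> \<open>With n the dimension of the base, the quadratic terms give \<open>?N\<close> the
    coefficient \<open>3 * n - n^2 - 2\<close>, that is -(n-1)(n-2). The trace of
    \<open>lP c\<close> has the coefficient -2(n-1) and contains \<open>- ?N\<close>, which adds
    2(n-1).\<close>
  also have "\<dots> = ?R"
    by (simp add: sum.distrib sum_subtractf sum_P sum_la c_smooth B.scal_frame[OF x e] flip: sum_distrib_left)
      (simp add: algebra_simps add_divide_distrib diff_divide_distrib)
  finally show ?thesis .
qed

text \<open>The product of two squares contributes for every pair of indices, the squared inner
  product only on the diagonal; the difference is k(k-1).\<close>

lemma sum_FF: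
  "(\<Sum>i<DIM('b). \<Sum>j<DIM('b). \<delta> i * \<delta> j *
     (h y (riem h y (f j) (f i) (f i)) (f j) - \<sigma> x * g x (lA w x) (lA w x) *
        (h y (f j) (f j) * h y (f i) (f i) - (h y (f j) (f i))\<^sup>2)))
   = scal h y - \<sigma> x * g x (lA w x) (lA w x) * (real DIM('b) * (real DIM('b) - 1))" (is "(\<Sum>i<_. \<Sum>j<_. ?t i j) = ?R")
proof -
  let ?L = "\<Sum>i<DIM('b). \<Sum>j<DIM('b). ?t i j"
  let ?N = "\<sigma> x * g x (lA w x) (lA w x)"
  let ?s = "\<lambda>i j. \<delta> i * \<delta> j * h y (riem h y (f j) (f i) (f i)) (f j) - ?N
      + ?N * \<delta> i * (\<delta> j * (h y (f i) (f j) * h y (f i) (f j)))"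
  have "?L = (\<Sum>i<DIM('b). \<Sum>j<DIM('b). ?s i j)"
  proof (intro sum.cong refl)
    fix i j assume "i \<in> {..<DIM('b)}" "j \<in> {..<DIM('b)}"
    then have "\<delta> i = 1 \<or> \<delta> i = - 1" "\<delta> j = 1 \<or> \<delta> j = - 1" using frame_pm[OF f] by auto
    then show "?t i j = ?s i j"
      using F.sym[OF y, of "f i" "f j"] by (elim disjE) (simp_all add: algebra_simps power2_eq_square)
  qed
  also have "\<dots> = (\<Sum>i<DIM('b). (\<Sum>j<DIM('b). \<delta> i * \<delta> j * h y (riem h y (f j) (f i) (f i)) (f j))
      - real DIM('b) * ?N + ?N)"
    by (intro sum.cong refl)
      (simp add: sum.distrib sum_subtractf frame_sum[OF f] frame_sq[OF f] mult.assoc flip: sum_distrib_left)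
  also have "\<dots> = ?R"
    by (simp add: sum.distrib sum_subtractf F.scal_frame[OF y f] algebra_simps)
  finally show ?thesis .
qed

text \<open>The square of \<open>la w\<close> cancels the square hidden in \<open>lP w\<close>,
  leaving the Laplacian of \<open>w\<close>. The mixed product of gradients occurs 2 times from the
  cross term and minus \<open>DIM('a)\<close> times from the summand with
  \<open>\<epsilon> i\<close>.\<close>

lemma sum_BF:
  "(\<Sum>i<DIM('a). \<epsilon> i * (2 * (la c x (e i) * la w x (e i)) - lP w x (e i) (e i)
      - g x (lA c x) (lA w x) * \<epsilon> i - (la w x (e i))\<^sup>2))
   = - ftrace (g x) (hess g w x) / w x - (real DIM('a) - 2) * g x (lA c x) (lA w x)" (is "?L = ?R")
proof -
  have "?L = (\<Sum>i<DIM('a). 2 * (\<epsilon> i * (la c x (e i) * la w x (e i))) - \<epsilon> i * lP w x (e i) (e i)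
      - g x (lA c x) (lA w x) - \<epsilon> i * (la w x (e i) * la w x (e i)))"
    by (intro sum.cong refl)
      (use frame_sq[OF e] in \<open>auto simp: right_diff_distrib power2_eq_square algebra_simps\<close>)
  also have "\<dots> = ?R"
    by (simp add: sum.distrib sum_subtractf sum_P sum_la c_smooth w_smooth flip: sum_distrib_left)
      (simp add: algebra_simps)
  finally show ?thesis .
qed

text \<open>The factor \<open>c^2\<close> in front meets the normalization of the frame: a base pair
  carries \<open>c^2\<close> against \<open>1 / c^4\<close>, a mixed pair \<open>w^2\<close> against
  \<open>1 / (c^2 * w^2)\<close>, a fibre pair \<open>w^2\<close> against \<open>1 / w^4\<close>.
  Only the last keeps the ratio \<open>c^2 / w^2\<close>.\<close>

lemma scal_warp_aux:
  fixes m k :: real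
  assumes mk: "m = real DIM('a)" "k = real DIM('b)"
  shows "(c x)\<^sup>2 * scal W (x, y) =
    scal g x - 2 * (m - 1) * (ftrace (g x) (hess g c x) / c x) - (m - 4) * (m - 1) * g x (lA c x) (lA c x)
    + 2 * k * (- ftrace (g x) (hess g w x) / w x - (m - 2) * g x (lA c x) (lA w x))
    + (c x)\<^sup>2 / (w x)\<^sup>2 * (scal h y - \<sigma> x * g x (lA w x) (lA w x) * (k * (k - 1)))"
proof -
  have xy: "(x, y) \<in> S \<times> T" using x y by simp
  have cw: "c x \<noteq> 0" "w x \<noteq> 0" using c_pos[OF x] w_pos[OF x] by auto
  let ?E = product_frame let ?m = "DIM('a)" let ?k = "DIM('b)"
  let ?t = "\<lambda>i j. W (x, y) (?E i) (?E i) * W (x, y) (?E j) (?E j) * W (x, y) (riem W (x, y) (?E j) (?E i) (?E i)) (?E j)"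
  let ?Q = "\<lambda>i. 2 * (la c x (e i) * la w x (e i)) - lP w x (e i) (e i) - g x (lA c x) (lA w x) * \<epsilon> i - (la w x (e i))\<^sup>2"
  have E1: "?E i = (1 / c x) *\<^sub>R (e i, 0)" if "i < ?m" for i using that by (simp add: product_frame_def)
  have E2: "?E (?m + i) = (1 / w x) *\<^sub>R (0, f i)" for i by (simp add: product_frame_def)
  have W1: "W (x, y) (?E i) (?E i) = \<epsilon> i" if "i < ?m" for i
    using cw by (simp add: E1[OF that] warp_def B.G_simps[OF x] F.G_simps[OF y] power2_eq_square)
  have W2: "W (x, y) (?E (?m + i)) (?E (?m + i)) = \<delta> i" for i
    using cw by (simp add: E2 warp_def B.G_simps[OF x] F.G_simps[OF y] power2_eq_square)
  note sc = W.riem_scale[OF xy]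
  have BB: "(c x)\<^sup>2 * (\<Sum>i<?m. \<Sum>j<?m. ?t i j) = scal g x - 2 * (m - 1) * (ftrace (g x) (hess g c x) / c x)
     - (m - 4) * (m - 1) * g x (lA c x) (lA c x)"
    unfolding sum_BB[symmetric] mk sum_distrib_left
    by (intro sum.cong refl, simp only: lessThan_iff W1)
      (use cw in \<open>simp add: E1 sc riem_BB[OF x y] power2_eq_square del: scaleR_Pair\<close>)
  \<comment> \<open>The sign \<open>\<delta> j\<close> meets the factor
    \<open>h y (f j) (f j)\<close> of the mixed curvature and squares to 1, so the sum over the
    fibre index just produces \<open>k\<close>.\<close>
  have BF: "(c x)\<^sup>2 * (\<Sum>i<?m. \<Sum>j<?k. ?t i (?m + j)) = k * (\<Sum>i<?m. \<epsilon> i * ?Q i)"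
  proof -
    have "?t i (?m + j) = 1 / (c x)\<^sup>2 * (\<epsilon> i * ?Q i)" if "i < ?m" "j < ?k" for i j
      unfolding W1[OF that(1)] W2 using cw that frame_sq[OF f, of j]
      by (simp add: E1 E2 sc riem_FB[OF x y] power_divide del: scaleR_Pair)
    then show ?thesis using cw by (simp add: mk sum_distrib_left mult.left_commute)
  qed
  have FB: "(c x)\<^sup>2 * (\<Sum>i<?k. \<Sum>j<?m. ?t (?m + i) j) = k * (\<Sum>i<?m. \<epsilon> i * ?Q i)"
  proof -
    have "?t (?m + i) j = 1 / (c x)\<^sup>2 * (\<epsilon> j * ?Q j)" if "i < ?k" "j < ?m" for i j
      unfolding W1[OF that(2)] W2 using cw that frame_sq[OF f, of i]
      by (simp add: E1 E2 sc riem_BF[OF x y] power_divide del: scaleR_Pair)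
    then show ?thesis using cw by (simp add: mk sum_distrib_left mult.left_commute)
  qed
  have FF: "(c x)\<^sup>2 * (\<Sum>i<?k. \<Sum>j<?k. ?t (?m + i) (?m + j))
      = (c x)\<^sup>2 / (w x)\<^sup>2 * (scal h y - \<sigma> x * g x (lA w x) (lA w x) * (k * (k - 1)))"
    unfolding sum_FF[symmetric] mk sum_distrib_left
    by (intro sum.cong refl, simp only: W2)
      (use cw in \<open>simp add: E2 sc riem_FF[OF x y] power2_eq_square del: scaleR_Pair\<close>)
  have "(c x)\<^sup>2 * scal W (x, y) = (c x)\<^sup>2 * (\<Sum>i<?m + ?k. \<Sum>j<?m + ?k. ?t i j)"
    using W.scal_frame[OF xy frame_product_frame] by simp
  also have "\<dots> = (c x)\<^sup>2 * (\<Sum>i<?m. \<Sum>j<?m. ?t i j) + (c x)\<^sup>2 * (\<Sum>i<?m. \<Sum>j<?k. ?t i (?m + j))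
      + ((c x)\<^sup>2 * (\<Sum>i<?k. \<Sum>j<?m. ?t (?m + i) j) + (c x)\<^sup>2 * (\<Sum>i<?k. \<Sum>j<?k. ?t (?m + i) (?m + j)))"
    by (simp only: sum_lessThan_add sum.distrib distrib_left)
  finally show ?thesis unfolding BB BF FB FF sum_BF mk by (simp add: algebra_simps)
qed

end

lemma scal_warp:
  fixes m k :: real
  assumes x: "x \<in> S" and y: "y \<in> T" and mk: "m = real DIM('a)" "k = real DIM('b)"
  shows "(c x)\<^sup>2 * scal W (x, y) =
    scal g x + scal h y * ((c x)\<^sup>2 / (w x)\<^sup>2)
    - 2 * (m - 1) * (ftrace (g x) (hess g c x) / c x)
    - 2 * k * (ftrace (g x) (hess g w x) / w x)
    - (m - 4) * (m - 1) * (g x (cgrad g c x) (cgrad g c x) / (c x)\<^sup>2)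
    - 2 * k * (m - 2) * (g x (cgrad g w x) (cgrad g c x) / (w x * c x))
    - k * (k - 1) * (g x (cgrad g w x) (cgrad g w x) / (w x)\<^sup>2)"
proof -
  have cw: "c x \<noteq> 0" "w x \<noteq> 0" using c_pos[OF x] w_pos[OF x] by auto
  obtain e f where "frame (g x) e" "frame (h y) f"
    using frame_exists[OF B.nondeg[OF x]] frame_exists[OF F.nondeg[OF y]] by blast
  note A = scal_warp_aux[OF x y this mk]
  have N: "g x (lA c x) (lA c x) = g x (cgrad g c x) (cgrad g c x) / (c x)\<^sup>2"
    "g x (lA w x) (lA w x) = g x (cgrad g w x) (cgrad g w x) / (w x)\<^sup>2"
    "g x (lA c x) (lA w x) = g x (cgrad g w x) (cgrad g c x) / (w x * c x)"
    using B.sym[OF x, of "cgrad g w x" "cgrad g c x"] by (simp_all add: lA_def B.G_simps[OF x] power2_eq_square)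
  have s: "(c x)\<^sup>2 / (w x)\<^sup>2 * (p - \<sigma> x * q * r) = p * ((c x)\<^sup>2 / (w x)\<^sup>2) - r * q" for p q r
    using cw by (simp add: \<sigma>_def right_diff_distrib)
  show ?thesis unfolding A N s by (simp add: algebra_simps)
qed

end

section \<open>Smooth atlases\<close>

text \<open>The chart conditions as a locale of their own, in a form that can be verified for a
  product manifold chart by chart.\<close>

locale atlas =
  fixes M :: "('p, 'e::euclidean_space) smooth_structure"
  assumes chart_exists: "p \<in> points M \<Longrightarrow> \<exists>U \<phi>. (U, \<phi>) \<in> charts M \<and> p \<in> U"
    and chart_open: "(U, \<phi>) \<in> charts M \<Longrightarrow> openin (mtop M) U"
    and chart_image_open: "(U, \<phi>) \<in> charts M \<Longrightarrow> open (\<phi> ` U)"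
    and chart_homeo: "(U, \<phi>) \<in> charts M \<Longrightarrow>
      homeomorphic_map (subtopology (mtop M) U) (top_of_set (\<phi> ` U)) \<phi>"
    and transition: "(U, \<phi>) \<in> charts M \<Longrightarrow> (V, \<psi>) \<in> charts M \<Longrightarrow>
      smooth_on (\<phi> ` (U \<inter> V)) (\<psi> \<circ> inv_into U \<phi>)"

lemma smooth_manifold_atlas: "smooth_manifold M \<Longrightarrow> atlas M"
  unfolding smooth_manifold_def atlas_def by fast

lemma smooth_fun_on_subset: "smooth_fun_on M W f \<Longrightarrow> W' \<subseteq> W \<Longrightarrow> smooth_fun_on M W' f"
  unfolding smooth_fun_on_def
proof clarify
  fix V \<phi> assume "\<forall>(V, \<phi>)\<in>charts M. smooth_on (\<phi> ` (W \<inter> V)) (f \<circ> inv_into V \<phi>)"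
    and "W' \<subseteq> W" "(V, \<phi>) \<in> charts M"
  then have "smooth_on (\<phi> ` (W \<inter> V)) (f \<circ> inv_into V \<phi>)" "\<phi> ` (W' \<inter> V) \<subseteq> \<phi> ` (W \<inter> V)"
    by fast+
  then show "smooth_on (\<phi> ` (W' \<inter> V)) (f \<circ> inv_into V \<phi>)"
    by (rule smooth_on_subset)
qed

lemma smooth_nearI: "smooth_fun_on M W f \<Longrightarrow> openin (mtop M) W \<Longrightarrow> p \<in> W \<Longrightarrow> smooth_near M p f"
  unfolding smooth_near_def by blast

lemma vector_field_on_subset: "vector_field_on M W X \<Longrightarrow> W' \<subseteq> W \<Longrightarrow> vector_field_on M W' X"
  unfolding vector_field_on_def by (meson subset_iff subset_trans)

locale chart = atlas +
  fixes U \<phi> assumes chart: "(U, \<phi>) \<in> charts M"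
begin

abbreviation \<psi> where "\<psi> \<equiv> inv_into U \<phi>"
abbreviation cv where "cv \<equiv> coord_vector M (U, \<phi>)"

lemma U_open: "openin (mtop M) U" by (rule chart_open[OF chart])
lemma image_open: "open (\<phi> ` U)" by (rule chart_image_open[OF chart])

lemma inj: "inj_on \<phi> U"
  using homeomorphic_imp_injective_map[OF chart_homeo[OF chart]] openin_subset[OF U_open]
  by (simp add: Int_absorb1)

lemma \<psi>_\<phi>: "p \<in> U \<Longrightarrow> \<psi> (\<phi> p) = p" by (simp add: inj)
lemma \<phi>_\<psi>: "x \<in> \<phi> ` U \<Longrightarrow> \<phi> (\<psi> x) = x" by (rule f_inv_into_f)
lemma \<psi>_in: "x \<in> \<phi> ` W \<Longrightarrow> W \<subseteq> U \<Longrightarrow> \<psi> x \<in> W" using \<psi>_\<phi> by auto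
lemma open_image:
  assumes "openin (mtop M) W" "W \<subseteq> U"
  shows "open (\<phi> ` W)"
proof -
  have "openin (subtopology (mtop M) U) W"
    using assms U_open by (simp add: openin_open_subtopology)
  then have "openin (top_of_set (\<phi> ` U)) (\<phi> ` W)"
    using homeomorphic_map_openness[OF chart_homeo[OF chart], of W] openin_subset by blast
  then show ?thesis using image_open openin_open_eq by blast
qed

text \<open>Smoothness is defined through all charts; inside the domain of one chart that chart
  decides, as transition maps carry its expression to the others.\<close>

lemma smooth_fun_on_chart:
  assumes W: "openin (mtop M) W" "W \<subseteq> U"
  shows "smooth_fun_on M W f \<longleftrightarrow> smooth_on (\<phi> ` W) (f \<circ> \<psi>)"
proof
  assume "smooth_fun_on M W f"
  then have "smooth_on (\<phi> ` (W \<inter> U)) (f \<circ> \<psi>)"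
    unfolding smooth_fun_on_def using chart by fast
  moreover have "W \<inter> U = W" using W by auto
  ultimately show "smooth_on (\<phi> ` W) (f \<circ> \<psi>)" by simp
next
  assume f: "smooth_on (\<phi> ` W) (f \<circ> \<psi>)"
  show "smooth_fun_on M W f"
    unfolding smooth_fun_on_def
  proof clarify
    fix V \<phi>' assume V: "(V, \<phi>') \<in> charts M"
    interpret V: chart M V \<phi>' by unfold_locales (rule V)
    have o: "open (\<phi>' ` (W \<inter> V))"
      by (rule V.open_image) (use W V.U_open in auto)
    have tr: "smooth_on (\<phi>' ` (W \<inter> V)) (\<phi> \<circ> V.\<psi>)"
      by (rule smooth_on_subset[OF transition[OF V chart]]) (use W in auto)
    have "smooth_on (\<phi>' ` (W \<inter> V)) (\<lambda>x. (f \<circ> \<psi>) ((\<phi> \<circ> V.\<psi>) x))"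
      by (rule smooth_on_compose[OF o open_image[OF W] _ tr f]) (auto simp: V.\<psi>_\<phi>)
    then show "smooth_on (\<phi>' ` (W \<inter> V)) (f \<circ> inv_into V \<phi>')"
      by (rule smooth_on_cong[OF o, THEN iffD1, rotated]) (use W in \<open>auto simp: V.\<psi>_\<phi> \<psi>_\<phi>\<close>)
  qed
qed

lemma smooth_near_chart:
  assumes "p \<in> U" "smooth_near M p f"
  obtains W where "openin (mtop M) W" "p \<in> W" "W \<subseteq> U" "smooth_fun_on M W f" "open (\<phi> ` W)"
    "smooth_on (\<phi> ` W) (f \<circ> \<psi>)"
proof -
  obtain N where N: "openin (mtop M) N" "p \<in> N" "smooth_fun_on M N f"
    using assms(2) unfolding smooth_near_def by blast
  have W: "openin (mtop M) (N \<inter> U)" "N \<inter> U \<subseteq> U" using N U_open by auto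
  have f: "smooth_fun_on M (N \<inter> U) f" by (rule smooth_fun_on_subset[OF N(3)]) auto
  show ?thesis
    by (rule that[OF W(1) _ W(2) f open_image[OF W]]) (use N assms f smooth_fun_on_chart[OF W] in auto)
qed

lemma cv_apply: "smooth_near M p f \<Longrightarrow> cv p v f = dd (f \<circ> \<psi>) (\<phi> p) v"
  by (simp add: coord_vector_def)

lemma cv_linear_comb:
  assumes p: "p \<in> U"
  shows "cv p (a *\<^sub>R u + b *\<^sub>R v) f = a * cv p u f + b * cv p v f"
proof (cases "smooth_near M p f")
  case True
  then obtain W where W: "p \<in> W" "smooth_on (\<phi> ` W) (f \<circ> \<psi>)" by (rule smooth_near_chart[OF p])
  have "linear (dd (f \<circ> \<psi>) (\<phi> p))" by (rule smooth_on_linear_dd[OF W(2)]) (use W in auto)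
  then show ?thesis using True by (simp add: cv_apply linear_add linear_cmul)
qed (simp add: coord_vector_def)

lemma cv_simps:
  assumes p: "p \<in> U"
  shows "cv p (u + v) = tadd (cv p u) (cv p v)" "cv p (r *\<^sub>R u) = tscale r (cv p u)"
    "cv p (u - v) f = cv p u f - cv p v f" "cv p 0 = (\<lambda>f. 0)"
  using cv_linear_comb[OF p, of 1 u 1 v] cv_linear_comb[OF p, of r u 0 u] cv_linear_comb[OF p, of 1 u "- 1" v]
    cv_linear_comb[OF p, of 0 u 0 u]
  by (auto simp: fun_eq_iff tadd_def tscale_def)

lemma coordinate_smooth: "smooth_fun_on M U (\<lambda>q. \<phi> q \<bullet> b)"
  unfolding smooth_fun_on_chart[OF U_open subset_refl]
  by (rule smooth_on_cong[OF image_open, THEN iffD1, OF _ smooth_on_bounded_linear[OF bounded_linear_inner_left]])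
    (simp add: \<phi>_\<psi>)

text \<open>Components are read off by applying the functional to the coordinate functions. The sum
  makes sense for every functional; it inverts \<open>cv p\<close> on tangent vectors.\<close>

definition vec :: "'a tvec \<Rightarrow> 'b" where
  "vec t = (\<Sum>b\<in>Basis. t (\<lambda>q. \<phi> q \<bullet> b) *\<^sub>R b)"

lemma vec_cv:
  assumes p: "p \<in> U"
  shows "vec (cv p v) = v"
proof -
  have "cv p v (\<lambda>q. \<phi> q \<bullet> b) = v \<bullet> b" for b
  proof -
    have "cv p v (\<lambda>q. \<phi> q \<bullet> b) = dd ((\<lambda>q. \<phi> q \<bullet> b) \<circ> \<psi>) (\<phi> p) v"
      by (rule cv_apply[OF smooth_nearI[OF coordinate_smooth U_open p]])
    also have "\<dots> = dd (\<lambda>x. x \<bullet> b) (\<phi> p) v"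
      by (rule fun_cong[OF dd_cong[OF image_open]]) (use p \<phi>_\<psi> in auto)
    also have "\<dots> = v \<bullet> b"
      by (rule dd_eqI) (rule bounded_linear_imp_has_derivative[OF bounded_linear_inner_left])
    finally show ?thesis .
  qed
  then show ?thesis by (simp add: vec_def euclidean_representation)
qed

lemma cv_inj: "p \<in> U \<Longrightarrow> cv p u = cv p v \<Longrightarrow> u = v"
  using vec_cv by metis

text \<open>A tangent vector may be given in any chart around \<open>p\<close>; by the chain rule
  the differential of the transition map rewrites it in the fixed chart.\<close>

lemma tangent_space_chart:
  assumes p: "p \<in> U"
  shows "tangent_space M p = range (cv p)"
proof
  show "range (cv p) \<subseteq> tangent_space M p"
    unfolding tangent_space_def using chart p by blast
  show "tangent_space M p \<subseteq> range (cv p)"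
  proof
    fix t assume "t \<in> tangent_space M p"
    then obtain V \<phi>' v where V: "(V, \<phi>') \<in> charts M" "p \<in> V" and t: "t = coord_vector M (V, \<phi>') p v"
      unfolding tangent_space_def by blast
    interpret V: chart M V \<phi>' by unfold_locales (rule V)
    have tr: "smooth_on (\<phi>' ` (V \<inter> U)) (\<phi> \<circ> V.\<psi>)" by (rule transition[OF V(1) chart])
    have pd: "\<phi>' p \<in> \<phi>' ` (V \<inter> U)" using V p by auto
    have "t f = cv p (dd (\<phi> \<circ> V.\<psi>) (\<phi>' p) v) f" for f
    proof (cases "smooth_near M p f")
      case True
      obtain W where W: "openin (mtop M) W" "p \<in> W" "W \<subseteq> U" "smooth_fun_on M W f" "open (\<phi> ` W)"
        "smooth_on (\<phi> ` W) (f \<circ> \<psi>)" by (rule smooth_near_chart[OF p True])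
      have o: "open (\<phi>' ` (W \<inter> V))" by (rule V.open_image) (use W V.U_open in auto)
      have eq: "(\<phi> \<circ> V.\<psi>) (\<phi>' p) = \<phi> p" by (simp add: V.\<psi>_\<phi> V)
      have "((\<lambda>x. (f \<circ> \<psi>) ((\<phi> \<circ> V.\<psi>) x)) has_derivative
          (\<lambda>u. dd (f \<circ> \<psi>) (\<phi> p) (dd (\<phi> \<circ> V.\<psi>) (\<phi>' p) u))) (at (\<phi>' p))"
        by (rule has_derivative_compose[OF smooth_on_has_derivative[OF tr pd]])
          (unfold eq, rule smooth_on_has_derivative[OF W(6)], use W in auto)
      then have "dd (\<lambda>x. (f \<circ> \<psi>) ((\<phi> \<circ> V.\<psi>) x)) (\<phi>' p) v = dd (f \<circ> \<psi>) (\<phi> p) (dd (\<phi> \<circ> V.\<psi>) (\<phi>' p) v)"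
        by (rule dd_eqI)
      moreover have "dd (\<lambda>x. (f \<circ> \<psi>) ((\<phi> \<circ> V.\<psi>) x)) (\<phi>' p) = dd (f \<circ> V.\<psi>) (\<phi>' p)"
        by (rule dd_cong[OF o]) (use W V in \<open>auto simp: V.\<psi>_\<phi> \<psi>_\<phi>\<close>)
      ultimately show ?thesis using True by (simp add: t cv_apply V.cv_apply)
    qed (simp add: t coord_vector_def)
    then show "t \<in> range (cv p)" by blast
  qed
qed

lemma cv_tangent: "p \<in> U \<Longrightarrow> cv p v \<in> tangent_space M p"
  by (simp add: tangent_space_chart)

lemma cv_vec: "p \<in> U \<Longrightarrow> t \<in> tangent_space M p \<Longrightarrow> cv p (vec t) = t"
  using tangent_space_chart vec_cv by auto

definition coords :: "('a \<Rightarrow> 'a tvec) \<Rightarrow> 'b \<Rightarrow> 'b" where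
  "coords X x = vec (X (\<psi> x))"

text \<open>Fields are tested on smooth functions; testing on the coordinate functions yields smooth
  components.\<close>

lemma vector_field_coords:
  assumes W: "openin (mtop M) W" "W \<subseteq> U" and X: "vector_field_on M W X"
  shows "smooth_on (\<phi> ` W) (coords X)" "p \<in> W \<Longrightarrow> X p = cv p (coords X (\<phi> p))"
proof -
  have "smooth_on (\<phi> ` W) (\<lambda>x. X (\<psi> x) (\<lambda>q. \<phi> q \<bullet> b))" for b
  proof -
    have "smooth_fun_on M W (\<lambda>q. \<phi> q \<bullet> b)" by (rule smooth_fun_on_subset[OF coordinate_smooth W(2)])
    then have "smooth_fun_on M W (\<lambda>p. X p (\<lambda>q. \<phi> q \<bullet> b))"
      using X W unfolding vector_field_on_def by blast
    then show ?thesis by (simp add: smooth_fun_on_chart[OF W] comp_def)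
  qed
  then show "smooth_on (\<phi> ` W) (coords X)"
    unfolding coords_def vec_def by (intro smooth_on_sum smooth_on_scaleR smooth_on_const open_image W)
  assume p: "p \<in> W"
  then have "X p \<in> tangent_space M p" using X unfolding vector_field_on_def by blast
  then show "X p = cv p (coords X (\<phi> p))" using p W by (simp add: coords_def \<psi>_\<phi> cv_vec subset_iff)
qed

lemma vector_fieldI:
  assumes W: "openin (mtop M) W" "W \<subseteq> U" and \<xi>: "smooth_on (\<phi> ` W) \<xi>"
    and X: "\<And>p. p \<in> W \<Longrightarrow> X p = cv p (\<xi> (\<phi> p))"
  shows "vector_field_on M W X"
  unfolding vector_field_on_def
proof (intro conjI ballI allI impI)
  show "X p \<in> tangent_space M p" if "p \<in> W" for p
    using that X W cv_tangent by auto
  fix N f assume N: "openin (mtop M) N \<and> N \<subseteq> W \<and> smooth_fun_on M N f"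
  then have N': "openin (mtop M) N" "N \<subseteq> U" using W by auto
  have o: "open (\<phi> ` N)" by (rule open_image[OF N'])
  have f: "smooth_on (\<phi> ` N) (f \<circ> \<psi>)" using N smooth_fun_on_chart[OF N'] by blast
  have \<xi>': "smooth_on (\<phi> ` N) \<xi>" by (rule smooth_on_subset[OF \<xi>]) (use N in auto)
  have "smooth_on (\<phi> ` N) (\<lambda>x. dd (f \<circ> \<psi>) x (\<xi> x))"
    by (rule smooth_on_apply[OF o smooth_on_linear_dd[OF f] smooth_on_dd[OF f] \<xi>'])
  then have "smooth_on (\<phi> ` N) ((\<lambda>p. X p f) \<circ> \<psi>)"
  proof (rule smooth_on_transfer[OF o])
    fix x assume "x \<in> \<phi> ` N"
    then obtain p where p: "p \<in> N" "x = \<phi> p" by blast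
    then have pW: "p \<in> W" "p \<in> U" using N W by auto
    have "smooth_near M p f" by (rule smooth_nearI[of M N]) (use N p in auto)
    then have "X p f = dd (f \<circ> \<psi>) (\<phi> p) (\<xi> (\<phi> p))" using X[OF pW(1)] cv_apply by simp
    then show "((\<lambda>p. X p f) \<circ> \<psi>) x = dd (f \<circ> \<psi>) x (\<xi> x)" using p(2) \<psi>_\<phi>[OF pW(2)] by simp
  qed
  then show "smooth_fun_on M N (\<lambda>p. X p f)" using smooth_fun_on_chart[OF N'] by blast
qed

lemma coords_eqI:
  assumes "W \<subseteq> U" "\<And>p. p \<in> W \<Longrightarrow> X p = cv p (\<xi> (\<phi> p))" "x \<in> \<phi> ` W"
  shows "coords X x = \<xi> x"
  using assms by (auto simp: coords_def \<psi>_\<phi> vec_cv subset_iff)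

lemma coords_simps:
  assumes "p \<in> U"
  shows "coords (\<lambda>q. tadd (X q) (Y q)) (\<phi> p) = coords X (\<phi> p) + coords Y (\<phi> p)"
    "coords (\<lambda>q. tscale (f q) (X q)) (\<phi> p) = f p *\<^sub>R coords X (\<phi> p)"
  using assms by (simp_all add: coords_def vec_def tadd_def tscale_def \<psi>_\<phi> scaleR_add_left sum.distrib scaleR_sum_right)

lemma vector_field_apply:
  assumes W: "openin (mtop M) W" "W \<subseteq> U" and X: "vector_field_on M W X" and p: "p \<in> W" and f: "smooth_near M p f"
  shows "X p f = dd (f \<circ> \<psi>) (\<phi> p) (coords X (\<phi> p))"
  using vector_field_coords(2)[OF W X p] cv_apply[OF f] by metis

text \<open>Both iterated derivatives contain the same second derivative of \<open>f\<close>, which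
  cancels by Schwarz's theorem and leaves a first-order operator.\<close>

lemma lie_bracket_chart:
  assumes W: "openin (mtop M) W" "W \<subseteq> U" and X: "vector_field_on M W X" and Y: "vector_field_on M W Y" and p: "p \<in> W"
  shows "lie_bracket M X Y p = cv p (bracket (coords X) (coords Y) (\<phi> p))"
proof
  fix f
  have pU: "p \<in> U" using p W by auto
  show "lie_bracket M X Y p f = cv p (bracket (coords X) (coords Y) (\<phi> p)) f"
  proof (cases "smooth_near M p f")
    case True
    obtain N' where N': "openin (mtop M) N'" "p \<in> N'" "N' \<subseteq> U" "smooth_fun_on M N' f"
      using True by (rule smooth_near_chart[OF pU])
    define N where "N = N' \<inter> W"
    have N: "openin (mtop M) N" "N \<subseteq> U" "N \<subseteq> W" "p \<in> N" using N' W p by (auto simp: N_def)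
    have fN: "smooth_fun_on M N f" by (rule smooth_fun_on_subset[OF N'(4)]) (simp add: N_def)
    define F where "F = f \<circ> \<psi>"
    have o: "open (\<phi> ` N)" by (rule open_image[OF N(1,2)])
    have x: "\<phi> p \<in> \<phi> ` N" using N by auto
    have F: "smooth_on (\<phi> ` N) F" using fN smooth_fun_on_chart[OF N(1,2)] by (simp add: F_def)
    have iter: "X p (\<lambda>q. Y q f) = dd (\<lambda>y. dd F y (coords Y (\<phi> p))) (\<phi> p) (coords X (\<phi> p))
        + dd F (\<phi> p) (dd (coords Y) (\<phi> p) (coords X (\<phi> p)))"
      if X: "vector_field_on M W X" and Y: "vector_field_on M W Y" for X Y
    proof -
      have "smooth_fun_on M N (\<lambda>q. Y q f)" using Y N fN unfolding vector_field_on_def by blast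
      then have "X p (\<lambda>q. Y q f) = dd ((\<lambda>q. Y q f) \<circ> \<psi>) (\<phi> p) (coords X (\<phi> p))"
        by (intro vector_field_apply[OF W X p] smooth_nearI[OF _ N(1,4)])
      also have "\<dots> = dd (\<lambda>y. dd F y (coords Y y)) (\<phi> p) (coords X (\<phi> p))"
      proof (rule fun_cong[OF dd_cong[OF o x]])
        fix y assume "y \<in> \<phi> ` N"
        then obtain q where q: "q \<in> N" "y = \<phi> q" by blast
        then show "((\<lambda>q. Y q f) \<circ> \<psi>) y = dd F y (coords Y y)"
          using vector_field_apply[OF W Y, of q f] smooth_nearI[OF fN N(1)] N
          by (simp add: F_def \<psi>_\<phi> subset_iff)
      qed
      also have "\<dots> = dd (\<lambda>y. dd F y (coords Y (\<phi> p))) (\<phi> p) (coords X (\<phi> p))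
          + dd F (\<phi> p) (dd (coords Y) (\<phi> p) (coords X (\<phi> p)))"
      proof (rule dd_eqI, rule has_derivative_apply[OF o x])
        show "linear (dd F y)" if "y \<in> \<phi> ` N" for y by (rule smooth_on_linear_dd[OF F that])
        show "(\<lambda>y. dd F y i) differentiable at (\<phi> p)" for i
          by (rule smooth_on_differentiable[OF smooth_on_dd[OF F] x])
        show "(coords Y has_derivative dd (coords Y) (\<phi> p)) (at (\<phi> p))"
          by (rule smooth_on_has_derivative[OF vector_field_coords(1)[OF W Y]]) (use p in auto)
      qed
      finally show ?thesis .
    qed
    have "linear (dd F (\<phi> p))" by (rule smooth_on_linear_dd[OF F x])
    moreover have "dd (\<lambda>y. dd F y (coords Y (\<phi> p))) (\<phi> p) (coords X (\<phi> p))
        = dd (\<lambda>y. dd F y (coords X (\<phi> p))) (\<phi> p) (coords Y (\<phi> p))"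
      by (rule dd_second[OF o x F])
    ultimately show ?thesis
      using iter[OF X Y] iter[OF Y X] True by (simp add: lie_bracket_def cv_apply bracket_def linear_diff F_def)
  qed (simp add: lie_bracket_def coord_vector_def)
qed

lemma bracket_smooth:
  assumes W: "open T" and \<xi>: "smooth_on T \<xi>" and \<eta>: "smooth_on T \<eta>"
  shows "smooth_on T (bracket \<xi> \<eta>)"
  unfolding bracket_def[abs_def]
  by (rule smooth_on_diff[OF W smooth_on_apply[OF W smooth_on_linear_dd[OF \<eta>] smooth_on_dd[OF \<eta>] \<xi>]
        smooth_on_apply[OF W smooth_on_linear_dd[OF \<xi>] smooth_on_dd[OF \<xi>] \<eta>]])

lemma lie_bracket_vector_field:
  assumes W: "openin (mtop M) W" "W \<subseteq> U" and X: "vector_field_on M W X" and Y: "vector_field_on M W Y"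
  shows "vector_field_on M W (lie_bracket M X Y)"
  by (rule vector_fieldI[OF W bracket_smooth[OF open_image[OF W] vector_field_coords(1)[OF W X] vector_field_coords(1)[OF W Y]]])
    (rule lie_bracket_chart[OF W X Y])

lemma constant_vector_field: "vector_field_on M U (\<lambda>p. cv p v)"
  by (rule vector_fieldI[OF U_open subset_refl smooth_on_const]) simp

lemma coords_constant: "x \<in> \<phi> ` U \<Longrightarrow> coords (\<lambda>p. cv p v) x = v"
  by (rule coords_eqI[of U]) auto

end

section \<open>Smoothness as a local property\<close>

context atlas
begin

lemma smooth_fun_on_local:
  assumes "\<And>p. p \<in> W \<Longrightarrow> smooth_near M p f" "openin (mtop M) W"
  shows "smooth_fun_on M W f"
  unfolding smooth_fun_on_def
proof clarify
  fix V \<phi>' assume V: "(V, \<phi>') \<in> charts M"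
  interpret V: chart M V \<phi>' by unfold_locales (rule V)
  show "smooth_on (\<phi>' ` (W \<inter> V)) (f \<circ> V.\<psi>)"
  proof (rule smooth_on_local)
    fix x assume "x \<in> \<phi>' ` (W \<inter> V)"
    then obtain p where p: "p \<in> W" "p \<in> V" "x = \<phi>' p" by blast
    obtain N where "p \<in> N" "open (\<phi>' ` N)" "smooth_on (\<phi>' ` N) (f \<circ> V.\<psi>)"
      using assms(1)[OF p(1)] by (rule V.smooth_near_chart[OF p(2)])
    then show "\<exists>T. open T \<and> x \<in> T \<and> smooth_on T (f \<circ> V.\<psi>)"
      using p by blast
  qed
qed

lemma vector_field_on_local:
  assumes W: "openin (mtop M) W"
    and X: "\<And>p. p \<in> W \<Longrightarrow> \<exists>N. openin (mtop M) N \<and> p \<in> N \<and> vector_field_on M N X"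
  shows "vector_field_on M W X"
  unfolding vector_field_on_def
proof (intro conjI ballI allI impI)
  show "X p \<in> tangent_space M p" if "p \<in> W" for p
    using X[OF that] unfolding vector_field_on_def by blast
  fix V f assume V: "openin (mtop M) V \<and> V \<subseteq> W \<and> smooth_fun_on M V f"
  show "smooth_fun_on M V (\<lambda>p. X p f)"
  proof (rule smooth_fun_on_local)
    fix p assume p: "p \<in> V"
    then obtain N where N: "openin (mtop M) N" "p \<in> N" "vector_field_on M N X" using X V by blast
    have "smooth_fun_on M (N \<inter> V) f" by (rule smooth_fun_on_subset[of _ V]) (use V in auto)
    moreover have o: "openin (mtop M) (N \<inter> V)" using N V by auto
    ultimately have "smooth_fun_on M (N \<inter> V) (\<lambda>p. X p f)"
      using N(3) unfolding vector_field_on_def by blast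
    then show "smooth_near M p (\<lambda>p. X p f)" by (rule smooth_nearI[OF _ o]) (use p N in auto)
  qed (use V in blast)
qed

end

section \<open>Metrics read in charts\<close>

definition chart_metric ::
  "('p, 'e::euclidean_space) smooth_structure \<Rightarrow> 'p metric_field \<Rightarrow> 'p set \<times> ('p \<Rightarrow> 'e) \<Rightarrow> 'e \<Rightarrow> 'e \<Rightarrow> 'e \<Rightarrow> real" where
  "chart_metric M h = (\<lambda>(U, \<phi>) x u v. h (inv_into U \<phi> x)
     (coord_vector M (U, \<phi>) (inv_into U \<phi> x) u) (coord_vector M (U, \<phi>) (inv_into U \<phi> x) v))"

text \<open>The condition that is carried over to the warped product: in a product chart the metric
  is the explicit \<open>warp\<close>, from which nondegeneracy and smoothness are read off.\<close>

locale metric_atlas = atlas M for M :: "('p, 'e::euclidean_space) smooth_structure" +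
  fixes h :: "'p metric_field"
  assumes local_metric: "(U, \<phi>) \<in> charts M \<Longrightarrow> local_metric (\<phi> ` U) (chart_metric M h (U, \<phi>))"

lemma pseudo_riemannian_metric_atlas:
  assumes h: "pseudo_riemannian M h"
  shows "metric_atlas M h"
proof -
  have man: "smooth_manifold M" using h unfolding pseudo_riemannian_def by blast
  interpret atlas M by (rule smooth_manifold_atlas[OF man])
  show ?thesis
  proof (intro metric_atlas.intro metric_atlas_axioms.intro)
    show "atlas M" by (rule atlas_axioms)
  next
    fix U \<phi> assume c: "(U, \<phi>) \<in> charts M"
    then interpret C: chart M U \<phi> by unfold_locales
    show "local_metric (\<phi> ` U) (chart_metric M h (U, \<phi>))"
    proof (unfold local_metric_def, unfold_locales)
      show "open (\<phi> ` U)" by (rule C.image_open)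
      show "nondeg_form (chart_metric M h (U, \<phi>) x)" if x: "x \<in> \<phi> ` U" for x
      proof -
        define p where "p = C.\<psi> x"
        have p: "p \<in> U" "p \<in> points M"
          using C.\<psi>_in[OF x] openin_subset[OF C.U_open] by (auto simp: p_def)
        define b where "b = chart_metric M h (U, \<phi>) x"
        have b: "b u v = h p (C.cv p u) (C.cv p v)" for u v by (simp add: b_def chart_metric_def p_def)
        have sym: "b u v = b v u" for u v
          unfolding b using h p C.cv_tangent[OF p(1)] unfolding pseudo_riemannian_def by blast
        have "h p (tadd (tscale a (C.cv p u)) (C.cv p u')) (C.cv p v) =
            a * h p (C.cv p u) (C.cv p v) + h p (C.cv p u') (C.cv p v)" for a u u' v
          using h p C.cv_tangent[OF p(1)] unfolding pseudo_riemannian_def by blast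
        then have comb: "b (a *\<^sub>R u + u') v = a * b u v + b u' v" for a u u' v
          unfolding b by (simp add: C.cv_simps[OF p(1)])
        have lin: "linear (\<lambda>u. b u v)" for v
        proof (rule linearI)
          show "b (u + u') v = b u v + b u' v" for u u' using comb[of 1 u u' v] by simp
          \<comment> \<open>With \<open>a = 1\<close> and zero vectors the combined axiom reads
            \<open>b 0 v = b 0 v + b 0 v\<close>; the value 0 is what separates homogeneity from
            it.\<close>
          have "b 0 v = 0" using comb[of 1 0 0 v] by simp
          then show "b (r *\<^sub>R u) v = r *\<^sub>R b u v" for r u using comb[of r u 0 v] by simp
        qed
        have "u = 0" if z: "\<And>v. b u v = 0" for u
        proof -
          have "\<forall>t\<in>tangent_space M p. h p (C.cv p u) t = 0"
            using z unfolding b C.tangent_space_chart[OF p(1)] by blast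
          then have "C.cv p u = (\<lambda>f. 0)"
            using h p C.cv_tangent[OF p(1)] unfolding pseudo_riemannian_def by blast
          then have "C.cv p u = C.cv p 0" using C.cv_simps(4)[OF p(1)] by simp
          then show ?thesis by (rule C.cv_inj[OF p(1)])
        qed
        moreover have "linear (b u)" for u
        proof -
          have "b u = (\<lambda>v. b v u)" using sym by blast
          then show ?thesis using lin[of u] by simp
        qed
        ultimately have "nondeg_form b"
          unfolding nondeg_form_def bilinear_def using lin sym by blast
        then show ?thesis by (simp add: b_def)
      qed
      show "smooth_on (\<phi> ` U) (\<lambda>x. chart_metric M h (U, \<phi>) x u v)" for u v
      proof -
        have "smooth_fun_on M U (\<lambda>p. h p (C.cv p u) (C.cv p v))"
          using h C.U_open C.constant_vector_field unfolding pseudo_riemannian_def by blast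
        then show ?thesis
          unfolding C.smooth_fun_on_chart[OF C.U_open subset_refl] by (simp add: comp_def chart_metric_def)
      qed
    qed
  qed
qed

section \<open>The Levi-Civita connection in a chart\<close>

text \<open>Localized to one open set, so that a single uniqueness argument covers both the chosen
  connection and the connection of another chart on an overlap.\<close>

definition lc_on ::
  "('p, 'e::euclidean_space) smooth_structure \<Rightarrow> 'p metric_field \<Rightarrow> 'p set \<Rightarrow>
    (('p \<Rightarrow> 'p tvec) \<Rightarrow> ('p \<Rightarrow> 'p tvec) \<Rightarrow> 'p \<Rightarrow> 'p tvec) \<Rightarrow> bool" where
  "lc_on M h W D \<longleftrightarrow>
    (\<forall>X Y Z. vector_field_on M W X \<and> vector_field_on M W Y \<and> vector_field_on M W Z \<longrightarrow>
      vector_field_on M W (D X Y) \<and>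
      (\<forall>p\<in>W. D X Y p = tadd (D Y X p) (lie_bracket M X Y p) \<and>
        X p (\<lambda>q. h q (Y q) (Z q)) = h p (D X Y p) (Z p) + h p (Y p) (D X Z p)))"

locale metric_chart = metric_atlas M h + chart M U \<phi>
  for M :: "('p, 'e::euclidean_space) smooth_structure" and h U \<phi>
begin

abbreviation G where "G \<equiv> chart_metric M h (U, \<phi>)"

sublocale L: local_metric "\<phi> ` U" G by (rule local_metric[OF chart])

lemma metric_cv: "p \<in> U \<Longrightarrow> h p (cv p u) (cv p v) = G (\<phi> p) u v"
  by (simp add: chart_metric_def \<psi>_\<phi>)

definition chart_conn :: "('p \<Rightarrow> 'p tvec) \<Rightarrow> ('p \<Rightarrow> 'p tvec) \<Rightarrow> 'p \<Rightarrow> 'p tvec" where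
  "chart_conn X Y p = cv p (covd G (coords X) (coords Y) (\<phi> p))"

context
  fixes W assumes W: "openin (mtop M) W" "W \<subseteq> U"
begin

lemma pU: "p \<in> W \<Longrightarrow> p \<in> U" using W by auto
lemma xW: "p \<in> W \<Longrightarrow> \<phi> p \<in> \<phi> ` W" by auto
lemma xU: "p \<in> W \<Longrightarrow> \<phi> p \<in> \<phi> ` U" using W by auto

lemma coords_differentiable: "vector_field_on M W X \<Longrightarrow> p \<in> W \<Longrightarrow> coords X differentiable (at (\<phi> p))"
  using smooth_on_differentiable[OF vector_field_coords(1)[OF W] xW] .

lemma metric_vector_fields:
  assumes X: "vector_field_on M W X" and Y: "vector_field_on M W Y" and p: "p \<in> W"
  shows "h p (X p) (Y p) = G (\<phi> p) (coords X (\<phi> p)) (coords Y (\<phi> p))"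
  using vector_field_coords(2)[OF W X p] vector_field_coords(2)[OF W Y p] metric_cv[OF pU[OF p]] by metis

lemma metric_smooth:
  assumes X: "vector_field_on M W X" and Y: "vector_field_on M W Y"
  shows "smooth_fun_on M W (\<lambda>q. h q (X q) (Y q))"
  unfolding smooth_fun_on_chart[OF W]
proof (rule smooth_on_transfer[OF open_image[OF W]])
  show "smooth_on (\<phi> ` W) (\<lambda>x. G x (coords X x) (coords Y x))"
    by (rule smooth_on_apply2[OF open_image[OF W] L.bil smooth_on_subset[OF L.smooth]
          vector_field_coords(1)[OF W X] vector_field_coords(1)[OF W Y]]) (use W in auto)
  fix x assume "x \<in> \<phi> ` W"
  then obtain p where p: "p \<in> W" "x = \<phi> p" by blast
  then show "((\<lambda>q. h q (X q) (Y q)) \<circ> \<psi>) x = G x (coords X x) (coords Y x)"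
    using metric_vector_fields[OF X Y p(1)] \<psi>_\<phi>[OF pU[OF p(1)]] by simp
qed

lemma metric_derivative:
  assumes X: "vector_field_on M W X" and Y: "vector_field_on M W Y" and Z: "vector_field_on M W Z" and p: "p \<in> W"
  shows "X p (\<lambda>q. h q (Y q) (Z q)) = dd (\<lambda>x. G x (coords Y x) (coords Z x)) (\<phi> p) (coords X (\<phi> p))"
proof -
  have "X p (\<lambda>q. h q (Y q) (Z q)) = dd ((\<lambda>q. h q (Y q) (Z q)) \<circ> \<psi>) (\<phi> p) (coords X (\<phi> p))"
    by (rule vector_field_apply[OF W X p smooth_nearI[OF metric_smooth[OF Y Z] W(1) p]])
  also have "\<dots> = dd (\<lambda>x. G x (coords Y x) (coords Z x)) (\<phi> p) (coords X (\<phi> p))"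
  proof (rule fun_cong[OF dd_cong[OF open_image[OF W] xW[OF p]]])
    fix x assume "x \<in> \<phi> ` W"
    then obtain q where q: "q \<in> W" "x = \<phi> q" by blast
    then show "((\<lambda>q. h q (Y q) (Z q)) \<circ> \<psi>) x = G x (coords Y x) (coords Z x)"
      using metric_vector_fields[OF Y Z q(1)] \<psi>_\<phi>[OF pU[OF q(1)]] by simp
  qed
  finally show ?thesis .
qed

lemma chart_conn_vector_field:
  assumes "vector_field_on M W X" "vector_field_on M W Y"
  shows "vector_field_on M W (chart_conn X Y)"
  by (rule vector_fieldI[OF W L.covd_smooth[OF open_image[OF W] _ vector_field_coords(1)[OF W assms(1)]
          vector_field_coords(1)[OF W assms(2)]]]) (use W in \<open>auto simp: chart_conn_def\<close>)

lemma chart_conn_torsion: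
  assumes X: "vector_field_on M W X" and Y: "vector_field_on M W Y" and p: "p \<in> W"
  shows "chart_conn X Y p = tadd (chart_conn Y X p) (lie_bracket M X Y p)"
  unfolding lie_bracket_chart[OF W X Y p] chart_conn_def
  by (simp add: L.covd_torsion[OF xU[OF p], of "coords X" "coords Y"] cv_simps[OF pU[OF p]])

lemma chart_conn_metric:
  assumes X: "vector_field_on M W X" and Y: "vector_field_on M W Y" and Z: "vector_field_on M W Z" and p: "p \<in> W"
  shows "X p (\<lambda>q. h q (Y q) (Z q)) = h p (chart_conn X Y p) (Z p) + h p (Y p) (chart_conn X Z p)"
proof -
  have "X p (\<lambda>q. h q (Y q) (Z q)) = G (\<phi> p) (covd G (coords X) (coords Y) (\<phi> p)) (coords Z (\<phi> p))
      + G (\<phi> p) (coords Y (\<phi> p)) (covd G (coords X) (coords Z) (\<phi> p))"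
    unfolding metric_derivative[OF X Y Z p]
    by (rule L.covd_metric[OF xU[OF p] coords_differentiable[OF Y p] coords_differentiable[OF Z p]])
  also have "\<dots> = h p (chart_conn X Y p) (Z p) + h p (Y p) (chart_conn X Z p)"
    using vector_field_coords(2)[OF W Y p] vector_field_coords(2)[OF W Z p] metric_cv[OF pU[OF p]]
    unfolding chart_conn_def by metis
  finally show ?thesis .
qed

lemma lc_on_chart_conn: "lc_on M h W chart_conn"
  unfolding lc_on_def using chart_conn_vector_field chart_conn_torsion chart_conn_metric by blast

text \<open>Koszul's formula at \<open>p\<close> for the coordinate expressions. Every
  \<open>z\<close> is the value of a field with constant components, so nondegeneracy at the single
  point \<open>\<phi> p\<close> identifies the two derivatives.\<close>

lemma lc_on_unique:
  assumes D: "lc_on M h W D" and X: "vector_field_on M W X" and Y: "vector_field_on M W Y" and p: "p \<in> W"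
  shows "D X Y p = chart_conn X Y p"
proof -
  let ?x = "\<phi> p"
  note o = open_image[OF W] and x = xW[OF p] and pU = pU[OF p] and xU = xU[OF p]
  have vf: "vector_field_on M W (D A B)" if "vector_field_on M W A" "vector_field_on M W B" for A B
    using D that unfolding lc_on_def by blast
  have val: "D A B p = cv p (coords (D A B) ?x)" if "vector_field_on M W A" "vector_field_on M W B" for A B
    by (rule vector_field_coords(2)[OF W vf[OF that] p])
  have tor: "coords (D A B) ?x - coords (D B A) ?x = bracket (coords A) (coords B) ?x"
    if A: "vector_field_on M W A" and B: "vector_field_on M W B" for A B
  proof -
    have "D A B p = tadd (D B A p) (lie_bracket M A B p)" using D A B p unfolding lc_on_def by blast
    then have "cv p (coords (D A B) ?x) = cv p (coords (D B A) ?x + bracket (coords A) (coords B) ?x)"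
      unfolding lie_bracket_chart[OF W A B p] val[OF A B] val[OF B A] cv_simps[OF pU] .
    then have "coords (D A B) ?x = coords (D B A) ?x + bracket (coords A) (coords B) ?x"
      by (rule cv_inj[OF pU])
    then show ?thesis by simp
  qed
  have met: "dd (\<lambda>y. G y (coords B y) (coords C y)) ?x (coords A ?x)
      = G ?x (coords (D A B) ?x) (coords C ?x) + G ?x (coords B ?x) (coords (D A C) ?x)"
    if A: "vector_field_on M W A" and B: "vector_field_on M W B" and C: "vector_field_on M W C" for A B C
  proof -
    have "A p (\<lambda>q. h q (B q) (C q)) = h p (D A B p) (C p) + h p (B p) (D A C p)"
      using D A B C p unfolding lc_on_def by blast
    then show ?thesis
      unfolding metric_derivative[OF A B C p] metric_vector_fields[OF vf[OF A B] C p]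
        metric_vector_fields[OF B vf[OF A C] p] .
  qed
  have "coords (D X Y) ?x = covd G (coords X) (coords Y) ?x"
  proof (rule L.eqI[OF xU])
    fix z
    define Z where "Z = (\<lambda>p. cv p z)"
    have Z: "vector_field_on M W Z"
      unfolding Z_def by (rule vector_field_on_subset[OF constant_vector_field W(2)])
    have cZ: "coords Z y = z" if "y \<in> \<phi> ` W" for y
      unfolding Z_def by (rule coords_constant) (use that W in auto)
    \<comment> \<open>\<open>coords Z\<close> is constant on the open image only; since derivatives
      are local, it may be replaced there by the constant function \<open>z\<close>.\<close>
    have br: "bracket \<xi> (coords Z) ?x = bracket \<xi> (\<lambda>_. z) ?x" for \<xi>
      using dd_cong[OF o x cZ] cZ[OF x] by (simp add: bracket_def)
    have d1: "dd (\<lambda>y. G y (coords Y y) (coords Z y)) ?x = dd (\<lambda>y. G y (coords Y y) z) ?x"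
      by (rule dd_cong[OF o x]) (simp add: cZ)
    have d2: "dd (\<lambda>y. G y (coords Z y) (coords X y)) ?x = dd (\<lambda>y. G y z (coords X y)) ?x"
      by (rule dd_cong[OF o x]) (simp add: cZ)
    show "G ?x (coords (D X Y) ?x) z = G ?x (covd G (coords X) (coords Y) ?x) z"
      by (rule L.koszul_unique[OF xU coords_differentiable[OF X p] coords_differentiable[OF Y p]
            tor[OF X Y] tor[OF X Z, unfolded br] tor[OF Y Z, unfolded br]
            met[OF X Y Z, unfolded d1 cZ[OF x]] met[OF Y Z X, unfolded d2 cZ[OF x]]
            met[OF Z X Y, unfolded cZ[OF x]]])
  qed
  then show ?thesis by (simp add: val[OF X Y] chart_conn_def)
qed

end

lemma chart_conn_cong:
  assumes W: "openin (mtop M) W" "W \<subseteq> U" and p: "p \<in> W" and eq: "\<And>q. q \<in> W \<Longrightarrow> X q = X' q \<and> Y q = Y' q"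
  shows "chart_conn X Y p = chart_conn X' Y' p"
proof -
  have "coords X x = coords X' x" "coords Y x = coords Y' x" if "x \<in> \<phi> ` W" for x
    using \<psi>_in[OF that W(2)] eq by (auto simp: coords_def)
  then have "covd G (coords X) (coords Y) (\<phi> p) = covd G (coords X') (coords Y') (\<phi> p)"
    by (intro L.covd_cong[OF open_image[OF W]]) (use p in auto)
  then show ?thesis by (simp add: chart_conn_def)
qed

lemma chart_conn_linear:
  assumes W: "openin (mtop M) W" "W \<subseteq> U" and p: "p \<in> W"
    and X: "vector_field_on M W X" and Y: "vector_field_on M W Y" and Z: "vector_field_on M W Z"
    and f: "smooth_fun_on M W f"
  shows "chart_conn (\<lambda>q. tadd (X q) (Y q)) Z p = tadd (chart_conn X Z p) (chart_conn Y Z p)"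
    and "chart_conn (\<lambda>q. tscale (f q) (X q)) Y p = tscale (f p) (chart_conn X Y p)"
    and "chart_conn X (\<lambda>q. tadd (Y q) (Z q)) p = tadd (chart_conn X Y p) (chart_conn X Z p)"
    and "chart_conn X (\<lambda>q. tscale (f q) (Y q)) p =
      tadd (tscale (X p f) (Y p)) (tscale (f p) (chart_conn X Y p))"
proof -
  let ?x = "\<phi> p"
  have qU: "q \<in> U" if "q \<in> W" for q using that W by auto
  note pU = qU[OF p] and o = open_image[OF W]
  have x: "?x \<in> \<phi> ` W" and xU: "?x \<in> \<phi> ` U" using p pU by auto
  note lin = linear_add[OF smooth_on_linear_dd[OF vector_field_coords(1)[OF W _] x]]
    linear_cmul[OF smooth_on_linear_dd[OF vector_field_coords(1)[OF W _] x]]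
  show "chart_conn (\<lambda>q. tadd (X q) (Y q)) Z p = tadd (chart_conn X Z p) (chart_conn Y Z p)"
    by (simp add: chart_conn_def covd_def coords_simps(1)[OF pU] lin Z
        L.christoffel_simps[OF xU] add_ac flip: cv_simps(1)[OF pU])
  show "chart_conn (\<lambda>q. tscale (f q) (X q)) Y p = tscale (f p) (chart_conn X Y p)"
    by (simp add: chart_conn_def covd_def coords_simps(2)[OF pU] lin Y
        L.christoffel_simps[OF xU] scaleR_add_right flip: cv_simps(2)[OF pU])
  have d: "(coords V has_derivative dd (coords V) ?x) (at ?x)" if "vector_field_on M W V" for V
    by (rule smooth_on_has_derivative[OF vector_field_coords(1)[OF W that] x])
  have "dd (coords (\<lambda>q. tadd (Y q) (Z q))) ?x v = dd (coords Y) ?x v + dd (coords Z) ?x v" for v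
  proof (rule dd_eqI, rule has_derivative_transfer_open[OF has_derivative_add[OF d[OF Y] d[OF Z]] o x])
    fix y assume "y \<in> \<phi> ` W"
    then obtain q where "q \<in> W" "y = \<phi> q" by blast
    then show "coords (\<lambda>q. tadd (Y q) (Z q)) y = coords Y y + coords Z y"
      using coords_simps(1)[OF qU] by simp
  qed
  then show "chart_conn X (\<lambda>q. tadd (Y q) (Z q)) p = tadd (chart_conn X Y p) (chart_conn X Z p)"
    by (simp add: chart_conn_def covd_def coords_simps(1)[OF pU]
        L.christoffel_simps[OF xU] add_ac flip: cv_simps(1)[OF pU])
  have F: "((f \<circ> \<psi>) has_derivative dd (f \<circ> \<psi>) ?x) (at ?x)"
    using f by (intro smooth_on_has_derivative[OF _ x]) (simp add: smooth_fun_on_chart[OF W])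
  have fp: "(f \<circ> \<psi>) ?x = f p" by (simp add: \<psi>_\<phi> pU)
  have "dd (coords (\<lambda>q. tscale (f q) (Y q))) ?x v
      = f p *\<^sub>R dd (coords Y) ?x v + dd (f \<circ> \<psi>) ?x v *\<^sub>R coords Y ?x" for v
    unfolding fp[symmetric]
  proof (rule dd_eqI, rule has_derivative_transfer_open[OF has_derivative_scaleR[OF F d[OF Y]] o x])
    fix y assume "y \<in> \<phi> ` W"
    then obtain q where "q \<in> W" "y = \<phi> q" by blast
    then show "coords (\<lambda>q. tscale (f q) (Y q)) y = (f \<circ> \<psi>) y *\<^sub>R coords Y y"
      using coords_simps(2)[OF qU] qU by (simp add: \<psi>_\<phi>)
  qed
  moreover have "X p f = dd (f \<circ> \<psi>) ?x (coords X ?x)"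
    by (rule vector_field_apply[OF W X p smooth_nearI[OF f W(1) p]])
  moreover have "Y p = cv p (coords Y ?x)" by (rule vector_field_coords(2)[OF W Y p])
  ultimately show "chart_conn X (\<lambda>q. tscale (f q) (Y q)) p =
      tadd (tscale (X p f) (Y p)) (tscale (f p) (chart_conn X Y p))"
    by (simp add: chart_conn_def covd_def coords_simps(2)[OF pU]
        L.christoffel_simps[OF xU] scaleR_add_right add_ac flip: cv_simps(1,2)[OF pU])
qed

end

section \<open>Gluing the connections of the charts\<close>

context metric_atlas
begin

text \<open>A chart is chosen separately at each point, so neighbouring points may use different
  charts; \<open>lc_connection_chart\<close> removes this dependence.\<close>

definition lc_connection :: "('p \<Rightarrow> 'p tvec) \<Rightarrow> ('p \<Rightarrow> 'p tvec) \<Rightarrow> 'p \<Rightarrow> 'p tvec" where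
  "lc_connection X Y p =
    (let c = (SOME c. c \<in> charts M \<and> p \<in> fst c) in metric_chart.chart_conn M h (fst c) (snd c) X Y p)"

lemma lc_connection_chart_exists:
  assumes "p \<in> points M"
  obtains V \<phi>' where "metric_chart M h V \<phi>'" "p \<in> V"
    "\<And>X Y. lc_connection X Y p = metric_chart.chart_conn M h V \<phi>' X Y p"
proof -
  define c where "c = (SOME c. c \<in> charts M \<and> p \<in> fst c)"
  have c: "c \<in> charts M \<and> p \<in> fst c"
    unfolding c_def by (rule someI_ex) (use chart_exists[OF assms] in force)
  then have "metric_chart M h (fst c) (snd c)" by unfold_locales simp
  then show ?thesis using c by (intro that[of "fst c" "snd c"]) (auto simp: lc_connection_def c_def Let_def)
qed

end

context metric_chart
begin

text \<open>On the overlap with the chosen chart both chart connections are torsion-free and metric,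
  so \<open>lc_on_unique\<close> identifies them.\<close>

lemma lc_connection_chart:
  assumes W: "openin (mtop M) W" and p: "p \<in> W" "p \<in> U"
    and X: "vector_field_on M W X" and Y: "vector_field_on M W Y"
  shows "lc_connection X Y p = chart_conn X Y p"
proof -
  obtain V \<phi>' where V: "metric_chart M h V \<phi>'" "p \<in> V"
    and eq: "\<And>X Y. lc_connection X Y p = metric_chart.chart_conn M h V \<phi>' X Y p"
    by (rule lc_connection_chart_exists[of p]) (use p openin_subset[OF U_open] in auto)
  interpret V: metric_chart M h V \<phi>' by (rule V)
  let ?N = "W \<inter> U \<inter> V"
  have N: "openin (mtop M) ?N" "?N \<subseteq> U" "?N \<subseteq> V" using W U_open V.U_open by auto
  have "V.chart_conn X Y p = chart_conn X Y p"
    by (rule lc_on_unique[OF N(1,2) V.lc_on_chart_conn[OF N(1,3)]])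
      (use p V in \<open>auto intro: vector_field_on_subset[OF X] vector_field_on_subset[OF Y]\<close>)
  then show ?thesis by (simp add: eq)
qed

end

context metric_atlas
begin

lemma is_levi_civita_lc_connection: "is_levi_civita M h lc_connection"
  unfolding is_levi_civita_def
proof (intro conjI allI impI ballI; (elim conjE)?)
  fix W and X Y X' Y' :: "'p \<Rightarrow> 'p tvec" and p
  assume W: "openin (mtop M) W" and p: "p \<in> W" and eq: "\<forall>p\<in>W. X p = X' p \<and> Y p = Y' p"
  obtain V \<phi>' where V: "metric_chart M h V \<phi>'" "p \<in> V"
    and D: "\<And>X Y. lc_connection X Y p = metric_chart.chart_conn M h V \<phi>' X Y p"
    by (rule lc_connection_chart_exists[of p]) (use p openin_subset[OF W] in auto)
  interpret V: metric_chart M h V \<phi>' by (rule V)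
  show "lc_connection X Y p = lc_connection X' Y' p"
    unfolding D by (rule V.chart_conn_cong[of "W \<inter> V"]) (use W V.U_open p V eq in auto)
next
  fix W and X Y Z :: "'p \<Rightarrow> 'p tvec" and f :: "'p \<Rightarrow> real"
  assume W: "openin (mtop M) W" and X: "vector_field_on M W X" and Y: "vector_field_on M W Y"
  show "vector_field_on M W (lc_connection X Y)"
  proof (rule vector_field_on_local[OF W])
    fix p assume p: "p \<in> W"
    then have "p \<in> points M" using openin_subset[OF W] by auto
    then obtain U \<phi> where U: "(U, \<phi>) \<in> charts M" "p \<in> U" using chart_exists by blast
    interpret U: metric_chart M h U \<phi> by unfold_locales (rule U)
    have N: "openin (mtop M) (W \<inter> U)" "W \<inter> U \<subseteq> U" using W U.U_open by auto
    have v: "smooth_on (\<phi> ` (W \<inter> U)) (covd U.G (U.coords X) (U.coords Y))"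
      by (rule U.L.covd_smooth[OF U.open_image[OF N] _ U.vector_field_coords(1)[OF N] U.vector_field_coords(1)[OF N]])
        (auto intro: vector_field_on_subset[OF X] vector_field_on_subset[OF Y])
    \<comment> \<open>The pointwise choice of charts is replaced by one chart throughout
      \<open>W \<inter> U\<close>, where the components are smooth.\<close>
    have "vector_field_on M (W \<inter> U) (lc_connection X Y)"
      by (rule U.vector_fieldI[OF N v])
        (use U.lc_connection_chart[OF W _ _ X Y] in \<open>auto simp: U.chart_conn_def\<close>)
    then show "\<exists>N. openin (mtop M) N \<and> p \<in> N \<and> vector_field_on M N (lc_connection X Y)"
      using N p U by blast
  qed
next
  fix W and X Y Z :: "'p \<Rightarrow> 'p tvec" and f :: "'p \<Rightarrow> real" and p
  assume W: "openin (mtop M) W" and vf: "vector_field_on M W X" "vector_field_on M W Y" "vector_field_on M W Z"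
    and f: "smooth_fun_on M W f" and p: "p \<in> W"
  obtain V \<phi>' where V: "metric_chart M h V \<phi>'" "p \<in> V"
    and D: "\<And>X Y. lc_connection X Y p = metric_chart.chart_conn M h V \<phi>' X Y p"
    by (rule lc_connection_chart_exists[of p]) (use p openin_subset[OF W] in auto)
  interpret V: metric_chart M h V \<phi>' by (rule V)
  have N: "openin (mtop M) (W \<inter> V)" "W \<inter> V \<subseteq> V" "p \<in> W \<inter> V" "W \<inter> V \<subseteq> W" using W V.U_open p V by auto
  note vf' = vf[THEN vector_field_on_subset, OF N(4)]
  note lin = V.chart_conn_linear[OF N(1,2,3) vf' smooth_fun_on_subset[OF f N(4)]]
  show "lc_connection (\<lambda>q. tadd (X q) (Y q)) Z p = tadd (lc_connection X Z p) (lc_connection Y Z p)"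
    unfolding D by (rule lin)
  show "lc_connection (\<lambda>q. tscale (f q) (X q)) Y p = tscale (f p) (lc_connection X Y p)"
    unfolding D by (rule lin)
  show "lc_connection X (\<lambda>q. tadd (Y q) (Z q)) p = tadd (lc_connection X Y p) (lc_connection X Z p)"
    unfolding D by (rule lin)
  show "lc_connection X (\<lambda>q. tscale (f q) (Y q)) p =
      tadd (tscale (X p f) (Y p)) (tscale (f p) (lc_connection X Y p))"
    unfolding D by (rule lin)
  show "lc_connection X Y p = tadd (lc_connection Y X p) (lie_bracket M X Y p)"
    unfolding D by (rule V.chart_conn_torsion[OF N(1,2) vf'(1,2) N(3)])
  show "X p (\<lambda>q. h q (Y q) (Z q)) = h p (lc_connection X Y p) (Z p) + h p (Y p) (lc_connection X Z p)"
    unfolding D by (rule V.chart_conn_metric[OF N(1,2) vf' N(3)])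
qed

lemma is_levi_civita_levi_civita: "is_levi_civita M h (levi_civita M h)"
  unfolding levi_civita_def by (rule someI[of "is_levi_civita M h", OF is_levi_civita_lc_connection])

end

context metric_chart
begin

lemma lc_on_levi_civita:
  assumes W: "openin (mtop M) W" "W \<subseteq> U"
  shows "lc_on M h W (levi_civita M h)"
proof -
  \<comment> \<open>The axioms in \<open>is_levi_civita\<close> also quantify over a smooth
    function; the zero function instantiates it.\<close>
  have z: "smooth_fun_on M W (\<lambda>_. 0)"
    by (simp add: smooth_fun_on_def comp_def smooth_on_const split_def)
  show ?thesis
    unfolding lc_on_def
  proof (intro allI impI)
    fix X Y Z assume "vector_field_on M W X \<and> vector_field_on M W Y \<and> vector_field_on M W Z"
    then have "openin (mtop M) W \<and> vector_field_on M W X \<and> vector_field_on M W Y \<and>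
        vector_field_on M W Z \<and> smooth_fun_on M W (\<lambda>_. 0)" using W z by blast
    from is_levi_civita_levi_civita[unfolded is_levi_civita_def, THEN conjunct2, rule_format, OF this]
    show "vector_field_on M W (levi_civita M h X Y) \<and>
      (\<forall>p\<in>W. levi_civita M h X Y p = tadd (levi_civita M h Y X p) (lie_bracket M X Y p) \<and>
        X p (\<lambda>q. h q (Y q) (Z q)) = h p (levi_civita M h X Y p) (Z p) + h p (Y p) (levi_civita M h X Z p))"
      by blast
  qed
qed

lemma levi_civita_chart:
  assumes W: "openin (mtop M) W" "W \<subseteq> U" and "vector_field_on M W X" "vector_field_on M W Y"
  shows "p \<in> W \<Longrightarrow> levi_civita M h X Y p = cv p (covd G (coords X) (coords Y) (\<phi> p))"
    and "vector_field_on M W (levi_civita M h X Y)"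
    and "x \<in> \<phi> ` W \<Longrightarrow> coords (levi_civita M h X Y) x = covd G (coords X) (coords Y) x"
proof -
  show *: "levi_civita M h X Y p = cv p (covd G (coords X) (coords Y) (\<phi> p))" if "p \<in> W" for p
    using lc_on_unique[OF W lc_on_levi_civita[OF W] assms(3,4) that] by (simp add: chart_conn_def)
  show "vector_field_on M W (levi_civita M h X Y)"
    using lc_on_levi_civita[OF W] assms(3,4) unfolding lc_on_def by blast
  show "x \<in> \<phi> ` W \<Longrightarrow> coords (levi_civita M h X Y) x = covd G (coords X) (coords Y) x"
    by (rule coords_eqI[OF W(2) *])
qed

section \<open>Curvature and Laplacian in a chart\<close>

text \<open>The field with constant components shows that an extension exists; of the chosen one
  only local smoothness and the value at \<open>p\<close> are known.\<close>

lemma local_extension_chart: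
  assumes p: "p \<in> U"
  obtains N where "openin (mtop M) N" "p \<in> N" "N \<subseteq> U" "vector_field_on M N (local_extension M p (cv p u))"
    "coords (local_extension M p (cv p u)) (\<phi> p) = u"
proof -
  let ?X = "local_extension M p (cv p u)"
  have "(\<exists>V. openin (mtop M) V \<and> p \<in> V \<and> vector_field_on M V ?X) \<and> ?X p = cv p u"
    unfolding local_extension_def
    by (rule someI[of _ "\<lambda>p. cv p u"]) (use U_open p constant_vector_field in blast)
  then obtain V where V: "openin (mtop M) V" "p \<in> V" "vector_field_on M V ?X" "?X p = cv p u" by blast
  show ?thesis
    by (rule that[of "V \<inter> U"])
      (use V U_open p vector_field_on_subset[OF V(3)] in \<open>auto simp: coords_def \<psi>_\<phi> vec_cv\<close>)
qed

text \<open>The unknown extensions enter through their values at \<open>p\<close> only, by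
  \<open>covd_curvature\<close>, once they are restricted to a common neighbourhood.\<close>

lemma curvature_at_chart:
  assumes p: "p \<in> U"
  shows "curvature_at M h p (cv p u) (cv p v) (cv p z) = cv p (riem G (\<phi> p) u v z)"
proof -
  let ?x = "\<phi> p" let ?D = "levi_civita M h"
  define X Y Z where "X = local_extension M p (cv p u)" and "Y = local_extension M p (cv p v)"
    and "Z = local_extension M p (cv p z)"
  obtain N1 where N1: "openin (mtop M) N1" "p \<in> N1" "N1 \<subseteq> U" "vector_field_on M N1 X" "coords X ?x = u"
    unfolding X_def by (rule local_extension_chart[OF p])
  obtain N2 where N2: "openin (mtop M) N2" "p \<in> N2" "N2 \<subseteq> U" "vector_field_on M N2 Y" "coords Y ?x = v"
    unfolding Y_def by (rule local_extension_chart[OF p])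
  obtain N3 where N3: "openin (mtop M) N3" "p \<in> N3" "N3 \<subseteq> U" "vector_field_on M N3 Z" "coords Z ?x = z"
    unfolding Z_def by (rule local_extension_chart[OF p])
  define W where "W = N1 \<inter> N2 \<inter> N3"
  have W: "openin (mtop M) W" "W \<subseteq> U" and pW: "p \<in> W" using N1 N2 N3 by (auto simp: W_def)
  have vf: "vector_field_on M W X" "vector_field_on M W Y" "vector_field_on M W Z"
    using N1(4) N2(4) N3(4) by (auto intro: vector_field_on_subset simp: W_def)
  note o = open_image[OF W]
  have x: "?x \<in> \<phi> ` W" using pW by blast
  have D2: "?D A (?D B Z) p = cv p (covd G (coords A) (covd G (coords B) (coords Z)) ?x)"
    \<comment> \<open>The inner derivative is differentiated again, so its coordinate expression is
      used on all of \<open>W\<close>, not merely at \<open>p\<close>.\<close>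
    if A: "vector_field_on M W A" and B: "vector_field_on M W B" for A B
    unfolding levi_civita_chart(1)[OF W A levi_civita_chart(2)[OF W B vf(3)] pW]
    by (rule arg_cong[where f = "cv p"], rule L.covd_cong[OF o x refl levi_civita_chart(3)[OF W B vf(3)]])
  have "coords (lie_bracket M X Y) ?x = bracket (coords X) (coords Y) ?x"
    by (rule coords_eqI[OF W(2) lie_bracket_chart[OF W vf(1,2)] x])
  then have D3: "?D (lie_bracket M X Y) Z p = cv p (covd G (bracket (coords X) (coords Y)) (coords Z) ?x)"
    unfolding levi_civita_chart(1)[OF W lie_bracket_vector_field[OF W vf(1,2)] vf(3) pW]
    by (intro arg_cong[where f = "cv p"] L.covd_cong[OF o x]) auto
  have "covd G (coords X) (covd G (coords Y) (coords Z)) ?x - covd G (coords Y) (covd G (coords X) (coords Z)) ?x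
      - covd G (bracket (coords X) (coords Y)) (coords Z) ?x = riem G ?x u v z"
    using L.covd_curvature[OF o _ x vector_field_coords(1)[OF W vf(1)] vector_field_coords(1)[OF W vf(2)]
        vector_field_coords(1)[OF W vf(3)]] W N1(5) N2(5) N3(5) by auto
  then show ?thesis
    unfolding curvature_at_def curvature_def Let_def X_def[symmetric] Y_def[symmetric] Z_def[symmetric]
      D2[OF vf(1,2)] D2[OF vf(2,1)] D3 cv_simps(3)[OF p, symmetric] by simp
qed

text \<open>A frame of the coordinate form transports to \<open>p\<close>, so the chosen frame
  exists; bilinearity of \<open>T\<close> makes the sum independent of which one it is.\<close>

lemma metric_trace_chart:
  assumes p: "p \<in> U" and T: "bilinear (\<lambda>u v. T (cv p u) (cv p v))"
  shows "metric_trace M h p T = ftrace (G (\<phi> p)) (\<lambda>u v. T (cv p u) (cv p v))"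
proof -
  have x: "\<phi> p \<in> \<phi> ` U" using p by blast
  define E where "E = (SOME E. orthonormal_frame M h p E)"
  obtain e where e: "frame (G (\<phi> p)) e" using frame_exists[OF L.nondeg[OF x]] by blast
  have "orthonormal_frame M h p (\<lambda>i. cv p (e i))"
    using e p by (simp add: orthonormal_frame_def frame_def cv_tangent metric_cv)
  then have E: "orthonormal_frame M h p E" unfolding E_def by (rule someI[of "orthonormal_frame M h p"])
  define f where "f i = vec (E i)" for i
  have Ef: "E i = cv p (f i)" if "i < DIM('e)" for i
    using E that p by (simp add: f_def cv_vec orthonormal_frame_def)
  have f: "frame (G (\<phi> p)) f"
    unfolding frame_def
  proof (intro allI impI conjI)
    fix i assume i: "i < DIM('e)"
    show "\<bar>G (\<phi> p) (f i) (f i)\<bar> = 1"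
    proof -
      have "\<bar>h p (E i) (E i)\<bar> = 1" using E i unfolding orthonormal_frame_def by blast
      then show ?thesis by (simp add: Ef[OF i] metric_cv[OF p])
    qed
    fix j assume j: "j < DIM('e)" "i \<noteq> j"
    have "h p (E i) (E j) = 0" using E i j unfolding orthonormal_frame_def by blast
    then show "G (\<phi> p) (f i) (f j) = 0" by (simp add: Ef[OF i] Ef[OF j(1)] metric_cv[OF p])
  qed
  have "metric_trace M h p T = (\<Sum>i<DIM('e). G (\<phi> p) (f i) (f i) * T (cv p (f i)) (cv p (f i)))"
    unfolding metric_trace_def E_def[symmetric] Let_def
    by (intro sum.cong refl) (simp add: Ef metric_cv[OF p])
  then show ?thesis using ftrace_frame[OF L.nondeg[OF x] f T] by simp
qed

lemma scalar_curvature_chart: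
  assumes p: "p \<in> U"
  shows "scalar_curvature M h p = scal G (\<phi> p)"
proof -
  have x: "\<phi> p \<in> \<phi> ` U" using p by blast
  have "ricci M h p (cv p u) (cv p v) = ftrace (G (\<phi> p)) (\<lambda>e e'. G (\<phi> p) (riem G (\<phi> p) e v u) e')" for u v
    unfolding ricci_def
    by (subst metric_trace_chart[OF p]) (simp_all add: curvature_at_chart[OF p] metric_cv[OF p] L.riem_bilinear[OF x])
  then show ?thesis
    unfolding scalar_curvature_def scal_def
    by (subst metric_trace_chart[OF p]) (simp_all add: L.ricci_bilinear[OF x])
qed

context
  fixes f assumes f: "smooth_fun_on M (points M) f"
begin

lemma smooth_chart_expr: "smooth_on (\<phi> ` U) (f \<circ> \<psi>)"
  using smooth_fun_on_subset[OF f openin_subset[OF U_open]] smooth_fun_on_chart[OF U_open subset_refl] by blast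

lemma gradient_chart:
  assumes p: "p \<in> U"
  shows "gradient M h f p = cv p (cgrad G (f \<circ> \<psi>) (\<phi> p))"
proof -
  have x: "\<phi> p \<in> \<phi> ` U" using p by blast
  have "p \<in> points M" using p openin_subset[OF U_open] by auto
  then have near: "smooth_near M p f" using smooth_nearI[OF f openin_topspace] by blast
  have *: "h p (cv p t) (cv p u) = cv p u f \<longleftrightarrow> G (\<phi> p) t u = G (\<phi> p) (cgrad G (f \<circ> \<psi>) (\<phi> p)) u" for t u
    by (simp add: metric_cv[OF p] cv_apply[OF near] L.cgrad[OF x smooth_chart_expr])
  show ?thesis
    unfolding gradient_def
  proof (rule the_equality)
    show "cv p (cgrad G (f \<circ> \<psi>) (\<phi> p)) \<in> tangent_space M p \<and>
      (\<forall>u\<in>tangent_space M p. h p (cv p (cgrad G (f \<circ> \<psi>) (\<phi> p))) u = u f)"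
      using * by (auto simp: tangent_space_chart[OF p])
    fix t assume t: "t \<in> tangent_space M p \<and> (\<forall>u\<in>tangent_space M p. h p t u = u f)"
    then obtain v where v: "t = cv p v" using tangent_space_chart[OF p] by blast
    have "G (\<phi> p) v u = G (\<phi> p) (cgrad G (f \<circ> \<psi>) (\<phi> p)) u" for u
      using t *[of v u] cv_tangent[OF p, of u] v by blast
    then have "v = cgrad G (f \<circ> \<psi>) (\<phi> p)" by (rule L.eqI[OF x])
    then show "t = cv p (cgrad G (f \<circ> \<psi>) (\<phi> p))" by (simp add: v)
  qed
qed

text \<open>The extension of \<open>u\<close> matters at \<open>p\<close> only, while the gradient
  is differentiated and must be known as a smooth field around \<open>p\<close>.\<close>

lemma hessian_chart:
  assumes p: "p \<in> U"
  shows "hessian M h f p (cv p u) (cv p v) = hess G (f \<circ> \<psi>) (\<phi> p) u v"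
proof -
  let ?F = "f \<circ> \<psi>" let ?X = "local_extension M p (cv p u)"
  obtain N where N: "openin (mtop M) N" "p \<in> N" "N \<subseteq> U" "vector_field_on M N ?X" "coords ?X (\<phi> p) = u"
    by (rule local_extension_chart[OF p])
  have x: "\<phi> p \<in> \<phi> ` N" "\<phi> p \<in> \<phi> ` U" using N p by auto
  have grad: "vector_field_on M U (gradient M h f)"
    by (rule vector_fieldI[OF U_open subset_refl L.cgrad_smooth[OF smooth_chart_expr] gradient_chart])
  have "levi_civita M h ?X (gradient M h f) p = cv p (covd G (coords ?X) (coords (gradient M h f)) (\<phi> p))"
    by (rule levi_civita_chart(1)[OF N(1,3,4) vector_field_on_subset[OF grad N(3)] N(2)])
  also have "covd G (coords ?X) (coords (gradient M h f)) (\<phi> p) = covd G (coords ?X) (cgrad G ?F) (\<phi> p)"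
    by (rule L.covd_cong[OF image_open x(2) refl coords_eqI[OF subset_refl gradient_chart]])
  finally show ?thesis
    using L.cgrad_covd[OF x(2) smooth_chart_expr, of "coords ?X" v] N(5) by (simp add: hessian_def metric_cv[OF p])
qed

lemma laplacian_chart:
  assumes p: "p \<in> U"
  shows "laplacian M h f p = ftrace (G (\<phi> p)) (hess G (f \<circ> \<psi>) (\<phi> p))"
proof -
  have "\<phi> p \<in> \<phi> ` U" using p by blast
  then have "bilinear (hess G (f \<circ> \<psi>) (\<phi> p))" by (rule L.hess_bilinear[OF _ smooth_chart_expr])
  then show ?thesis
    unfolding laplacian_def by (subst metric_trace_chart[OF p]) (simp_all add: hessian_chart[OF p])
qed

end

end

section \<open>Products of charts\<close>

lemma smooth_on_Pair:
  fixes f :: "'a::euclidean_space \<Rightarrow> 'b::real_normed_vector" and g :: "'a \<Rightarrow> 'c::real_normed_vector"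
  assumes "open S" "smooth_on S f" "smooth_on S g"
  shows "smooth_on S (\<lambda>x. (f x, g x))"
proof -
  have "smooth_on S (\<lambda>x. (f x, 0 :: 'c))" "smooth_on S (\<lambda>x. (0 :: 'b, g x))"
    using smooth_on_bounded_linear_compose[OF assms(1) bounded_linear_Pair[OF bounded_linear_ident bounded_linear_zero] assms(2)]
      smooth_on_bounded_linear_compose[OF assms(1) bounded_linear_Pair[OF bounded_linear_zero bounded_linear_ident] assms(3)]
    by simp_all
  from smooth_on_add[OF assms(1) this] show ?thesis by simp
qed

lemma inv_into_map_prod:
  assumes "inj_on f A" "inj_on g B" "a \<in> f ` A" "b \<in> g ` B"
  shows "inv_into (A \<times> B) (map_prod f g) (a, b) = (inv_into A f a, inv_into B g b)"
  by (rule inv_into_f_eq)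
    (use assms in \<open>auto simp: map_prod_inj_on f_inv_into_f inv_into_into\<close>)

lemma homeomorphic_map_map_prod:
  assumes "homeomorphic_map (subtopology X A) (top_of_set A') f"
    and "homeomorphic_map (subtopology Y B) (top_of_set B') g"
  shows "homeomorphic_map (subtopology (prod_topology X Y) (A \<times> B)) (top_of_set (A' \<times> B')) (map_prod f g)"
proof -
  obtain f' g' where "homeomorphic_maps (subtopology X A) (top_of_set A') f f'"
    "homeomorphic_maps (subtopology Y B) (top_of_set B') g g'"
    using assms unfolding homeomorphic_map_maps by blast
  then have "homeomorphic_maps (prod_topology (subtopology X A) (subtopology Y B))
      (prod_topology (top_of_set A') (top_of_set B')) (map_prod f g) (\<lambda>(x, y). (f' x, g' y))"
    unfolding map_prod_def homeomorphic_maps_prod by blast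
  moreover have "prod_topology (top_of_set A') (top_of_set B') = top_of_set (A' \<times> B')"
    by (metis prod_topology_euclidean subtopology_Times)
  ultimately show ?thesis
    unfolding homeomorphic_map_maps subtopology_Times by auto
qed

lemma charts_product_manifold:
  "c \<in> charts (product_manifold B F) \<longleftrightarrow>
    (\<exists>U \<phi> V \<psi>. c = (U \<times> V, map_prod \<phi> \<psi>) \<and> (U, \<phi>) \<in> charts B \<and> (V, \<psi>) \<in> charts F)"
  by (simp add: product_manifold_def)

lemma mtop_product_manifold: "mtop (product_manifold B F) = prod_topology (mtop B) (mtop F)"
  by (simp add: product_manifold_def)

lemma atlas_product_manifold:
  fixes B :: "('p, 'a::euclidean_space) smooth_structure" and F :: "('q, 'b::euclidean_space) smooth_structure"
  assumes "atlas B" "atlas F"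
  shows "atlas (product_manifold B F)"
proof -
  interpret B: atlas B by (rule assms)
  interpret F: atlas F by (rule assms)
  show ?thesis
  proof
    fix z assume "z \<in> points (product_manifold B F)"
    then have "fst z \<in> points B" "snd z \<in> points F" by (auto simp: mtop_product_manifold)
    then obtain U \<phi> V \<psi> where "(U, \<phi>) \<in> charts B" "fst z \<in> U" "(V, \<psi>) \<in> charts F" "snd z \<in> V"
      using B.chart_exists F.chart_exists by metis
    then show "\<exists>U \<phi>. (U, \<phi>) \<in> charts (product_manifold B F) \<and> z \<in> U"
      unfolding charts_product_manifold
      by (intro exI[of _ "U \<times> V"] exI[of _ "map_prod \<phi> \<psi>"]) (auto simp: mem_Times_iff)
  next
    fix N \<theta> assume "(N, \<theta>) \<in> charts (product_manifold B F)"
    then obtain U \<phi> V \<psi> where N: "N = U \<times> V" "\<theta> = map_prod \<phi> \<psi>" and c: "(U, \<phi>) \<in> charts B" "(V, \<psi>) \<in> charts F"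
      by (auto simp: charts_product_manifold)
    show "openin (mtop (product_manifold B F)) N"
      using B.chart_open[OF c(1)] F.chart_open[OF c(2)] by (simp add: N mtop_product_manifold openin_prod_Times_iff)
    show "open (\<theta> ` N)"
      unfolding N map_prod_surj_on[OF refl refl]
      by (rule open_Times[OF B.chart_image_open[OF c(1)] F.chart_image_open[OF c(2)]])
    show "homeomorphic_map (subtopology (mtop (product_manifold B F)) N) (top_of_set (\<theta> ` N)) \<theta>"
      unfolding N mtop_product_manifold map_prod_surj_on[OF refl refl]
      by (rule homeomorphic_map_map_prod[OF B.chart_homeo[OF c(1)] F.chart_homeo[OF c(2)]])
    fix N' \<theta>' assume "(N', \<theta>') \<in> charts (product_manifold B F)"
    then obtain U' \<phi>' V' \<psi>' where N': "N' = U' \<times> V'" "\<theta>' = map_prod \<phi>' \<psi>'"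
      and c': "(U', \<phi>') \<in> charts B" "(V', \<psi>') \<in> charts F"
      by (auto simp: charts_product_manifold)
    interpret BU: chart B U \<phi> by unfold_locales (rule c)
    interpret FV: chart F V \<psi> by unfold_locales (rule c)
    have im: "\<theta> ` (N \<inter> N') = \<phi> ` (U \<inter> U') \<times> \<psi> ` (V \<inter> V')"
      unfolding N N' Times_Int_Times by (rule map_prod_surj_on) auto
    have o: "open (\<phi> ` (U \<inter> U'))" "open (\<psi> ` (V \<inter> V'))"
      using BU.open_image[of "U \<inter> U'"] FV.open_image[of "V \<inter> V'"] BU.U_open FV.U_open
        B.chart_open[OF c'(1)] F.chart_open[OF c'(2)] by auto
    show "smooth_on (\<theta> ` (N \<inter> N')) (\<theta>' \<circ> inv_into N \<theta>)"
      unfolding im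
    proof (rule smooth_on_transfer[OF open_Times[OF o]])
      show "smooth_on (\<phi> ` (U \<inter> U') \<times> \<psi> ` (V \<inter> V')) (\<lambda>z. ((\<phi>' \<circ> inv_into U \<phi>) (fst z), (\<psi>' \<circ> inv_into V \<psi>) (snd z)))"
        by (intro smooth_on_Pair open_Times o smooth_on_comp_fst[OF o B.transition[OF c(1) c'(1)]]
            smooth_on_comp_snd[OF o F.transition[OF c(2) c'(2)]])
      show "(\<theta>' \<circ> inv_into N \<theta>) z = ((\<phi>' \<circ> inv_into U \<phi>) (fst z), (\<psi>' \<circ> inv_into V \<psi>) (snd z))"
        if "z \<in> \<phi> ` (U \<inter> U') \<times> \<psi> ` (V \<inter> V')" for z
        using that inv_into_map_prod[OF BU.inj FV.inj, of "fst z" "snd z"] by (auto simp: N N')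
    qed
  qed
qed

locale product_chart = B: chart B U \<phi> + F: chart F V \<psi>'
  for B :: "('p, 'a::euclidean_space) smooth_structure" and U \<phi>
    and F :: "('q, 'b::euclidean_space) smooth_structure" and V \<psi>'
begin

abbreviation P where "P \<equiv> product_manifold B F"

lemma product_chart: "(U \<times> V, map_prod \<phi> \<psi>') \<in> charts P"
  unfolding charts_product_manifold using B.chart F.chart by blast

sublocale P: chart P "U \<times> V" "map_prod \<phi> \<psi>'"
  using atlas_product_manifold[OF B.atlas_axioms F.atlas_axioms] product_chart
  by (simp add: chart_def chart_axioms_def)

lemma product_image: "map_prod \<phi> \<psi>' ` (A \<times> C) = \<phi> ` A \<times> \<psi>' ` C"
  by (rule map_prod_surj_on[OF refl refl])

lemma product_inv:
  "x \<in> \<phi> ` U \<Longrightarrow> y \<in> \<psi>' ` V \<Longrightarrow> P.\<psi> (x, y) = (B.\<psi> x, F.\<psi> y)"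
  by (rule inv_into_map_prod[OF B.inj F.inj])

text \<open>In the product chart \<open>f \<circ> fst\<close> is the expression of \<open>f\<close>
  composed with the first projection, so its differential sees \<open>fst u\<close> only. Both sides
  are 0 on functions not smooth near \<open>p\<close>.\<close>

lemma pushforward_fst:
  assumes p: "p \<in> U" "q \<in> V"
  shows "pushforward B fst (p, q) (P.cv (p, q) u) = B.cv p (fst u)"
proof
  fix f show "pushforward B fst (p, q) (P.cv (p, q) u) f = B.cv p (fst u) f"
  proof (cases "smooth_near B p f")
    case True
    then obtain W where W: "openin (mtop B) W" "p \<in> W" "W \<subseteq> U" "open (\<phi> ` W)" "smooth_on (\<phi> ` W) (f \<circ> B.\<psi>)"
      by (rule B.smooth_near_chart[OF p(1)])
    have o: "open (\<phi> ` W \<times> \<psi>' ` V)" by (rule open_Times[OF W(4) F.image_open])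
    have N: "openin (mtop P) (W \<times> V)" "W \<times> V \<subseteq> U \<times> V"
      using W F.U_open by (auto simp: mtop_product_manifold openin_prod_Times_iff)
    have eq: "((f \<circ> fst) \<circ> P.\<psi>) z = (f \<circ> B.\<psi>) (fst z)" if "z \<in> \<phi> ` W \<times> \<psi>' ` V" for z
      using that product_inv[of "fst z" "snd z"] W(3) by auto
    have "smooth_fun_on P (W \<times> V) (f \<circ> fst)"
      unfolding P.smooth_fun_on_chart[OF N] product_image
      by (rule smooth_on_transfer[OF o smooth_on_comp_fst[OF W(4) F.image_open W(5)] eq])
    then have near: "smooth_near P (p, q) (f \<circ> fst)" by (rule smooth_nearI[OF _ N(1)]) (use W p in auto)
    have "P.cv (p, q) u (f \<circ> fst) = dd ((f \<circ> fst) \<circ> P.\<psi>) (\<phi> p, \<psi>' q) u"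
      using P.cv_apply[OF near] by simp
    also have "\<dots> = dd (\<lambda>z. (f \<circ> B.\<psi>) (fst z)) (\<phi> p, \<psi>' q) u"
      by (rule fun_cong[OF dd_cong[OF o _ eq]]) (use W p in auto)
    also have "\<dots> = dd (f \<circ> B.\<psi>) (\<phi> p) (fst u)"
      using smooth_on_differentiable[OF W(5), of "\<phi> p"] W(2)
        dd_eqI[OF has_derivative_comp_fst[of "f \<circ> B.\<psi>" "(\<phi> p, \<psi>' q)"], of u] by simp
    finally show ?thesis using True by (simp add: pushforward_def B.cv_apply)
  qed (simp add: pushforward_def coord_vector_def)
qed

lemma pushforward_snd:
  assumes p: "p \<in> U" "q \<in> V"
  shows "pushforward F snd (p, q) (P.cv (p, q) u) = F.cv q (snd u)"
proof
  fix f show "pushforward F snd (p, q) (P.cv (p, q) u) f = F.cv q (snd u) f"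
  proof (cases "smooth_near F q f")
    case True
    then obtain W where W: "openin (mtop F) W" "q \<in> W" "W \<subseteq> V" "open (\<psi>' ` W)" "smooth_on (\<psi>' ` W) (f \<circ> F.\<psi>)"
      by (rule F.smooth_near_chart[OF p(2)])
    have o: "open (\<phi> ` U \<times> \<psi>' ` W)" by (rule open_Times[OF B.image_open W(4)])
    have N: "openin (mtop P) (U \<times> W)" "U \<times> W \<subseteq> U \<times> V"
      using W B.U_open by (auto simp: mtop_product_manifold openin_prod_Times_iff)
    have eq: "((f \<circ> snd) \<circ> P.\<psi>) z = (f \<circ> F.\<psi>) (snd z)" if "z \<in> \<phi> ` U \<times> \<psi>' ` W" for z
      using that product_inv[of "fst z" "snd z"] W(3) by auto
    have "smooth_fun_on P (U \<times> W) (f \<circ> snd)"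
      unfolding P.smooth_fun_on_chart[OF N] product_image
      by (rule smooth_on_transfer[OF o smooth_on_comp_snd[OF B.image_open W(4) W(5)] eq])
    then have near: "smooth_near P (p, q) (f \<circ> snd)" by (rule smooth_nearI[OF _ N(1)]) (use W p in auto)
    have "P.cv (p, q) u (f \<circ> snd) = dd ((f \<circ> snd) \<circ> P.\<psi>) (\<phi> p, \<psi>' q) u"
      using P.cv_apply[OF near] by simp
    also have "\<dots> = dd (\<lambda>z. (f \<circ> F.\<psi>) (snd z)) (\<phi> p, \<psi>' q) u"
      by (rule fun_cong[OF dd_cong[OF o _ eq]]) (use W p in auto)
    also have "\<dots> = dd (f \<circ> F.\<psi>) (\<psi>' q) (snd u)"
      using smooth_on_differentiable[OF W(5), of "\<psi>' q"] W(2)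
        dd_eqI[OF has_derivative_comp_snd[of "f \<circ> F.\<psi>" "(\<phi> p, \<psi>' q)"], of u] by simp
    finally show ?thesis using True by (simp add: pushforward_def F.cv_apply)
  qed (simp add: pushforward_def coord_vector_def)
qed

lemma chart_metric_warped:
  assumes z: "z \<in> \<phi> ` U \<times> \<psi>' ` V"
  shows "chart_metric P (warped_metric B gB F gF c w) (U \<times> V, map_prod \<phi> \<psi>') z =
    warp (chart_metric B gB (U, \<phi>)) (chart_metric F gF (V, \<psi>')) (c \<circ> B.\<psi>) (w \<circ> B.\<psi>) z"
proof (intro ext)
  fix u v
  obtain x y where xy: "z = (x, y)" "x \<in> \<phi> ` U" "y \<in> \<psi>' ` V" using z by blast
  have "B.\<psi> x \<in> U" "F.\<psi> y \<in> V" using xy by (auto intro: inv_into_into)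
  then show "chart_metric P (warped_metric B gB F gF c w) (U \<times> V, map_prod \<phi> \<psi>') z u v =
    warp (chart_metric B gB (U, \<phi>)) (chart_metric F gF (V, \<psi>')) (c \<circ> B.\<psi>) (w \<circ> B.\<psi>) z u v"
    by (simp add: xy chart_metric_def warp_def warped_metric_def pullback_metric_def product_inv
        pushforward_fst pushforward_snd)
qed

end

section \<open>From a product chart to the manifold\<close>

lemma local_metric_cong:
  assumes "local_metric S G" "\<And>x. x \<in> S \<Longrightarrow> G' x = G x"
  shows "local_metric S G'"
proof -
  interpret local_metric S G by (rule assms)
  show ?thesis
    unfolding local_metric_def
  proof
    show "smooth_on S (\<lambda>x. G' x u v)" for u v
      by (rule smooth_on_transfer[OF open_S smooth[of u v]]) (simp add: assms(2))
  qed (simp_all add: open_S assms(2) nondeg)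
qed

text \<open>Two derivatives of the metric enter, so agreement at the point would not suffice: it
  passes to the Christoffel maps on all of \<open>S\<close>, and from there to the curvature at
  \<open>x\<close>.\<close>

lemma scal_cong:
  assumes S: "open S" "x \<in> S" and eq: "\<And>y. y \<in> S \<Longrightarrow> G' y = G y"
  shows "scal G' x = scal G x"
proof -
  have chr: "christoffel G' y = christoffel G y" if y: "y \<in> S" for y
  proof -
    have "dd (\<lambda>y. G' y u v) y = dd (\<lambda>y. G y u v) y" for u v
      by (rule dd_cong[OF S(1) y]) (simp add: eq)
    then show ?thesis by (simp add: christoffel_def fun_eq_iff eq[OF y])
  qed
  have "dd (\<lambda>y. christoffel G' y u v) x = dd (\<lambda>y. christoffel G y u v) x" for u v
    by (rule dd_cong[OF S]) (simp add: chr)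
  then have "riem G' x = riem G x" by (simp add: riem_def fun_eq_iff chr[OF S(2)])
  then show ?thesis by (simp add: scal_def eq[OF S(2)])
qed

locale warped_charts = B: metric_chart B gB U \<phi> + F: metric_chart F gF V \<psi>'
  for B :: "('p, 'a::euclidean_space) smooth_structure" and gB U \<phi>
    and F :: "('q, 'b::euclidean_space) smooth_structure" and gF V \<psi>' +
  fixes c w :: "'p \<Rightarrow> real"
  assumes c: "smooth_fun_on B (points B) c" "\<And>x. x \<in> points B \<Longrightarrow> 0 < c x"
    and w: "smooth_fun_on B (points B) w" "\<And>x. x \<in> points B \<Longrightarrow> 0 < w x"
begin

sublocale product_chart B U \<phi> F V \<psi>' ..

sublocale warped: local_warped "\<phi> ` U" B.G "\<psi>' ` V" F.G "c \<circ> B.\<psi>" "w \<circ> B.\<psi>"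
proof
  show "smooth_on (\<phi> ` U) (c \<circ> B.\<psi>)" "smooth_on (\<phi> ` U) (w \<circ> B.\<psi>)"
    using B.smooth_chart_expr c w by blast+
  fix x assume "x \<in> \<phi> ` U"
  then have "B.\<psi> x \<in> points B" using B.\<psi>_in openin_subset[OF B.U_open] by blast
  then show "0 < (c \<circ> B.\<psi>) x" "0 < (w \<circ> B.\<psi>) x" using c w by auto
qed

lemma local_metric_chart_warped:
  "local_metric (map_prod \<phi> \<psi>' ` (U \<times> V)) (chart_metric P (warped_metric B gB F gF c w) (U \<times> V, map_prod \<phi> \<psi>'))"
  unfolding product_image
  by (rule local_metric_cong[OF warped.local_metric_warp chart_metric_warped])

end

text \<open>Every chart of the product is by construction a product of charts, so the metric has the
  form \<open>warp\<close> in each of them.\<close>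

lemma metric_atlas_warped:
  assumes "metric_atlas B gB" "metric_atlas F gF"
    and "smooth_fun_on B (points B) c" "\<And>x. x \<in> points B \<Longrightarrow> 0 < c x"
    and "smooth_fun_on B (points B) w" "\<And>x. x \<in> points B \<Longrightarrow> 0 < w x"
  shows "metric_atlas (product_manifold B F) (warped_metric B gB F gF c w)"
proof -
  interpret B: metric_atlas B gB by (rule assms)
  interpret F: metric_atlas F gF by (rule assms)
  show ?thesis
  proof (intro metric_atlas.intro metric_atlas_axioms.intro)
    show "atlas (product_manifold B F)"
      by (rule atlas_product_manifold[OF B.atlas_axioms F.atlas_axioms])
    fix N \<theta> assume "(N, \<theta>) \<in> charts (product_manifold B F)"
    then obtain U \<phi> V \<psi> where N: "N = U \<times> V" "\<theta> = map_prod \<phi> \<psi>" and ch: "(U, \<phi>) \<in> charts B" "(V, \<psi>) \<in> charts F"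
      by (auto simp: charts_product_manifold)
    interpret warped_charts B gB U \<phi> F gF V \<psi> c w
      by unfold_locales (use ch assms in auto)
    show "local_metric (\<theta> ` N) (chart_metric (product_manifold B F) (warped_metric B gB F gF c w) (N, \<theta>))"
      unfolding N by (rule local_metric_chart_warped)
  qed
qed

theorem theorem3p16:
  fixes B :: "('p, 'a::euclidean_space) smooth_structure" and gB :: "'p metric_field"
    and F :: "('q, 'b::euclidean_space) smooth_structure" and gF :: "'q metric_field"
    and c w :: "'p \<Rightarrow> real" and m k :: real and p :: 'p and q :: 'q
  assumes "pseudo_riemannian B gB" and "pseudo_riemannian F gF"
    and "m = real DIM('a)" and "k = real DIM('b)"
    and "smooth_fun_on B (points B) c" and "\<forall>x\<in>points B. 0 < c x"
    and "smooth_fun_on B (points B) w" and "\<forall>x\<in>points B. 0 < w x"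
    and "p \<in> points B" and "q \<in> points F"
  shows "(c p)\<^sup>2 * scalar_curvature (product_manifold B F) (warped_metric B gB F gF c w) (p, q) =
      scalar_curvature B gB p
      + scalar_curvature F gF q * ((c p)\<^sup>2 / (w p)\<^sup>2)
      - 2 * (m - 1) * (laplacian B gB c p / c p)
      - 2 * k * (laplacian B gB w p / w p)
      - (m - 4) * (m - 1) * (gB p (gradient B gB c p) (gradient B gB c p) / (c p)\<^sup>2)
      - 2 * k * (m - 2) * (gB p (gradient B gB w p) (gradient B gB c p) / (w p * c p))
      - k * (k - 1) * (gB p (gradient B gB w p) (gradient B gB w p) / (w p)\<^sup>2)"
proof -
  interpret B: metric_atlas B gB by (rule pseudo_riemannian_metric_atlas[OF assms(1)])
  interpret F: metric_atlas F gF by (rule pseudo_riemannian_metric_atlas[OF assms(2)])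
  obtain U \<phi> V \<psi> where ch: "(U, \<phi>) \<in> charts B" "(V, \<psi>) \<in> charts F" and p: "p \<in> U" and q: "q \<in> V"
    using B.chart_exists[OF assms(9)] F.chart_exists[OF assms(10)] by blast
  interpret warped_charts B gB U \<phi> F gF V \<psi> c w
    by unfold_locales (use ch assms in auto)
  interpret PW: metric_chart P "warped_metric B gB F gF c w" "U \<times> V" "map_prod \<phi> \<psi>"
  proof (intro metric_chart.intro)
    show "metric_atlas P (warped_metric B gB F gF c w)"
      by (rule metric_atlas_warped[OF B.metric_atlas_axioms F.metric_atlas_axioms c w])
    show "chart P (U \<times> V) (map_prod \<phi> \<psi>)" by (rule P.chart_axioms)
  qed
  have x: "\<phi> p \<in> \<phi> ` U" "\<psi> q \<in> \<psi> ` V" using p q by auto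
  have "scalar_curvature P (warped_metric B gB F gF c w) (p, q) =
      scal (chart_metric P (warped_metric B gB F gF c w) (U \<times> V, map_prod \<phi> \<psi>)) (\<phi> p, \<psi> q)"
    using PW.scalar_curvature_chart[of "(p, q)"] p q by simp
  \<comment> \<open>The chart metric and \<open>warped.W\<close> are known to agree over the image
    of the chart, an open neighbourhood of the point, which suffices for the curvature
    there.\<close>
  also have "\<dots> = scal warped.W (\<phi> p, \<psi> q)"
    by (rule scal_cong[OF open_Times[OF B.image_open F.image_open] _ chart_metric_warped]) (use x in auto)
  finally have S: "scalar_curvature P (warped_metric B gB F gF c w) (p, q) = scal warped.W (\<phi> p, \<psi> q)" .
  have e: "(c \<circ> B.\<psi>) (\<phi> p) = c p" "(w \<circ> B.\<psi>) (\<phi> p) = w p" by (simp_all add: B.\<psi>_\<phi>[OF p])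
  show ?thesis
    unfolding S B.scalar_curvature_chart[OF p] F.scalar_curvature_chart[OF q]
      B.laplacian_chart[OF c(1) p] B.laplacian_chart[OF w(1) p]
      B.gradient_chart[OF c(1) p] B.gradient_chart[OF w(1) p] B.metric_cv[OF p]
    using warped.scal_warp[OF x assms(3,4)] unfolding e .
qed

end
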